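(* (a) Let $n$ and $k$ be integers such that $n \rightarrow \infty$ with $n \equiv k+1 \pmod{2k}$, $k=o(n)$, and $k \geq 3$ is odd. Then $\mathrm{SP}(n,k) \sim \mathrm{MMS}(n,k)$. (b) Let $n$ and $k$ be integers such that $n \rightarrow \infty$ with $n \equiv k-1 \pmod{2k}$, $k=o(n)$, and $k \geq 5$ is odd. Then $\mathrm{SP}(n,k) \sim \mathrm{MMS}(n,k)$.
   Context: For integers $n \geq k \geq 1$, an $(n,k)$-Sperner partition system is a set of partitions of some $n$-set such that each partition has exactly $k$ nonempty parts and no part in any partition is a subset of a part in a different partition. $\mathrm{SP}(n,k)$ denotes the maximum number of partitions in an $(n,k)$-Sperner partition system. With $c,r$ the unique integers such that $n=ck+r$ and $r\in\{0,\ldots,k-1\}$, \[\mathrm{MMS}(n,k) = \frac{\binom{n}{c}}{k-r+\frac{r(c+1)}{n-c}}.\] Asymptotic statements are along any sequence of pairs $(n,k)$ (with $k$ allowed to vary with $n$) with $n\to\infty$ satisfying the stated hypotheses; $f\sim g$ means $f/g\to 1$ along the sequence. *)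

theory Defs
  imports
    Complex_Main
    "HOL-Library.Disjoint_Sets"
    "HOL-Library.Landau_Symbols"
    "HOL-Number_Theory.Cong"
begin

definition sperner_partition_system :: "'a set \<Rightarrow> nat \<Rightarrow> 'a set set set \<Rightarrow> bool" where
  "sperner_partition_system X k S \<longleftrightarrow>
     (\<forall>P\<in>S. partition_on X P \<and> card P = k) \<and>
     (\<forall>P\<in>S. \<forall>Q\<in>S. P \<noteq> Q \<longrightarrow> (\<forall>A\<in>P. \<forall>B\<in>Q. \<not> A \<subseteq> B))"

text \<open>
  The ground set is fixed to be \<open>{..<n}\<close>; by \<open>card_le_SP\<close> and \<open>SP_attained\<close> below the value is the
  maximum over the systems on any set with \<open>n\<close> elements.
\<close>

definition SP :: "nat \<Rightarrow> nat \<Rightarrow> nat" where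
  "SP n k = Max {card S |S. sperner_partition_system {..<n} k S}"

definition MMS :: "nat \<Rightarrow> nat \<Rightarrow> real" where
  "MMS n k =
     (let c = n div k; r = n mod k
      in real (n choose c) / (real k - real r + real r * (real c + 1) / (real n - real c)))"

lemma finite_sperner_partition_systems:
  assumes "finite X"
  shows "finite {S. sperner_partition_system X k S}"
proof (rule finite_subset)
  show "{S. sperner_partition_system X k S} \<subseteq> Pow (Pow (Pow X))"
    by (auto simp: sperner_partition_system_def partition_on_def)
qed (use assms in simp)

lemma sperner_partition_system_image:
  assumes S: "sperner_partition_system X k S" and f: "bij_betw f X Y"
  shows "sperner_partition_system Y k ((`) ((`) f) ` S) \<and> card ((`) ((`) f) ` S) = card S"
proof -
  have inj: "inj_on f X" and Y: "f ` X = Y"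
    using f by (auto simp: bij_betw_def)
  have inj1: "inj_on ((`) f) (Pow X)"
    using inj by (rule inj_on_image_Pow)
  have inj2: "inj_on ((`) ((`) f)) (Pow (Pow X))"
    using inj1 by (rule inj_on_image_Pow)
  have sub: "S \<subseteq> Pow (Pow X)"
    using S by (auto simp: sperner_partition_system_def partition_on_def)
  have part: "partition_on Y ((`) f ` P) \<and> card ((`) f ` P) = k" if P: "P \<in> S" for P
  proof
    have PX: "partition_on X P" and card: "card P = k"
      using S P by (auto simp: sperner_partition_system_def)
    have PsubX: "P \<subseteq> Pow X" using sub P by auto
    show "card ((`) f ` P) = k"
      using card card_image inj_on_subset[OF inj1 PsubX] by blast
    show "partition_on Y ((`) f ` P)"
    proof (rule partition_onI)
      show "\<Union> ((`) f ` P) = Y"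
        using partition_onD1[OF PX] Y by auto
      show "{} \<notin> (`) f ` P"
        using partition_onD3[OF PX] by auto
      fix p q assume "p \<in> (`) f ` P" "q \<in> (`) f ` P" "p \<noteq> q"
      then obtain A B where AB: "A \<in> P" "B \<in> P" "p = f ` A" "q = f ` B" "A \<noteq> B" by auto
      then have "A \<inter> B = {}"
        using partition_onD2[OF PX] by (auto simp: disjoint_def)
      then have "f ` A \<inter> f ` B = {}"
        using inj_on_image_Int[OF inj, of A B] AB PsubX by auto
      then show "disjnt p q" using AB by (simp add: disjnt_def)
    qed
  qed
  have sperner: "\<not> f ` A \<subseteq> f ` B"
    if "P \<in> S" "Q \<in> S" "P \<noteq> Q" "A \<in> P" "B \<in> Q" for P Q A B
  proof -
    have "\<not> A \<subseteq> B" "A \<subseteq> X" "B \<subseteq> X"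
      using S sub that unfolding sperner_partition_system_def by blast+
    then show ?thesis using inj unfolding inj_on_def by blast
  qed
  have "sperner_partition_system Y k ((`) ((`) f) ` S)"
    unfolding sperner_partition_system_def
  proof (intro conjI ballI impI)
    fix P Q A B
    assume "P \<in> (`) ((`) f) ` S" "Q \<in> (`) ((`) f) ` S" "P \<noteq> Q" "A \<in> P" "B \<in> Q"
    then show "\<not> A \<subseteq> B" using sperner by blast
  qed (use part in blast)+
  moreover have "card ((`) ((`) f) ` S) = card S"
    using inj2 sub by (meson card_image inj_on_subset)
  ultimately show ?thesis ..
qed

lemma card_le_SP:
  assumes "finite X" "card X = n" "sperner_partition_system X k S"
  shows "card S \<le> SP n k"
proof -
  obtain f where "bij_betw f X {..<n}"
    using assms by (metis card_lessThan finite_lessThan finite_same_card_bij)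
  then obtain T where "sperner_partition_system {..<n} k T" "card T = card S"
    using sperner_partition_system_image[OF assms(3)] by blast
  moreover have "finite {card S |S. sperner_partition_system {..<n} k S}"
    using finite_sperner_partition_systems[of "{..<n}" k] by simp
  ultimately show ?thesis unfolding SP_def by (intro Max_ge) (auto intro: exI[of _ T])
qed

lemma SP_attained:
  assumes "finite X" "card X = n"
  shows "\<exists>S. sperner_partition_system X k S \<and> card S = SP n k"
proof -
  obtain f where f: "bij_betw f {..<n} X"
    using assms by (metis card_lessThan finite_lessThan finite_same_card_bij)
  have "SP n k \<in> {card S |S. sperner_partition_system {..<n} k S}"
    unfolding SP_def
  proof (rule Max_in)
    show "finite {card S |S. sperner_partition_system {..<n} k S}"
      using finite_sperner_partition_systems[of "{..<n}" k] by simp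
    have "sperner_partition_system {..<n} k {}"
      by (simp add: sperner_partition_system_def)
    then show "{card S |S. sperner_partition_system {..<n} k S} \<noteq> {}" by blast
  qed
  then show ?thesis using sperner_partition_system_image[OF _ f] by fastforce
qed

end

theory Submission
  imports
    Defs
    "HOL-Library.Transitive_Closure_Table"
    "HOL-Combinatorics.Multiset_Permutations"
begin

text \<open>
  The upper bound \<open>SP n k \<le> MMS n k\<close> is the LYM inequality for the antichain of all parts, combined with
  convexity of \<open>x \<mapsto> 1 / (n choose x)\<close>, which makes balanced partitions the lightest ones.

  For the lower bound write \<open>n = 2N\<close> and split the ground set into two halves of size \<open>N\<close>; the type of a
  set records the sizes of its intersections with the halves. By an argument in the style of Baranyai,
  every assignment of types to \<open>p\<close> groups of \<open>k\<close> slots is realised by \<open>p\<close> partitions into distinct sets, as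
  long as the types of each group add up to \<open>(N, N)\<close> and no type is used more often than there are sets
  of that type. So only types have to be chosen.

  In both cases of the theorem a partition has one part of even size \<open>2e\<close> and \<open>k - 1\<close> parts of odd size
  \<open>2f + 1\<close> with \<open>f \<in> {e - 1, e}\<close>. The types \<open>(e + s, e - s)\<close> and \<open>(f + j, f + 1 - j)\<close> are comparable only
  if \<open>j \<in> {s, s + 1}\<close>. Cut the line of positions into periods of length \<open>(g + 1) L + 1\<close>: a block of \<open>L\<close>
  positions goes to the even sets, \<open>g\<close> blocks of \<open>L\<close> positions go to the odd sets, and one odd position
  per period is wasted. The layer sizes are unimodal and symmetric, hence superpositions of uniform
  distributions on intervals \<open>{-Q..Q}\<close>, and on such an interval three permutations with pointwise sum
  zero are explicit; they balance one even part against two odd parts. The other \<open>k - 3\<close> odd parts are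
  grouped into pairs at the positions \<open>j\<close> and \<open>1 - j\<close>. What is lost is of the order of the period times the
  largest layer, which is negligible because the number of layers of nearly maximal size tends to
  infinity with \<open>n / k\<close>.
\<close>

section \<open>Rounding and set assignments\<close>

text \<open>Moving one element along every edge of a simple path changes only the counts at its two
  ends. The tail is shifted first; as \<open>x\<close> is not on the tail, the second clause of the
  conclusion guarantees that the element chosen for the first edge still sits in class
  \<open>x\<close>.\<close>

lemma shift_choice_along_path:
  fixes W :: "'c \<Rightarrow> 'l \<Rightarrow> real"
  assumes path: "rtrancl_path (\<lambda>a b. \<exists>c\<in>C. \<psi> c = a \<and> b \<in> \<Lambda> \<and> W c b > 0) x xs y"
    and "distinct (x # xs)" and "finite C"
    and "\<And>c. c \<in> C \<Longrightarrow> \<psi> c \<in> \<Lambda> \<and> W c (\<psi> c) > 0"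
  shows "\<exists>\<psi>'. (\<forall>c\<in>C. \<psi>' c \<in> \<Lambda> \<and> W c (\<psi>' c) > 0)
    \<and> (\<forall>c. \<psi> c \<notin> set (x # xs) \<longrightarrow> \<psi>' c = \<psi> c)
    \<and> (\<forall>b. card {c\<in>C. \<psi>' c = b} + (if b = x then 1 else 0)
         = card {c\<in>C. \<psi> c = b} + (if b = y then 1 else 0))"
  using assms
proof (induction rule: rtrancl_path.induct)
  case (base x)
  then show ?case by (intro exI[of _ \<psi>]) auto
next
  case (step x z zs y)
  from step.hyps(1) obtain c where c: "c \<in> C" "\<psi> c = x" "z \<in> \<Lambda>" "W c z > 0" by blast
  have "distinct (z # zs)" using step.prems by simp
  from step.IH[OF this step.prems(2,3)] obtain \<psi>' where
    p1: "\<And>c. c \<in> C \<Longrightarrow> \<psi>' c \<in> \<Lambda> \<and> W c (\<psi>' c) > 0" and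
    p2: "\<And>c. \<psi> c \<notin> set (z # zs) \<Longrightarrow> \<psi>' c = \<psi> c" and
    p3: "\<And>b. card {c\<in>C. \<psi>' c = b} + (if b = z then 1 else 0)
         = card {c\<in>C. \<psi> c = b} + (if b = y then 1 else 0)"
    by blast
  have x: "x \<notin> set (z # zs)" using step.prems(1) by auto
  have c': "\<psi>' c = x" using p2[of c] c x by auto
  have "x \<noteq> z" using x by auto
  have fin: "finite {c\<in>C. P c}" for P using step.prems by auto
  have cnt: "card {d\<in>C. (\<psi>'(c := z)) d = b} + (if b = x then 1 else 0)
     = card {d\<in>C. \<psi>' d = b} + (if b = z then 1 else 0)" for b
  proof -
    consider "b = x" | "b = z" | "b \<noteq> x" "b \<noteq> z" by blast
    then show ?thesis
    proof cases
      case 1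
      have "{d\<in>C. \<psi>' d = x} = insert c {d\<in>C. (\<psi>'(c := z)) d = x}"
        using c c' \<open>x \<noteq> z\<close> by auto
      then show ?thesis using 1 \<open>x \<noteq> z\<close> fin by (simp add: card_insert_if)
    next
      case 2
      have "{d\<in>C. (\<psi>'(c := z)) d = z} = insert c {d\<in>C. \<psi>' d = z}"
        using c c' \<open>x \<noteq> z\<close> by auto
      then show ?thesis using 2 \<open>x \<noteq> z\<close> fin c' by (simp add: card_insert_if)
    next
      case 3
      then have "{d\<in>C. (\<psi>'(c := z)) d = b} = {d\<in>C. \<psi>' d = b}"
        using c' by auto
      then show ?thesis using 3 by simp
    qed
  qed
  show ?case
  proof (intro exI[of _ "\<psi>'(c := z)"] conjI)
    show "\<forall>d\<in>C. (\<psi>'(c := z)) d \<in> \<Lambda> \<and> W d ((\<psi>'(c := z)) d) > 0"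
      using p1 c by auto
    show "\<forall>d. \<psi> d \<notin> set (x # z # zs) \<longrightarrow> (\<psi>'(c := z)) d = \<psi> d"
      using p2 c by auto
    show "\<forall>b. card {d\<in>C. (\<psi>'(c := z)) d = b} + (if b = x then 1 else 0)
         = card {c\<in>C. \<psi> c = b} + (if b = y then 1 else 0)"
      using cnt p3 by metis
  qed
qed

text \<open>
  Integrality of a transportation polytope: take an integral choice with the least total violation
  of the bounds. If some bound is violated, then the classes reachable from (or co-reachable to) the
  violating class by exchanging choices are all full (or all deficient), which contradicts the
  fractional solution.
\<close>

lemma integral_choice_of_fractional:
  fixes W :: "'c \<Rightarrow> 'l \<Rightarrow> real" and lo up :: "'l \<Rightarrow> nat"
  assumes finC: "finite C" and finL: "finite \<Lambda>"
    and W0: "\<And>c b. W c b \<ge> 0"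
    and W1: "\<And>c. c \<in> C \<Longrightarrow> (\<Sum>b\<in>\<Lambda>. W c b) = 1"
    and lo: "\<And>b. b \<in> \<Lambda> \<Longrightarrow> real (lo b) \<le> (\<Sum>c\<in>C. W c b)"
    and up: "\<And>b. b \<in> \<Lambda> \<Longrightarrow> (\<Sum>c\<in>C. W c b) \<le> real (up b)"
  obtains \<psi> where "\<And>c. c \<in> C \<Longrightarrow> \<psi> c \<in> \<Lambda> \<and> W c (\<psi> c) > 0"
    and "\<And>b. b \<in> \<Lambda> \<Longrightarrow> lo b \<le> card {c\<in>C. \<psi> c = b} \<and> card {c\<in>C. \<psi> c = b} \<le> up b"
proof -
  define ok where "ok \<psi> \<longleftrightarrow> (\<forall>c\<in>C. \<psi> c \<in> \<Lambda> \<and> W c (\<psi> c) > 0)" for \<psi> :: "'c \<Rightarrow> 'l"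
  define cnt where "cnt \<psi> b = card {c\<in>C. \<psi> c = b}" for \<psi> :: "'c \<Rightarrow> 'l" and b
  define df where "df \<psi> b = (cnt \<psi> b - up b) + (lo b - cnt \<psi> b)" for \<psi> b
  have loup: "lo b \<le> up b" if "b \<in> \<Lambda>" for b
    using lo[OF that] up[OF that] by linarith
  have "\<exists>b. b \<in> \<Lambda> \<and> W c b > 0" if "c \<in> C" for c
  proof (rule ccontr)
    assume "\<nexists>b. b \<in> \<Lambda> \<and> W c b > 0"
    then have "(\<Sum>b\<in>\<Lambda>. W c b) \<le> 0" by (intro sum_nonpos) (auto simp: not_less)
    then show False using W1[OF that] by simp
  qed
  then have "\<exists>\<psi>. ok \<psi>" unfolding ok_def by metis
  then obtain \<psi> where \<psi>: "ok \<psi>" and min: "\<And>\<psi>'. ok \<psi>' \<Longrightarrow> (\<Sum>b\<in>\<Lambda>. df \<psi> b) \<le> (\<Sum>b\<in>\<Lambda>. df \<psi>' b)"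
    using ex_has_least_nat[of ok _ "\<lambda>\<psi>. \<Sum>b\<in>\<Lambda>. df \<psi> b"] by blast
  define r where "r = (\<lambda>a b. \<exists>c\<in>C. \<psi> c = a \<and> b \<in> \<Lambda> \<and> W c b > 0)"
  have \<psi>L: "\<psi> c \<in> \<Lambda>" if "c \<in> C" for c using \<psi> that by (auto simp: ok_def)
  have shift: False
    if reach: "r\<^sup>*\<^sup>* x y" and "x \<noteq> y" "x \<in> \<Lambda>" "y \<in> \<Lambda>" "cnt \<psi> x > lo x" "cnt \<psi> y < up y"
      "cnt \<psi> x > up x \<or> cnt \<psi> y < lo y" for x y
  proof -
    obtain ys where "rtrancl_path r x ys y"
      using reach unfolding rtranclp_eq_rtrancl_path by blast
    then obtain xs where "rtrancl_path r x xs y" "distinct (x # xs)"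
      by (rule rtrancl_path_distinct)
    from shift_choice_along_path[OF this(1)[unfolded r_def] this(2) finC] \<psi>
    obtain \<psi>' where \<psi>': "ok \<psi>'" and c: "\<And>b. cnt \<psi>' b + (if b = x then 1 else 0)
         = cnt \<psi> b + (if b = y then 1 else 0)"
      unfolding ok_def cnt_def by blast
    have cx: "cnt \<psi>' x = cnt \<psi> x - 1" and cy: "cnt \<psi>' y = cnt \<psi> y + 1"
      and cb: "\<And>b. b \<noteq> x \<Longrightarrow> b \<noteq> y \<Longrightarrow> cnt \<psi>' b = cnt \<psi> b"
      using c[of x] c[of y] c that(2) by (auto split: if_splits) (metis add.right_neutral)
    have dx: "df \<psi>' x \<le> df \<psi> x" and dy: "df \<psi>' y \<le> df \<psi> y"
      and d: "df \<psi>' x < df \<psi> x \<or> df \<psi>' y < df \<psi> y"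
      using that(5-7) loup[OF that(3)] loup[OF that(4)] by (auto simp: df_def cx cy)
    have "(\<Sum>b\<in>\<Lambda>. df \<psi>' b) < (\<Sum>b\<in>\<Lambda>. df \<psi> b)"
    proof (rule sum_strict_mono_ex1[OF finL])
      show "\<forall>b\<in>\<Lambda>. df \<psi>' b \<le> df \<psi> b"
      proof
        fix b assume "b \<in> \<Lambda>"
        consider "b = x" | "b = y" | "b \<noteq> x" "b \<noteq> y" by blast
        then show "df \<psi>' b \<le> df \<psi> b"
          by cases (use dx dy cb in \<open>auto simp: df_def\<close>)
      qed
      show "\<exists>b\<in>\<Lambda>. df \<psi>' b < df \<psi> b" using d that by blast
    qed
    then show False using min[OF \<psi>'] by linarith
  qed
  have cnt_R: "(\<Sum>b\<in>R. cnt \<psi> b) = card {c\<in>C. \<psi> c \<in> R}" if "R \<subseteq> \<Lambda>" for R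
  proof -
    have "finite R" using that finL finite_subset by blast
    have "card (\<Union>b\<in>R. {c\<in>C. \<psi> c = b}) = (\<Sum>b\<in>R. card {c\<in>C. \<psi> c = b})"
      by (rule card_UN_disjoint) (use \<open>finite R\<close> finC in auto)
    moreover have "(\<Union>b\<in>R. {c\<in>C. \<psi> c = b}) = {c\<in>C. \<psi> c \<in> R}" by auto
    ultimately show ?thesis by (simp add: cnt_def)
  qed
  have upper: "cnt \<psi> a \<le> up a" if a: "a \<in> \<Lambda>" for a
  proof (rule ccontr)
    assume "\<not> cnt \<psi> a \<le> up a"
    then have over: "cnt \<psi> a > up a" by simp
    define R where "R = {b\<in>\<Lambda>. r\<^sup>*\<^sup>* a b}"
    have aR: "a \<in> R" using a by (auto simp: R_def)
    have RL: "R \<subseteq> \<Lambda>" by (auto simp: R_def)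
    have finR: "finite R" using RL finL finite_subset by blast
    have ge: "cnt \<psi> b \<ge> up b" if "b \<in> R" for b
    proof (rule ccontr)
      assume b: "\<not> cnt \<psi> b \<ge> up b"
      then have "a \<noteq> b" using over by auto
      then show False
        using shift[of a b] b over that a loup[OF a] by (auto simp: R_def)
    qed
    let ?D = "{c\<in>C. \<psi> c \<in> R}"
    \<comment> \<open>\<open>R\<close> is closed under the exchange edges, so an element whose
      choice lies in \<open>R\<close> has its whole weight in \<open>R\<close>. Counting that weight
      against the bounds \<open>up\<close> gives the contradiction.\<close>
    have supp: "b \<in> R" if "c \<in> ?D" "b \<in> \<Lambda>" "W c b > 0" for b c
    proof -
      have "r (\<psi> c) b" using that unfolding r_def by blast
      then show ?thesis using that by (auto simp: R_def intro: rtranclp.rtrancl_into_rtrancl)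
    qed
    have "real (card ?D) = (\<Sum>c\<in>?D. \<Sum>b\<in>\<Lambda>. W c b)"
      using W1 by simp
    also have "\<dots> = (\<Sum>c\<in>?D. \<Sum>b\<in>R. W c b)"
    proof (rule sum.cong[OF refl])
      fix c assume c: "c \<in> ?D"
      show "(\<Sum>b\<in>\<Lambda>. W c b) = (\<Sum>b\<in>R. W c b)"
        by (rule sum.mono_neutral_right[OF finL RL])
          (use supp[OF c] W0 in \<open>force simp: less_eq_real_def\<close>)
    qed
    also have "\<dots> = (\<Sum>b\<in>R. \<Sum>c\<in>?D. W c b)" by (rule sum.swap)
    also have "\<dots> \<le> (\<Sum>b\<in>R. \<Sum>c\<in>C. W c b)"
      by (intro sum_mono sum_mono2) (use finC W0 in auto)
    also have "\<dots> \<le> (\<Sum>b\<in>R. real (up b))"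
      by (intro sum_mono up) (use RL in auto)
    also have "\<dots> < (\<Sum>b\<in>R. real (cnt \<psi> b))"
      by (rule sum_strict_mono_ex1[OF finR]) (use ge over aR in auto)
    also have "\<dots> = real (card ?D)" using cnt_R[OF RL] by (metis of_nat_sum)
    finally show False by simp
  qed
  have lower: "lo a \<le> cnt \<psi> a" if a: "a \<in> \<Lambda>" for a
  proof (rule ccontr)
    assume "\<not> lo a \<le> cnt \<psi> a"
    then have under: "cnt \<psi> a < lo a" by simp
    define R where "R = {b\<in>\<Lambda>. r\<^sup>*\<^sup>* b a}"
    have aR: "a \<in> R" using a by (auto simp: R_def)
    have RL: "R \<subseteq> \<Lambda>" by (auto simp: R_def)
    have finR: "finite R" using RL finL finite_subset by blast
    have le: "cnt \<psi> b \<le> lo b" if "b \<in> R" for b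
    proof (rule ccontr)
      assume b: "\<not> cnt \<psi> b \<le> lo b"
      then have "b \<noteq> a" using under by auto
      then show False
        using shift[of b a] b under that a loup[OF a] by (auto simp: R_def)
    qed
    let ?D = "{c\<in>C. \<psi> c \<in> R}"
    \<comment> \<open>Dual closure: \<open>R\<close> is closed backwards, so every element with some
      weight in \<open>R\<close> has its choice in \<open>R\<close>.\<close>
    have supp: "c \<in> ?D" if "c \<in> C" "b \<in> R" "W c b > 0" for b c
    proof -
      have "r (\<psi> c) b" using that RL unfolding r_def by blast
      then show ?thesis using that \<psi>L by (auto simp: R_def intro: converse_rtranclp_into_rtranclp)
    qed
    have "real (card ?D) = (\<Sum>b\<in>R. real (cnt \<psi> b))" using cnt_R[OF RL] by (metis of_nat_sum)
    also have "\<dots> < (\<Sum>b\<in>R. real (lo b))"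
      by (rule sum_strict_mono_ex1[OF finR]) (use le under aR in auto)
    also have "\<dots> \<le> (\<Sum>b\<in>R. \<Sum>c\<in>C. W c b)"
      by (intro sum_mono lo) (use RL in auto)
    also have "\<dots> = (\<Sum>b\<in>R. \<Sum>c\<in>?D. W c b)"
      by (intro sum.cong refl sum.mono_neutral_right)
        (use finC supp W0 in \<open>force simp: less_eq_real_def\<close>)+
    also have "\<dots> = (\<Sum>c\<in>?D. \<Sum>b\<in>R. W c b)" by (rule sum.swap)
    also have "\<dots> \<le> (\<Sum>c\<in>?D. \<Sum>b\<in>\<Lambda>. W c b)"
      by (intro sum_mono sum_mono2) (use finL W0 RL in auto)
    also have "\<dots> = real (card ?D)" using W1 by simp
    finally show False by simp
  qed
  show ?thesis
    by (rule that[of \<psi>]) (use \<psi> upper lower in \<open>auto simp: ok_def cnt_def\<close>)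
qed

section \<open>Distributing points in the manner of Baranyai\<close>

text \<open>
  The points of \<open>S\<close> are distributed one at a time, as in the proof of Baranyai's theorem. If a set has
  to receive \<open>r\<close> of the \<open>m\<close> remaining points, it asks for the next point with weight \<open>r / m\<close>; Pascal's
  recursion for \<open>m choose r\<close> is exactly what keeps the capacity bounds intact after rounding.
\<close>

lemma equitable_set_assignment:
  fixes col :: "'e \<Rightarrow> 'c" and lab :: "'e \<Rightarrow> 'l" and r R :: "'l \<Rightarrow> nat" and S :: "'a set"
  assumes finE: "finite E" and finS: "finite S"
    and size: "\<And>e. e \<in> E \<Longrightarrow> (\<Sum>e'\<in>{e'\<in>E. col e' = col e}. r (lab e')) = card S"
    and cap: "\<And>l. card {e\<in>E. lab e = l} \<le> (card S choose r l) * R l"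
  obtains g :: "'e \<Rightarrow> 'a set" where
    "\<And>e. e \<in> E \<Longrightarrow> g e \<subseteq> S \<and> card (g e) = r (lab e)"
    "\<And>e e'. e \<in> E \<Longrightarrow> e' \<in> E \<Longrightarrow> col e = col e' \<Longrightarrow> e \<noteq> e' \<Longrightarrow> g e \<inter> g e' = {}"
    "\<And>l A. card {e\<in>E. lab e = l \<and> g e = A} \<le> R l"
proof -
  \<comment> \<open>\<open>V\<close> is the set of points already distributed. The last clause says
    that the slots with label \<open>l\<close> holding \<open>A\<close> do not outnumber the ways to
    complete \<open>A\<close> from \<open>S - V\<close> to a set of size \<open>r l\<close>, each
    counted \<open>R l\<close> times.\<close>
  define inv where "inv V g \<longleftrightarrow>
      (\<forall>e\<in>E. g e \<subseteq> V \<and> card (g e) \<le> r (lab e)) \<and>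
      (\<forall>e\<in>E. \<forall>e'\<in>E. col e = col e' \<longrightarrow> e \<noteq> e' \<longrightarrow> g e \<inter> g e' = {}) \<and>
      (\<forall>e\<in>E. (\<Sum>e'\<in>{e'\<in>E. col e' = col e}. r (lab e') - card (g e')) = card (S - V)) \<and>
      (\<forall>l A. card A \<le> r l \<longrightarrow> card {e\<in>E. lab e = l \<and> g e = A}
          \<le> (card (S - V) choose (r l - card A)) * R l)"
    for V and g :: "'e \<Rightarrow> 'a set"
  have "\<exists>g. inv S g"
    using finS order.refl[of S]
  proof (induction S rule: finite_subset_induct')
    case empty
    have "card {e\<in>E. lab e = l \<and> {} = A} \<le> (card S choose (r l - card A)) * R l" for l and A :: "'a set"
      by (cases "A = {}") (use cap in auto)
    then show ?case
      using size by (intro exI[of _ "\<lambda>_. {}"]) (auto simp: inv_def)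
  next
    case (insert x V)
    then obtain g where "inv V g" by blast
    then have g1: "\<And>e. e \<in> E \<Longrightarrow> g e \<subseteq> V \<and> card (g e) \<le> r (lab e)"
      and g2: "\<And>e e'. e \<in> E \<Longrightarrow> e' \<in> E \<Longrightarrow> col e = col e' \<Longrightarrow> e \<noteq> e' \<Longrightarrow> g e \<inter> g e' = {}"
      and g3: "\<And>e. e \<in> E \<Longrightarrow> (\<Sum>e'\<in>{e'\<in>E. col e' = col e}. r (lab e') - card (g e')) = card (S - V)"
      and g4: "\<And>l A. card A \<le> r l \<Longrightarrow> card {e\<in>E. lab e = l \<and> g e = A}
          \<le> (card (S - V) choose (r l - card A)) * R l"
      unfolding inv_def by blast+
    have finV: "finite V" using insert.hyps finS finite_subset by blast
    define m where "m = card (S - V)"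
    have m: "card (S - insert x V) = m - 1" "m > 0"
      using insert.hyps finS by (auto simp: m_def card_Diff_insert card_gt_0_iff)
    define key where "key e = (lab e, g e)" for e
    define nd where "nd b = r (fst b) - card (snd b)" for b :: "'l \<times> 'a set"
    define u where "u b = card {e\<in>E. key e = b}" for b
    define \<Lambda> where "\<Lambda> = key ` E"
    \<comment> \<open>Slots of one colour with equal label and equal current set are
      interchangeable, so the choice made for colour \<open>c\<close> is a key and not a
      slot.\<close>
    define W where "W c b = real (card {e\<in>E. col e = c \<and> key e = b} * nd b) / real m" for c b
    have finL: "finite \<Lambda>" using finE by (simp add: \<Lambda>_def)
    have nd_le: "nd (key e) \<le> m" if "e \<in> E" for e
    proof -
      have "nd (key e) \<le> (\<Sum>e'\<in>{e'\<in>E. col e' = col e}. nd (key e'))"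
        by (rule member_le_sum) (use that finE in auto)
      also have "\<dots> = m" using g3[OF that] by (simp add: nd_def key_def m_def)
      finally show ?thesis .
    qed
    have u_le: "u b \<le> (m choose nd b) * R (fst b)" if b: "b \<in> \<Lambda>" for b
    proof -
      obtain e where e: "e \<in> E" "b = key e" using b by (auto simp: \<Lambda>_def)
      have "{e'\<in>E. key e' = b} = {e'\<in>E. lab e' = lab e \<and> g e' = g e}"
        using e by (auto simp: key_def)
      then show ?thesis
        using g4[of "g e" "lab e"] g1[OF e(1)] e(2) by (simp add: u_def nd_def key_def m_def)
    qed
    have sumW: "(\<Sum>c\<in>col ` E. W c b) = real (u b) * real (nd b) / real m" for b
    proof -
      have "(\<Sum>c\<in>col ` E. card {e\<in>E. col e = c \<and> key e = b}) = u b"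
      proof -
        have "card (\<Union>c\<in>col ` E. {e\<in>E. col e = c \<and> key e = b})
            = (\<Sum>c\<in>col ` E. card {e\<in>E. col e = c \<and> key e = b})"
          by (rule card_UN_disjoint) (use finE in auto)
        moreover have "(\<Union>c\<in>col ` E. {e\<in>E. col e = c \<and> key e = b}) = {e\<in>E. key e = b}" by auto
        ultimately show ?thesis by (simp add: u_def)
      qed
      then show ?thesis
        unfolding W_def by (simp add: sum_divide_distrib[symmetric] sum_distrib_right[symmetric]
            flip: of_nat_sum of_nat_mult)
    qed
    \<comment> \<open>By Pascal's rule the capacity of a key splits: \<open>up\<close> is what the
      set enlarged by \<open>x\<close> can take, and \<open>lo\<close> makes sure that the slots not
      receiving \<open>x\<close> fit in the capacity left for the old set.\<close>
    define up where "up b = (if nd b = 0 then 0 else (m - 1 choose (nd b - 1)) * R (fst b))" for b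
    define lo where "lo b = u b - (m - 1 choose nd b) * R (fst b)" for b
    have up: "(\<Sum>c\<in>col ` E. W c b) \<le> real (up b)" if "b \<in> \<Lambda>" for b
    proof (cases "nd b = 0")
      case True
      then show ?thesis by (simp add: sumW)
    next
      case False
      have "u b * nd b \<le> nd b * (m choose nd b) * R (fst b)"
        using mult_le_mono1[OF u_le[OF that], of "nd b"] by (simp add: algebra_simps)
      also have "nd b * (m choose nd b) = m * (m - 1 choose (nd b - 1))"
        using False by (intro times_binomial_minus1_eq) simp
      finally have "u b * nd b \<le> m * up b" using False by (simp add: up_def algebra_simps)
      then have "real (u b) * real (nd b) \<le> real m * real (up b)"
        by (metis of_nat_le_iff of_nat_mult)
      then show ?thesis using m by (simp add: sumW divide_le_eq mult.commute)
    qed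
    have lo: "real (lo b) \<le> (\<Sum>c\<in>col ` E. W c b)" if "b \<in> \<Lambda>" for b
    proof -
      have ndm: "nd b \<le> m" using that nd_le by (auto simp: \<Lambda>_def)
      have "u b * (m - nd b) \<le> (m - nd b) * (m choose nd b) * R (fst b)"
        using mult_le_mono1[OF u_le[OF that], of "m - nd b"] by (simp add: algebra_simps)
      also have "(m - nd b) * (m choose nd b) = m * (m - 1 choose nd b)"
        by (rule binomial_absorb_comp)
      finally have "real (u b * (m - nd b)) \<le> real (m * (m - 1 choose nd b) * R (fst b))"
        by (metis of_nat_le_iff)
      then have "real (u b) * (real m - real (nd b)) \<le> real m * real ((m - 1 choose nd b) * R (fst b))"
        using ndm by (simp add: of_nat_diff algebra_simps)
      then have "real m * (real (u b) - real ((m - 1 choose nd b) * R (fst b))) \<le> real (u b) * real (nd b)"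
        by (simp add: algebra_simps)
      then have "real (u b) - real ((m - 1 choose nd b) * R (fst b)) \<le> real (u b) * real (nd b) / real m"
        using m by (simp add: pos_le_divide_eq mult.commute)
      moreover have "0 \<le> real (u b) * real (nd b) / real m" by simp
      ultimately show ?thesis unfolding sumW lo_def by linarith
    qed
    have W1: "(\<Sum>b\<in>\<Lambda>. W c b) = 1" if c: "c \<in> col ` E" for c
    proof -
      let ?Ec = "{e\<in>E. col e = c}"
      have "(\<Sum>b\<in>\<Lambda>. card {e\<in>E. col e = c \<and> key e = b} * nd b)
          = (\<Sum>b\<in>\<Lambda>. \<Sum>e\<in>{e\<in>?Ec. key e = b}. nd (key e))"
        by (intro sum.cong) (auto intro!: arg_cong2[of _ _ _ _ "(*)"] arg_cong[of _ _ card])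
      also have "\<dots> = (\<Sum>e\<in>?Ec. nd (key e))"
        by (rule sum.group) (use finE finL in \<open>auto simp: \<Lambda>_def\<close>)
      also have "\<dots> = m" using g3 c by (auto simp: nd_def key_def m_def)
      finally have "(\<Sum>b\<in>\<Lambda>. card {e\<in>E. col e = c \<and> key e = b} * nd b) = m" .
      then show ?thesis using m unfolding W_def
        by (simp only: sum_divide_distrib[symmetric] of_nat_sum[symmetric]) simp
    qed
    have W0: "W c b \<ge> 0" for c b by (simp add: W_def)
    from integral_choice_of_fractional[of "col ` E" \<Lambda> W lo up, OF _ finL W0 W1 lo up] finE
    obtain \<psi> where \<psi>1: "\<And>c. c \<in> col ` E \<Longrightarrow> \<psi> c \<in> \<Lambda> \<and> W c (\<psi> c) > 0"
      and \<psi>2: "\<And>b. b \<in> \<Lambda> \<Longrightarrow> lo b \<le> card {c\<in>col ` E. \<psi> c = b} \<and> card {c\<in>col ` E. \<psi> c = b} \<le> up b"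
      by auto
    \<comment> \<open>Positive weight forces a slot that still needs a point; giving
      \<open>x\<close> to it cannot overfill it.\<close>
    have "\<exists>e\<in>E. col e = c \<and> key e = \<psi> c \<and> nd (key e) > 0" if "c \<in> col ` E" for c
    proof -
      have "card {e\<in>E. col e = c \<and> key e = \<psi> c} * nd (\<psi> c) \<noteq> 0"
      proof
        assume "card {e\<in>E. col e = c \<and> key e = \<psi> c} * nd (\<psi> c) = 0"
        then have "W c (\<psi> c) = 0" by (simp only: W_def)
        then show False using \<psi>1[OF that] by simp
      qed
      then have "{e\<in>E. col e = c \<and> key e = \<psi> c} \<noteq> {}" "nd (\<psi> c) \<noteq> 0" by (auto simp del: Collect_empty_eq)
      then show ?thesis by force
    qed
    then obtain pe where pe: "\<And>c. c \<in> col ` E \<Longrightarrow> pe c \<in> E \<and> col (pe c) = c \<and> key (pe c) = \<psi> c \<and> nd (key (pe c)) > 0"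
      by metis
    define g' where "g' e = (if pe (col e) = e then insert x (g e) else g e)" for e
    have xg: "x \<notin> g e" if "e \<in> E" for e using g1[OF that] insert.hyps by blast
    have fing: "finite (g e)" if "e \<in> E" for e using g1[OF that] finV finite_subset by blast
    have cg': "card (g' e) = card (g e) + (if pe (col e) = e then 1 else 0)" if "e \<in> E" for e
      using xg[OF that] fing[OF that] by (simp add: g'_def)
    have npe: "pe (col e) = e \<Longrightarrow> card (g e) < r (lab e)" if "e \<in> E" for e
      using pe[of "col e"] that by (auto simp: nd_def key_def)
    have picked: "card {e\<in>E. pe (col e) = e \<and> key e = b} = card {c\<in>col ` E. \<psi> c = b}" for b
    proof (rule bij_betw_same_card[of col])
      show "bij_betw col {e\<in>E. pe (col e) = e \<and> key e = b} {c\<in>col ` E. \<psi> c = b}"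
        by (rule bij_betw_byWitness[where f' = pe]) (use pe in auto, metis imageI)
    qed
    have "inv (insert x V) g'"
      unfolding inv_def
    proof (intro conjI ballI allI impI)
      fix e assume e: "e \<in> E"
      show "g' e \<subseteq> insert x V" using g1[OF e] by (auto simp: g'_def)
      show "card (g' e) \<le> r (lab e)" using cg'[OF e] npe[OF e] g1[OF e] by auto
    next
      fix e e' assume e: "e \<in> E" "e' \<in> E" "col e = col e'" "e \<noteq> e'"
      then show "g' e \<inter> g' e' = {}"
        using g2[OF e] xg by (auto simp: g'_def)
    next
      fix e assume e: "e \<in> E"
      let ?Ec = "{e'\<in>E. col e' = col e}"
      let ?p = "pe (col e)"
      have p: "?p \<in> ?Ec" "card (g ?p) < r (lab ?p)"
        using pe[of "col e"] e by (auto simp: nd_def key_def)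
      have fc: "finite ?Ec" using finE by simp
      have "(\<Sum>e'\<in>?Ec. r (lab e') - card (g' e'))
          = (r (lab ?p) - card (g' ?p)) + (\<Sum>e'\<in>?Ec - {?p}. r (lab e') - card (g' e'))"
        by (rule sum.remove[OF fc p(1)])
      also have "(\<Sum>e'\<in>?Ec - {?p}. r (lab e') - card (g' e'))
          = (\<Sum>e'\<in>?Ec - {?p}. r (lab e') - card (g e'))"
        by (rule sum.cong) (auto simp: g'_def)
      also have "r (lab ?p) - card (g' ?p) = r (lab ?p) - card (g ?p) - 1"
        using cg'[of ?p] p by simp
      also have "r (lab ?p) - card (g ?p) - 1 + (\<Sum>e'\<in>?Ec - {?p}. r (lab e') - card (g e'))
          = (\<Sum>e'\<in>?Ec. r (lab e') - card (g e')) - 1"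
        using sum.remove[OF fc p(1), of "\<lambda>e'. r (lab e') - card (g e')"] p(2) by simp
      finally show "(\<Sum>e'\<in>?Ec. r (lab e') - card (g' e')) = card (S - insert x V)"
        using g3[OF e] m by (simp add: m_def)
    next
      fix l and A :: "'a set" assume A: "card A \<le> r l"
      show "card {e\<in>E. lab e = l \<and> g' e = A} \<le> (card (S - insert x V) choose (r l - card A)) * R l"
      proof (cases "{e\<in>E. lab e = l \<and> g' e = A} = {}")
        case True
        then show ?thesis by (simp only: card.empty)
      next
        case False
        then obtain e0 where e0: "e0 \<in> E" "lab e0 = l" "g' e0 = A" by blast
        show ?thesis
        \<comment> \<open>As \<open>x\<close> is new, the slots now holding \<open>A\<close> with
          \<open>x \<in> A\<close> are the chosen ones that held \<open>A - {x}\<close>; if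
          \<open>x \<notin> A\<close>, they are those holding \<open>A\<close> that were passed
          over.\<close>
        proof (cases "x \<in> A")
          case True
          define b where "b = (l, A - {x})"
          have eq: "{e\<in>E. lab e = l \<and> g' e = A} = {e\<in>E. pe (col e) = e \<and> key e = b}"
            using True xg by (auto simp: g'_def key_def b_def split: if_splits)
          then have "e0 \<in> {e\<in>E. pe (col e) = e \<and> key e = b}" using e0 by blast
          then have "b \<in> \<Lambda>" by (auto simp: \<Lambda>_def)
          have "finite A" using e0 cg' fing by (auto simp: g'_def split: if_splits)
          then have "card (A - {x}) = card A - 1" "card A > 0" using True by (auto simp: card_gt_0_iff)
          then have "nd b = r l - card A + 1" using A by (simp add: nd_def b_def)
          then show ?thesis using \<psi>2[OF \<open>b \<in> \<Lambda>\<close>] unfolding eq picked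
            by (simp add: up_def m b_def)
        next
          case False
          define b where "b = (l, A)"
          have eq: "{e\<in>E. lab e = l \<and> g' e = A} = {e\<in>E. key e = b} - {e\<in>E. pe (col e) = e \<and> key e = b}"
            using False by (auto simp: g'_def key_def b_def split: if_splits)
          then have "e0 \<in> {e\<in>E. key e = b}" using e0 by blast
          then have "b \<in> \<Lambda>" by (auto simp: \<Lambda>_def)
          have "card {e\<in>E. lab e = l \<and> g' e = A} = u b - card {c\<in>col ` E. \<psi> c = b}"
            unfolding eq u_def picked[symmetric] by (rule card_Diff_subset) (use finE in auto)
          also have "\<dots> \<le> u b - lo b" using \<psi>2[OF \<open>b \<in> \<Lambda>\<close>] by linarith
          also have "\<dots> \<le> (m - 1 choose nd b) * R (fst b)" by (simp add: lo_def)
          finally show ?thesis by (simp add: m b_def nd_def)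
        qed
      qed
    qed
    then show ?case by blast
  qed
  then obtain g where "inv S g" by blast
  from this[unfolded inv_def Diff_cancel card.empty]
  have g1: "\<And>e. e \<in> E \<Longrightarrow> g e \<subseteq> S \<and> card (g e) \<le> r (lab e)"
      and g2: "\<And>e e'. e \<in> E \<Longrightarrow> e' \<in> E \<Longrightarrow> col e = col e' \<Longrightarrow> e \<noteq> e' \<Longrightarrow> g e \<inter> g e' = {}"
      and g3: "\<And>e. e \<in> E \<Longrightarrow> (\<Sum>e'\<in>{e'\<in>E. col e' = col e}. r (lab e') - card (g e')) = 0"
      and g4: "\<And>l A. card A \<le> r l \<Longrightarrow> card {e\<in>E. lab e = l \<and> g e = A}
          \<le> (0 choose (r l - card A)) * R l"
    by blast+
  have c: "card (g e) = r (lab e)" if "e \<in> E" for e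
    using g3[OF that] g1[OF that] that finE by auto
  show ?thesis
  proof (rule that[of g])
    fix l A
    show "card {e\<in>E. lab e = l \<and> g e = A} \<le> R l"
    proof (cases "{e\<in>E. lab e = l \<and> g e = A} = {}")
      case True
      then show ?thesis by (simp only: card.empty)
    next
      case False
      then have "card A = r l" using c by auto
      then show ?thesis using g4[of A l] by simp
    qed
  qed (use g1 g2 c in auto)
qed

text \<open>Slots of one colour become the parts of one partition, as their sizes in either half add
  up to \<open>N\<close>. Inclusion of two parts forces comparable types, hence equal types by
  \<open>antichain\<close>, hence equal sets, and the capacity lets each set occur in only one
  slot.\<close>

lemma card_le_SP_of_types:
  fixes col :: "'e \<Rightarrow> 'c" and ty :: "'e \<Rightarrow> nat \<times> nat" and N k :: nat
  assumes finE: "finite E" and k: "k > 0"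
    and slots: "\<And>e. e \<in> E \<Longrightarrow> card {e'\<in>E. col e' = col e} = k"
    and size1: "\<And>e. e \<in> E \<Longrightarrow> (\<Sum>e'\<in>{e'\<in>E. col e' = col e}. fst (ty e')) = N"
    and size2: "\<And>e. e \<in> E \<Longrightarrow> (\<Sum>e'\<in>{e'\<in>E. col e' = col e}. snd (ty e')) = N"
    and cap: "\<And>\<tau>. card {e\<in>E. ty e = \<tau>} \<le> (N choose fst \<tau>) * (N choose snd \<tau>)"
    and nonempty: "\<And>e. e \<in> E \<Longrightarrow> ty e \<noteq> (0, 0)"
    and antichain: "\<And>e e'. e \<in> E \<Longrightarrow> e' \<in> E \<Longrightarrow> fst (ty e) \<le> fst (ty e') \<Longrightarrow>
          snd (ty e) \<le> snd (ty e') \<Longrightarrow> ty e = ty e'"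
  shows "card (col ` E) \<le> SP (2 * N) k"
proof -
  define X1 where "X1 = {..<N}"
  define X2 where "X2 = {N..<2 * N}"
  have X: "finite X1" "finite X2" "card X1 = N" "card X2 = N" "X1 \<inter> X2 = {}" "X1 \<union> X2 = {..<2 * N}"
    by (auto simp: X1_def X2_def)
  \<comment> \<open>The assignment lemma is used once per half; in the second half the label of a slot includes the
    set chosen in the first half.\<close>
  obtain g1 :: "'e \<Rightarrow> nat set" where
    g1: "\<And>e. e \<in> E \<Longrightarrow> g1 e \<subseteq> X1 \<and> card (g1 e) = fst (ty e)"
      "\<And>e e'. e \<in> E \<Longrightarrow> e' \<in> E \<Longrightarrow> col e = col e' \<Longrightarrow> e \<noteq> e' \<Longrightarrow> g1 e \<inter> g1 e' = {}"
      "\<And>\<tau> A. card {e\<in>E. ty e = \<tau> \<and> g1 e = A} \<le> (N choose snd \<tau>)"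
    by (rule equitable_set_assignment[where E = E and S = X1 and col = col and r = fst and lab = ty
        and R = "\<lambda>\<tau>. N choose snd \<tau>"])
      (use finE X size1 cap in auto)
  obtain g2 :: "'e \<Rightarrow> nat set" where
    g2: "\<And>e. e \<in> E \<Longrightarrow> g2 e \<subseteq> X2 \<and> card (g2 e) = (snd \<circ> fst) (ty e, g1 e)"
      "\<And>e e'. e \<in> E \<Longrightarrow> e' \<in> E \<Longrightarrow> col e = col e' \<Longrightarrow> e \<noteq> e' \<Longrightarrow> g2 e \<inter> g2 e' = {}"
      "\<And>l A. card {e\<in>E. (ty e, g1 e) = l \<and> g2 e = A} \<le> 1"
    by (rule equitable_set_assignment[where E = E and S = X2 and col = col and r = "snd \<circ> fst"
        and lab = "\<lambda>e. (ty e, g1 e)" and R = "\<lambda>_. 1"])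
      (use finE X size2 g1(3) in auto)
  define G where "G e = g1 e \<union> g2 e" for e
  have G: "G e \<inter> X1 = g1 e" "G e \<inter> X2 = g2 e" "G e \<subseteq> {..<2 * N}" if "e \<in> E" for e
    using g1(1)[OF that] g2(1)[OF that] X(5,6) by (auto simp: G_def)
  have finG: "finite (g1 e)" "finite (g2 e)" if "e \<in> E" for e
    using g1(1)[OF that] g2(1)[OF that] X(1,2) finite_subset by blast+
  have sub_eq: "e = e'" if e: "e \<in> E" "e' \<in> E" and sub: "G e \<subseteq> G e'" for e e'
  proof -
    have s: "g1 e \<subseteq> g1 e'" "g2 e \<subseteq> g2 e'"
      using Int_mono[OF sub order.refl, of X1] Int_mono[OF sub order.refl, of X2]
      by (simp_all add: G[OF e(1)] G[OF e(2)])
    then have "card (g1 e) \<le> card (g1 e')" "card (g2 e) \<le> card (g2 e')"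
      using finG[OF e(2)] by (auto intro: card_mono)
    then have t: "ty e = ty e'"
      using antichain[OF e] g1(1) g2(1) e by auto
    have "g1 e = g1 e'"
      by (rule card_subset_eq) (use s finG[OF e(2)] g1(1) e t in simp_all)
    moreover have "g2 e = g2 e'"
      by (rule card_subset_eq) (use s finG[OF e(2)] g2(1) e t in simp_all)
    ultimately have "{e, e'} \<subseteq> {d\<in>E. (ty d, g1 d) = (ty e, g1 e) \<and> g2 d = g2 e}"
      using e t by auto
    then have "card {e, e'} \<le> card {d\<in>E. (ty d, g1 d) = (ty e, g1 e) \<and> g2 d = g2 e}"
      by (rule card_mono[rotated]) (use finE in simp)
    also have "\<dots> \<le> 1" by (rule g2(3))
    finally have "card {e, e'} \<le> 1" .
    then show ?thesis by (auto simp: card_insert_if split: if_splits)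
  qed
  have injG: "inj_on G E" by (rule inj_onI) (metis sub_eq order_refl)
  define P where "P c = G ` {e\<in>E. col e = c}" for c
  have cardP: "card (P (col e)) = k" if "e \<in> E" for e
    unfolding P_def using slots[OF that] inj_on_subset[OF injG] by (subst card_image) auto
  have part: "partition_on {..<2 * N} (P (col e))" if e: "e \<in> E" for e
  proof (rule partition_onI)
    let ?Ec = "{e'\<in>E. col e' = col e}"
    have fc: "finite ?Ec" using finE by simp
    have "card (\<Union>e'\<in>?Ec. g1 e') = (\<Sum>e'\<in>?Ec. card (g1 e'))"
      by (rule card_UN_disjoint[OF fc]) (use finG g1(2) in auto)
    also have "\<dots> = card X1" using size1[OF e] g1(1) X by simp
    finally have u1: "(\<Union>e'\<in>?Ec. g1 e') = X1"
      using g1(1) X by (intro card_subset_eq) auto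
    have "card (\<Union>e'\<in>?Ec. g2 e') = (\<Sum>e'\<in>?Ec. card (g2 e'))"
      by (rule card_UN_disjoint[OF fc]) (use finG g2(2) in auto)
    also have "\<dots> = card X2" using size2[OF e] g2(1) X by simp
    finally have u2: "(\<Union>e'\<in>?Ec. g2 e') = X2"
      using g2(1) X by (intro card_subset_eq) auto
    have "\<Union> (P (col e)) = (\<Union>e'\<in>?Ec. g1 e') \<union> (\<Union>e'\<in>?Ec. g2 e')"
      by (auto simp: P_def G_def)
    then show "\<Union> (P (col e)) = {..<2 * N}" using u1 u2 X by simp
    show "{} \<notin> P (col e)"
    proof
      assume "{} \<in> P (col e)"
      then obtain d where d: "d \<in> E" "G d = {}" by (auto simp: P_def)
      then have "card (g1 d) = 0" "card (g2 d) = 0" by (auto simp: G_def)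
      then have "ty d = (0, 0)" using g1(1)[OF d(1)] g2(1)[OF d(1)] by (auto simp: prod_eq_iff)
      then show False using nonempty[OF d(1)] by simp
    qed
    fix p q assume pq: "p \<in> P (col e)" "q \<in> P (col e)" "p \<noteq> q"
    obtain a where a: "a \<in> E" "col a = col e" "p = G a" using pq(1) unfolding P_def by blast
    obtain b where b: "b \<in> E" "col b = col e" "q = G b" using pq(2) unfolding P_def by blast
    have ab: "a \<in> E" "b \<in> E" "col a = col b" "p = G a" "q = G b" "a \<noteq> b"
      using a b pq(3) by auto
    show "disjnt p q"
      using g1(2)[OF ab(1,2,3,6)] g2(2)[OF ab(1,2,3,6)] g1(1)[OF ab(1)] g1(1)[OF ab(2)]
        g2(1)[OF ab(1)] g2(1)[OF ab(2)] X(5) ab(4,5)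
      unfolding disjnt_def G_def by blast
  qed
  have colP: "c = c'" if AB: "A \<in> P c" "B \<in> P c'" "A \<subseteq> B" for c c' A B
  proof -
    obtain e e' where "e \<in> E" "col e = c" "A = G e" "e' \<in> E" "col e' = c'" "B = G e'"
      using AB(1,2) unfolding P_def by blast
    then show ?thesis using sub_eq[of e e'] AB(3) by blast
  qed
  have ne: "P c \<noteq> {}" if "c \<in> col ` E" for c using that by (auto simp: P_def)
  have injP: "inj_on P (col ` E)"
  proof (rule inj_onI)
    fix c c' assume "c \<in> col ` E" "c' \<in> col ` E" "P c = P c'"
    then obtain A where "A \<in> P c" "A \<in> P c'" using ne by auto
    then show "c = c'" using colP by blast
  qed
  have "sperner_partition_system {..<2 * N} k (P ` (col ` E))"
    unfolding sperner_partition_system_def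
  proof (intro conjI ballI impI)
    fix Q Q' A B assume "Q \<in> P ` (col ` E)" "Q' \<in> P ` (col ` E)" "Q \<noteq> Q'" "A \<in> Q" "B \<in> Q'"
    then show "\<not> A \<subseteq> B" using colP by (metis imageE)
  qed (use part cardP in auto)
  from card_le_SP[OF _ _ this, of "2 * N"] show ?thesis
    by (simp add: card_image[OF injP])
qed

section \<open>Types from zero-sum triples\<close>

text \<open>For \<open>\<bar>a\<bar> \<le> Q\<close> the maps \<open>a\<close>, \<open>perm2 Q a\<close>, \<open>perm3 Q a\<close> permute \<open>{-Q..Q}\<close> and add up to zero.\<close>

definition perm2 :: "int \<Rightarrow> int \<Rightarrow> int" where
  "perm2 Q a = (if a \<le> 0 then - Q - 2 * a else Q + 1 - 2 * a)"

definition perm3 :: "int \<Rightarrow> int \<Rightarrow> int" where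
  "perm3 Q a = - (a + perm2 Q a)"

lemma perm2_abs_le: "\<bar>a\<bar> \<le> Q \<Longrightarrow> \<bar>perm2 Q a\<bar> \<le> Q"
  by (auto simp: perm2_def)

lemma perm3_abs_le: "\<bar>a\<bar> \<le> Q \<Longrightarrow> \<bar>perm3 Q a\<bar> \<le> Q"
  by (auto simp: perm3_def perm2_def)

text \<open>The branch \<open>a \<le> 0\<close> takes values of the parity of \<open>Q\<close>, the
  other branch those of the opposite parity.\<close>

lemma perm2_inj: "perm2 Q a = perm2 Q b \<Longrightarrow> a = b"
  unfolding perm2_def by (auto split: if_splits; presburger)

text \<open>\<open>perm3 Q a\<close> is \<open>Q + a \<ge> 0\<close> for \<open>a \<le> 0\<close>
  and \<open>a - Q - 1 < 0\<close> for \<open>a > 0\<close>, so the sign tells the branches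
  apart.\<close>

lemma perm3_inj: "\<bar>a\<bar> \<le> Q \<Longrightarrow> \<bar>b\<bar> \<le> Q \<Longrightarrow> perm3 Q a = perm3 Q b \<Longrightarrow> a = b"
  unfolding perm3_def perm2_def by (auto split: if_splits)

lemma euclid_unique:
  fixes q q' u u' M :: int
  assumes "q * M + u = q' * M + u'" "0 \<le> u" "u < M" "0 \<le> u'" "u' < M"
  shows "q = q' \<and> u = u'"
proof -
  have M: "M > 0" using assms by linarith
  have "(q * M + u) div M = q" "(q' * M + u') div M = q'"
    using assms(2-5) M by (simp_all add: div_pos_pos_trivial)
  then have "q = q'" using assms(1) by metis
  then show ?thesis using assms(1) by simp
qed

text \<open>
  The number of sets of size \<open>2e\<close> (or \<open>2f + 1\<close>) that meet the halves in \<open>e + s\<close> and \<open>e - s\<close> (or \<open>f + j\<close> and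
  \<open>f + 1 - j\<close>) elements.
\<close>

definition even_layer :: "nat \<Rightarrow> nat \<Rightarrow> int \<Rightarrow> nat" where
  "even_layer N e s = (if \<bar>s\<bar> \<le> int e then (N choose nat (int e + s)) * (N choose nat (int e - s)) else 0)"

definition odd_layer :: "nat \<Rightarrow> nat \<Rightarrow> int \<Rightarrow> nat" where
  "odd_layer N f j = (if - int f \<le> j \<and> j \<le> int f + 1
     then (N choose nat (int f + j)) * (N choose nat (int f + 1 - j)) else 0)"

lemma even_layer_minus: "even_layer N e (- s) = even_layer N e s"
  by (simp add: even_layer_def)

lemma odd_layer_reflect: "odd_layer N f (1 - j) = odd_layer N f j"
proof -
  have "nat (int f + (1 - j)) = nat (int f + 1 - j)" "nat (int f + 1 - (1 - j)) = nat (int f + j)"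
    by simp_all
  then show ?thesis by (auto simp: odd_layer_def)
qed

section \<open>Triples of one even and two odd sets\<close>

text \<open>
  \<open>F\<close> is a layer-cake profile: every \<open>y\<close> contributes one family of triples spread uniformly over the
  periods \<open>a\<close> with \<open>y < F \<bar>a\<bar>\<close>.
\<close>

locale layered_triples =
  fixes N e f h g l Q0 :: nat and F :: "nat \<Rightarrow> nat" and M :: int
  assumes N: "N = e + (h + 1) * (2 * f + 1)"
    and ef: "f \<le> e" "e \<le> f + 1" "e > 0"
    and M: "M = int ((g + 1) * (2 * l + 1) + 1)"
    and F_antimono: "\<And>p q. p \<le> q \<Longrightarrow> F q \<le> F p"
    and F_zero: "F Q0 = 0"
    and F_even: "\<And>q. g * F q \<le> even_layer N e ((int q + 1) * M)"
    and F_odd: "\<And>q. (2 * h + 2) * F q \<le> odd_layer N f ((int q + 1) * M)"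
    and even_mono: "\<And>s s'. 0 \<le> s \<Longrightarrow> s \<le> s' \<Longrightarrow> even_layer N e s' \<le> even_layer N e s"
    and odd_mono: "\<And>j j'. 1 \<le> j \<Longrightarrow> j \<le> j' \<Longrightarrow> odd_layer N f j' \<le> odd_layer N f j"
begin

abbreviation "L \<equiv> 2 * int l + 1"

lemma M_eq: "M = int g * L + 2 * int l + 2"
  unfolding M by (simp add: algebra_simps)

lemma M_gt: "M > 2 * int l + 1" "int g * L + int l < M"
proof -
  have "0 \<le> int g * L" by simp
  then show "M > 2 * int l + 1" "int g * L + int l < M" unfolding M_eq by linarith+
qed

lemma M_pos: "M > 0"
  using M_gt by linarith

text \<open>The periods \<open>a\<close> with \<open>y < F (nat \<bar>a\<bar>)\<close> form a
  symmetric interval, and this is its radius; the value -1 stands for the empty interval.\<close>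

definition level :: "nat \<Rightarrow> int" where
  "level y = int (LEAST q. F q \<le> y) - 1"

lemma less_F_iff: "y < F (nat \<bar>a\<bar>) \<longleftrightarrow> \<bar>a\<bar> \<le> level y"
proof -
  have ex: "F (LEAST q. F q \<le> y) \<le> y" by (rule LeastI[of _ Q0]) (simp add: F_zero)
  have "y < F q \<longleftrightarrow> q < (LEAST q. F q \<le> y)" for q
    using ex F_antimono[of "LEAST q. F q \<le> y" q] not_less_Least[of q "\<lambda>q. F q \<le> y"]
    by (meson leD le_less_linear order_trans)
  then show ?thesis unfolding level_def by (auto simp: nat_less_iff)
qed

text \<open>
  In a triple \<open>(a, y, t, b)\<close>, \<open>a\<close> is the period of the even set, \<open>y\<close> is a level of \<open>F\<close>, \<open>t\<close> is the block of the
  odd sets within their periods, and \<open>b\<close> is the offset of the even set in its block. Both the periods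
  and the offsets of the three sets are balanced by zero-sum permutations.
\<close>

definition Tri :: "(int \<times> nat \<times> nat \<times> int) set" where
  "Tri = (SIGMA a:{- int Q0..int Q0}. {..<F (nat \<bar>a\<bar>)} \<times> {..<g} \<times> {- int l..int l})"

definition pos1 :: "int \<times> nat \<times> nat \<times> int \<Rightarrow> int" where
  "pos1 = (\<lambda>(a, y, t, b). a * M + b)"

text \<open>Offsets \<open>- l..l\<close> of a period belong to even sets, which forbids
  \<open>- l..l + 1\<close> to odd ones. The remaining \<open>g * L\<close> offsets start at
  \<open>l + 2\<close>, so block \<open>t\<close> has its centre at
  \<open>2 * l + 2 + t * L\<close>. In \<open>pos3\<close> the block is mirrored by \<open>j\<close>
  to \<open>1 - j\<close>; this makes the three positions add up to 1, as the sizes in the first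
  half require: \<open>(e + s) + (f + j) + (f + j') = e + 2 * f + 1\<close>.\<close>

definition pos2 :: "int \<times> nat \<times> nat \<times> int \<Rightarrow> int" where
  "pos2 = (\<lambda>(a, y, t, b). perm2 (level y) a * M + (2 * int l + 2 + int t * L + perm2 (int l) b))"

definition pos3 :: "int \<times> nat \<times> nat \<times> int \<Rightarrow> int" where
  "pos3 = (\<lambda>(a, y, t, b). perm3 (level y) a * M - (2 * int l + 1 + int t * L - perm3 (int l) b))"

lemma pos_sum: "pos1 \<omega> + pos2 \<omega> + pos3 \<omega> = 1"
proof -
  obtain a y t b where \<omega>: "\<omega> = (a, y, t, b)" by (cases \<omega>)
  have "pos1 \<omega> + pos2 \<omega> + pos3 \<omega>
      = (a + perm2 (level y) a + perm3 (level y) a) * M + (b + perm2 (int l) b + perm3 (int l) b) + 1"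
    by (simp add: \<omega> pos1_def pos2_def pos3_def algebra_simps)
  then show ?thesis by (simp add: perm3_def)
qed

lemma finite_Tri: "finite Tri" by (auto simp: Tri_def)

lemma card_Tri: "card Tri = g * (2 * l + 1) * (\<Sum>a\<in>{- int Q0..int Q0}. F (nat \<bar>a\<bar>))"
proof -
  have "card {- int l..int l} = 2 * l + 1" by simp
  then show ?thesis
    by (simp add: Tri_def card_SigmaI sum_distrib_left mult_ac del: card_atLeastAtMost_int)
qed

lemma TriD:
  assumes "(a, y, t, b) \<in> Tri"
  shows "\<bar>a\<bar> \<le> level y" "y < F (nat \<bar>a\<bar>)" "t < g" "\<bar>b\<bar> \<le> int l"
  using assms by (auto simp: Tri_def simp flip: less_F_iff)

lemma offset_bounds:
  assumes "t < g" "\<bar>x\<bar> \<le> int l"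
  shows "int l + 1 \<le> 2 * int l + 1 + int t * L + x" "2 * int l + 1 + int t * L + x \<le> int g * L + int l"
proof -
  have "0 \<le> int t * L" by simp
  then show "int l + 1 \<le> 2 * int l + 1 + int t * L + x" using assms by linarith
  have "(int t + 1) * L \<le> int g * L" using assms by (intro mult_right_mono) auto
  then have "int t * L + L \<le> int g * L" by (simp add: algebra_simps)
  then show "2 * int l + 1 + int t * L + x \<le> int g * L + int l" using assms by linarith
qed

text \<open>Offsets of odd sets are counted from position \<open>q * M + 1\<close>, so that
  mirroring \<open>j\<close> to \<open>1 - j\<close> acts as \<open>u\<close> to
  \<open>M - 1 - u\<close>.\<close>

definition off2 :: "int \<times> nat \<times> nat \<times> int \<Rightarrow> int" where
  "off2 = (\<lambda>(a, y, t, b). 2 * int l + 1 + int t * L + perm2 (int l) b)"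

definition off3 :: "int \<times> nat \<times> nat \<times> int \<Rightarrow> int" where
  "off3 = (\<lambda>(a, y, t, b). M - 1 - (2 * int l + 1 + int t * L - perm3 (int l) b))"

lemma pos2_eq: "pos2 (a, y, t, b) = perm2 (level y) a * M + off2 (a, y, t, b) + 1"
  by (simp add: pos2_def off2_def)

lemma pos3_eq: "pos3 (a, y, t, b) = (perm3 (level y) a - 1) * M + off3 (a, y, t, b) + 1"
  by (simp add: pos3_def off3_def algebra_simps)

lemma off2_bounds:
  assumes "\<omega> \<in> Tri" shows "int l + 1 \<le> off2 \<omega>" "off2 \<omega> \<le> int g * L + int l"
proof -
  obtain a y t b where \<omega>: "\<omega> = (a, y, t, b)" by (cases \<omega>)
  note T = TriD[OF assms[unfolded \<omega>]]
  show "int l + 1 \<le> off2 \<omega>" "off2 \<omega> \<le> int g * L + int l"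
    using offset_bounds[OF T(3) perm2_abs_le[OF T(4)]] by (simp_all add: \<omega> off2_def)
qed

lemma off3_bounds:
  assumes "\<omega> \<in> Tri" shows "int l + 1 \<le> off3 \<omega>" "off3 \<omega> \<le> int g * L + int l"
proof -
  obtain a y t b where \<omega>: "\<omega> = (a, y, t, b)" by (cases \<omega>)
  note T = TriD[OF assms[unfolded \<omega>]]
  have "\<bar>- perm3 (int l) b\<bar> \<le> int l" using perm3_abs_le[OF T(4)] by simp
  from offset_bounds[OF T(3) this] show "int l + 1 \<le> off3 \<omega>" "off3 \<omega> \<le> int g * L + int l"
    using M_eq unfolding \<omega> off3_def prod.case by linarith+
qed

lemma offset_inj:
  assumes "int t * L + x = int t' * L + x'" "\<bar>x\<bar> \<le> int l" "\<bar>x'\<bar> \<le> int l"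
  shows "t = t' \<and> x = x'"
  using euclid_unique[of "int t" L "x + int l" "int t'" "x' + int l"] assms by auto

text \<open>An even position determines the period and the offset; the level \<open>y\<close> and
  the block \<open>t\<close> stay free, whence the factor \<open>g\<close>.\<close>

lemma card_pos1_le:
  assumes "(a0, y0, t0, b0) \<in> Tri"
  shows "card {\<omega>\<in>Tri. pos1 \<omega> = pos1 (a0, y0, t0, b0)} \<le> g * F (nat \<bar>a0\<bar>)"
proof -
  let ?A = "{\<omega>\<in>Tri. pos1 \<omega> = pos1 (a0, y0, t0, b0)}"
  have ab: "a = a0 \<and> b = b0" if "(a, y, t, b) \<in> ?A" for a y t b
  proof -
    have "a * M + (b + int l) = a0 * M + (b0 + int l)" using that by (simp add: pos1_def)
    moreover have "\<bar>b\<bar> \<le> int l" "\<bar>b0\<bar> \<le> int l" using that TriD assms by blast+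
    ultimately show ?thesis
      using euclid_unique[of a M "b + int l" a0 "b0 + int l"] M_gt by auto
  qed
  have "card ?A \<le> card ({..<F (nat \<bar>a0\<bar>)} \<times> {..<g})"
  proof (rule card_inj_on_le[where f = "\<lambda>(a, y, t, b). (y, t)"])
    show "inj_on (\<lambda>(a, y, t, b). (y, t)) ?A"
    proof (rule inj_onI)
      fix \<omega> \<omega>' assume A: "\<omega> \<in> ?A" "\<omega>' \<in> ?A"
        and eq: "(\<lambda>(a, y, t, b). (y, t)) \<omega> = (\<lambda>(a, y, t, b). (y, t)) \<omega>'"
      obtain a y t b where \<omega>: "\<omega> = (a, y, t, b)" by (cases \<omega>)
      obtain a' b' where \<omega>': "\<omega>' = (a', y, t, b')" using eq \<omega> by (cases \<omega>') auto
      show "\<omega> = \<omega>'" using ab[OF A(1)[unfolded \<omega>]] ab[OF A(2)[unfolded \<omega>']] by (simp add: \<omega> \<omega>')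
    qed
    show "(\<lambda>(a, y, t, b). (y, t)) ` ?A \<subseteq> {..<F (nat \<bar>a0\<bar>)} \<times> {..<g}"
    proof
      fix z assume "z \<in> (\<lambda>(a, y, t, b). (y, t)) ` ?A"
      then obtain a y t b where A: "(a, y, t, b) \<in> ?A" "z = (y, t)" by auto
      then show "z \<in> {..<F (nat \<bar>a0\<bar>)} \<times> {..<g}"
        using ab[OF A(1)] TriD[of a y t b] by auto
    qed
  qed auto
  then show ?thesis by (simp add: mult.commute)
qed

text \<open>Here the position determines the block as well, and for given \<open>y\<close> the
  triple is recovered by injectivity of the permutations. The bound on \<open>y\<close> holds
  because \<open>perm2 (level y)\<close> maps the interval of radius \<open>level y\<close> into
  itself.\<close>

lemma card_pos2_le:
  assumes u: "0 \<le> u" "u < M"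
  shows "card {\<omega>\<in>Tri. pos2 \<omega> = q * M + u + 1} \<le> F (nat \<bar>q\<bar>)"
proof -
  let ?A = "{\<omega>\<in>Tri. pos2 \<omega> = q * M + u + 1}"
  have ab: "perm2 (level y) a = q \<and> off2 (a, y, t, b) = u" if "(a, y, t, b) \<in> ?A" for a y t b
    using euclid_unique[of "perm2 (level y) a" M "off2 (a, y, t, b)" q u] that u
      off2_bounds[of "(a, y, t, b)"] M_gt by (simp add: pos2_eq)
  have "card ?A \<le> card {..<F (nat \<bar>q\<bar>)}"
  proof (rule card_inj_on_le[where f = "\<lambda>(a, y, t, b). y"])
    show "inj_on (\<lambda>(a, y, t, b). y) ?A"
    proof (rule inj_onI)
      fix \<omega> \<omega>' assume A: "\<omega> \<in> ?A" "\<omega>' \<in> ?A" and eq: "(\<lambda>(a, y, t, b). y) \<omega> = (\<lambda>(a, y, t, b). y) \<omega>'"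
      obtain a y t b where \<omega>: "\<omega> = (a, y, t, b)" by (cases \<omega>)
      obtain a' t' b' where \<omega>': "\<omega>' = (a', y, t', b')" using eq \<omega> by (cases \<omega>') auto
      have T: "\<bar>b\<bar> \<le> int l" "\<bar>b'\<bar> \<le> int l" using A TriD unfolding \<omega> \<omega>' by blast+
      note ab1 = ab[OF A(1)[unfolded \<omega>]] and ab2 = ab[OF A(2)[unfolded \<omega>']]
      have a: "a = a'" using ab1 ab2 perm2_inj[of "level y" a a'] by auto
      have "int t * L + perm2 (int l) b = int t' * L + perm2 (int l) b'"
        using ab1 ab2 by (simp add: off2_def)
      then have "t = t'" "perm2 (int l) b = perm2 (int l) b'"
        using offset_inj perm2_abs_le T by blast+
      then show "\<omega> = \<omega>'" using a perm2_inj[of "int l" b b'] by (simp add: \<omega> \<omega>')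
    qed
    show "(\<lambda>(a, y, t, b). y) ` ?A \<subseteq> {..<F (nat \<bar>q\<bar>)}"
    proof
      fix z assume "z \<in> (\<lambda>(a, y, t, b). y) ` ?A"
      then obtain a t b where A: "(a, z, t, b) \<in> ?A" by auto
      then have "\<bar>a\<bar> \<le> level z" using TriD(1)[of a z t b] by simp
      then show "z \<in> {..<F (nat \<bar>q\<bar>)}"
        using perm2_abs_le[of a "level z"] ab[OF A] less_F_iff by auto
    qed
  qed auto
  then show ?thesis by simp
qed

text \<open>Mirroring moves the block into the preceding period, hence \<open>q + 1\<close> in place
  of \<open>q\<close>.\<close>

lemma card_pos3_le:
  assumes u: "0 \<le> u" "u < M"
  shows "card {\<omega>\<in>Tri. pos3 \<omega> = q * M + u + 1} \<le> F (nat \<bar>q + 1\<bar>)"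
proof -
  let ?A = "{\<omega>\<in>Tri. pos3 \<omega> = q * M + u + 1}"
  have ab: "perm3 (level y) a = q + 1 \<and> off3 (a, y, t, b) = u" if "(a, y, t, b) \<in> ?A" for a y t b
    using euclid_unique[of "perm3 (level y) a - 1" M "off3 (a, y, t, b)" q u] that u
      off3_bounds[of "(a, y, t, b)"] M_gt by (simp add: pos3_eq)
  have "card ?A \<le> card {..<F (nat \<bar>q + 1\<bar>)}"
  proof (rule card_inj_on_le[where f = "\<lambda>(a, y, t, b). y"])
    show "inj_on (\<lambda>(a, y, t, b). y) ?A"
    proof (rule inj_onI)
      fix \<omega> \<omega>' assume A: "\<omega> \<in> ?A" "\<omega>' \<in> ?A" and eq: "(\<lambda>(a, y, t, b). y) \<omega> = (\<lambda>(a, y, t, b). y) \<omega>'"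
      obtain a y t b where \<omega>: "\<omega> = (a, y, t, b)" by (cases \<omega>)
      obtain a' t' b' where \<omega>': "\<omega>' = (a', y, t', b')" using eq \<omega> by (cases \<omega>') auto
      have T: "\<bar>b\<bar> \<le> int l" "\<bar>b'\<bar> \<le> int l" "\<bar>a\<bar> \<le> level y" "\<bar>a'\<bar> \<le> level y"
        using A TriD unfolding \<omega> \<omega>' by blast+
      note ab1 = ab[OF A(1)[unfolded \<omega>]] and ab2 = ab[OF A(2)[unfolded \<omega>']]
      have a: "a = a'" using ab1 ab2 perm3_inj[of a "level y" a'] T by auto
      have "int t * L + (- perm3 (int l) b) = int t' * L + (- perm3 (int l) b')"
        using ab1 ab2 by (simp add: off3_def)
      moreover have "\<bar>- perm3 (int l) b\<bar> \<le> int l" "\<bar>- perm3 (int l) b'\<bar> \<le> int l"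
        using perm3_abs_le T by simp_all
      ultimately have "t = t'" "- perm3 (int l) b = - perm3 (int l) b'"
        using offset_inj by blast+
      then show "\<omega> = \<omega>'" using a perm3_inj[of b "int l" b'] T by (simp add: \<omega> \<omega>')
    qed
    show "(\<lambda>(a, y, t, b). y) ` ?A \<subseteq> {..<F (nat \<bar>q + 1\<bar>)}"
    proof
      fix z assume "z \<in> (\<lambda>(a, y, t, b). y) ` ?A"
      then obtain a t b where A: "(a, z, t, b) \<in> ?A" by auto
      then have "\<bar>a\<bar> \<le> level z" using TriD(1)[of a z t b] by simp
      then show "z \<in> {..<F (nat \<bar>q + 1\<bar>)}"
        using perm3_abs_le[of a "level z"] ab[OF A] less_F_iff by auto
    qed
  qed auto
  then show ?thesis by simp
qed

end

lemma sum_abs_int: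
  fixes F :: "nat \<Rightarrow> nat"
  shows "(\<Sum>a\<in>{- int n..int n}. F (nat \<bar>a\<bar>)) + F 0 = 2 * (\<Sum>q\<le>n. F q)"
proof (induction n)
  case (Suc n)
  have "{- int (Suc n)..int (Suc n)} = insert (- int (Suc n)) (insert (int (Suc n)) {- int n..int n})"
    by auto
  then have "(\<Sum>a\<in>{- int (Suc n)..int (Suc n)}. F (nat \<bar>a\<bar>))
      = 2 * F (Suc n) + (\<Sum>a\<in>{- int n..int n}. F (nat \<bar>a\<bar>))"
    by (simp add: nat_add_distrib)
  then show ?case using Suc by simp
qed simp

lemma sum_lessThan_pairs:
  fixes G :: "nat \<Rightarrow> nat"
  shows "(\<Sum>i<2 * h + 3. G i) = G 0 + G 1 + G 2 + (\<Sum>a<h. G (2 * a + 3) + G (2 * a + 4))"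
proof (induction h)
  case 0
  have "{..<3 :: nat} = {0, 1, 2}" by auto
  then show ?case by simp
next
  case (Suc h)
  have "2 * Suc h + 3 = Suc (Suc (2 * h + 3))" by simp
  then have "(\<Sum>i<2 * Suc h + 3. G i) = (\<Sum>i<2 * h + 3. G i) + G (2 * h + 3) + G (Suc (2 * h + 3))"
    by (simp only: sum.lessThan_Suc)
  moreover have "Suc (2 * h + 3) = 2 * h + 4" by simp
  ultimately show ?case using Suc by simp
qed

lemma half_parity_eq:
  fixes a b :: nat
  assumes "(a - 3) div 2 = (b - 3) div 2" "even a = even b" "3 \<le> a" "3 \<le> b"
  shows "a = b"
proof -
  have mod: "(c - 3) mod 2 = (if even c then 1 else 0)" if "3 \<le> c" for c :: nat
    using that by presburger
  then show ?thesis
    using assms div_mult_mod_eq[of "a - 3" 2] div_mult_mod_eq[of "b - 3" 2] by simp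
qed

section \<open>Pairs for the remaining odd sets\<close>

context layered_triples
begin

text \<open>Of the capacity \<open>(2 * h + 2) * F q\<close> at a position in period
  \<open>q\<close>, the second sets of the triples take at most \<open>F q\<close> and the third
  sets at most \<open>F (q + 1)\<close>.\<close>

definition rest :: "nat \<Rightarrow> nat" where
  "rest q = (2 * h + 2) * F q - F q - F (q + 1)"

lemma rest_eq: "F q + F (q + 1) + rest q = (2 * h + 2) * F q"
  using F_antimono[of q "q + 1"] by (simp add: rest_def algebra_simps)

text \<open>
  A token \<open>(q, u, y)\<close> is a pair of odd sets at the positions \<open>tokpos (q, u, y)\<close> and \<open>1 - tokpos (q, u, y)\<close>.
\<close>

definition Tok :: "(nat \<times> nat \<times> nat) set" where
  "Tok = (SIGMA q:{..<Q0}. {..<g * (2 * l + 1)} \<times> {..<rest q})"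

definition tokpos :: "nat \<times> nat \<times> nat \<Rightarrow> int" where
  "tokpos = (\<lambda>(q, u, y). int q * M + (int l + 1 + int u) + 1)"

text \<open>Each triple needs \<open>h\<close> tokens. By telescoping, the \<open>rest q\<close> add
  up to \<open>2 * h\<close> times the sum of the \<open>F q\<close>, plus \<open>F 0\<close>.
  Counting \<open>F\<close> over all periods, positive and negative, gives twice the sum of the
  \<open>F q\<close>, minus \<open>F 0\<close>.\<close>

lemma card_Tri_le_Tok: "card (Tri \<times> {..<h}) \<le> card Tok"
proof -
  have "(\<Sum>q<Q0. rest q) + (\<Sum>q<Q0. F q) + (\<Sum>q<Q0. F (Suc q)) = (2 * h + 2) * (\<Sum>q<Q0. F q)"
    using rest_eq by (simp add: sum_distrib_left ac_simps flip: sum.distrib)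
  moreover have "F 0 + (\<Sum>q<Q0. F (Suc q)) = (\<Sum>q<Q0. F q)"
    using sum.lessThan_Suc_shift[of F Q0] F_zero by simp
  ultimately have "2 * h * (\<Sum>q<Q0. F q) \<le> (\<Sum>q<Q0. rest q)"
    by (simp add: algebra_simps)
  moreover have "(\<Sum>a\<in>{- int Q0..int Q0}. F (nat \<bar>a\<bar>)) \<le> 2 * (\<Sum>q<Q0. F q)"
    using sum_abs_int[of F Q0] F_zero by (simp add: lessThan_Suc_atMost[symmetric])
  from mult_le_mono2[OF this, of h]
  have "h * (\<Sum>a\<in>{- int Q0..int Q0}. F (nat \<bar>a\<bar>)) \<le> 2 * h * (\<Sum>q<Q0. F q)"
    by (simp only: mult_ac)
  ultimately have "h * (\<Sum>a\<in>{- int Q0..int Q0}. F (nat \<bar>a\<bar>)) \<le> (\<Sum>q<Q0. rest q)"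
    by (rule order_trans[rotated])
  then have "g * (2 * l + 1) * (h * (\<Sum>a\<in>{- int Q0..int Q0}. F (nat \<bar>a\<bar>)))
      \<le> g * (2 * l + 1) * (\<Sum>q<Q0. rest q)"
    by (rule mult_le_mono2)
  moreover have "card (Tri \<times> {..<h}) = g * (2 * l + 1) * (h * (\<Sum>a\<in>{- int Q0..int Q0}. F (nat \<bar>a\<bar>)))"
    by (simp add: card_cartesian_product card_Tri mult_ac)
  moreover have "card Tok = g * (2 * l + 1) * (\<Sum>q<Q0. rest q)"
    by (simp add: Tok_def card_SigmaI mult_ac flip: sum_distrib_left sum_distrib_right)
  ultimately show ?thesis by simp
qed

definition tok :: "(int \<times> nat \<times> nat \<times> int) \<times> nat \<Rightarrow> nat \<times> nat \<times> nat" where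
  "tok = (SOME \<pi>. \<pi> ` (Tri \<times> {..<h}) \<subseteq> Tok \<and> inj_on \<pi> (Tri \<times> {..<h}))"

lemma tok: "tok ` (Tri \<times> {..<h}) \<subseteq> Tok" "inj_on tok (Tri \<times> {..<h})"
proof -
  have "\<exists>\<pi>. \<pi> ` (Tri \<times> {..<h}) \<subseteq> Tok \<and> inj_on \<pi> (Tri \<times> {..<h})"
    by (rule card_le_inj) (use card_Tri_le_Tok finite_Tri in \<open>auto simp: Tok_def\<close>)
  from someI_ex[OF this] show "tok ` (Tri \<times> {..<h}) \<subseteq> Tok" "inj_on tok (Tri \<times> {..<h})"
    unfolding tok_def by blast+
qed

text \<open>Slot 0 is the even set, slots 1 and 2 are the odd sets of the triple, and slots
  \<open>2 * a + 3\<close> and \<open>2 * a + 4\<close> share the token of index \<open>a\<close>,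
  the second one mirrored.\<close>

definition dpos :: "(int \<times> nat \<times> nat \<times> int) \<times> nat \<Rightarrow> int" where
  "dpos = (\<lambda>(\<omega>, i). if i = 1 then pos2 \<omega> else if i = 2 then pos3 \<omega>
     else if even i then 1 - tokpos (tok (\<omega>, (i - 3) div 2)) else tokpos (tok (\<omega>, (i - 3) div 2)))"

definition odd_slot :: "int \<Rightarrow> int \<Rightarrow> int \<Rightarrow> bool" where
  "odd_slot j q u \<longleftrightarrow> j = q * M + u + 1 \<and> int l + 1 \<le> u \<and> u \<le> int g * L + int l"

lemma odd_slot_bounds: "odd_slot j q u \<Longrightarrow> 0 \<le> u \<and> u < M"
  using M_gt by (auto simp: odd_slot_def)

text \<open>Since \<open>M = g * L + 2 * l + 2\<close>, the map \<open>u\<close> to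
  \<open>M - 1 - u\<close> preserves the range from \<open>l + 1\<close> to
  \<open>g * L + l\<close>.\<close>

lemma odd_slot_reflect: "odd_slot j q u \<Longrightarrow> odd_slot (1 - j) (- q - 1) (M - 1 - u)"
  unfolding odd_slot_def using M_eq by (simp add: algebra_simps)

lemma odd_slot_tokpos:
  assumes "(q, u, y) \<in> Tok" shows "odd_slot (tokpos (q, u, y)) (int q) (int l + 1 + int u)"
proof -
  have "u + 1 \<le> g * (2 * l + 1)" using assms by (auto simp: Tok_def)
  then have "int (u + 1) \<le> int (g * (2 * l + 1))" by (simp only: of_nat_le_iff)
  then have "int u + 1 \<le> int g * L" by (simp add: algebra_simps)
  then show ?thesis by (simp add: odd_slot_def tokpos_def)
qed

lemma tok_in:
  assumes "\<omega> \<in> Tri" "3 \<le> i" "i < 2 * h + 3"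
  shows "(\<omega>, (i - 3) div 2) \<in> Tri \<times> {..<h}" "tok (\<omega>, (i - 3) div 2) \<in> Tok"
proof -
  show "(\<omega>, (i - 3) div 2) \<in> Tri \<times> {..<h}" using assms by auto
  then show "tok (\<omega>, (i - 3) div 2) \<in> Tok" using tok(1) by blast
qed

lemma dpos_odd_slot:
  assumes "\<omega> \<in> Tri" "1 \<le> i" "i < 2 * h + 3"
  shows "\<exists>q u. odd_slot (dpos (\<omega>, i)) q u"
proof -
  obtain a y t b where \<omega>: "\<omega> = (a, y, t, b)" by (cases \<omega>)
  consider "i = 1" | "i = 2" | "3 \<le> i" using assms by linarith
  then show ?thesis
  proof cases
    case 1
    have "odd_slot (pos2 \<omega>) (perm2 (level y) a) (off2 \<omega>)"
      using off2_bounds[OF assms(1)] by (simp add: odd_slot_def pos2_eq \<omega>)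
    then show ?thesis using 1 by (auto simp: dpos_def)
  next
    case 2
    have "odd_slot (pos3 \<omega>) (perm3 (level y) a - 1) (off3 \<omega>)"
      using off3_bounds[OF assms(1)] by (simp add: odd_slot_def pos3_eq \<omega>)
    then show ?thesis using 2 by (auto simp: dpos_def)
  next
    case 3
    obtain q u z where tk: "tok (\<omega>, (i - 3) div 2) = (q, u, z)" by (metis prod_cases3)
    have s: "odd_slot (tokpos (q, u, z)) (int q) (int l + 1 + int u)"
      using tok_in(2)[OF assms(1) 3 assms(3)] tk odd_slot_tokpos by simp
    show ?thesis
    proof (cases "even i")
      case True
      then have "dpos (\<omega>, i) = 1 - tokpos (q, u, z)" using 3 tk by (auto simp: dpos_def)
      then show ?thesis using odd_slot_reflect[OF s] by auto
    next
      case False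
      then have "dpos (\<omega>, i) = tokpos (q, u, z)" using 3 tk by (auto simp: dpos_def)
      then show ?thesis using s by auto
    qed
  qed
qed

lemma odd_slot_sign:
  assumes "odd_slot j q u" shows "0 \<le> q \<longleftrightarrow> 1 \<le> j"
proof
  assume "0 \<le> q"
  then have "0 \<le> q * M" using M_pos by simp
  then show "1 \<le> j" using assms odd_slot_bounds[OF assms] by (simp add: odd_slot_def)
next
  assume "1 \<le> j"
  show "0 \<le> q"
  proof (rule ccontr)
    assume "\<not> 0 \<le> q"
    then have "q * M \<le> - 1 * M" using M_pos by (intro mult_right_mono) auto
    then show False using \<open>1 \<le> j\<close> assms odd_slot_bounds[OF assms] by (simp add: odd_slot_def)
  qed
qed

lemma odd_slot_unique: "odd_slot j q u \<Longrightarrow> odd_slot j q' u' \<Longrightarrow> q = q' \<and> u = u'"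
  using euclid_unique[of q M u q' u'] odd_slot_bounds[of j q u] odd_slot_bounds[of j q' u']
  by (auto simp: odd_slot_def)

text \<open>The sign of \<open>q\<close> decides whether the slot is mirrored, and the position then
  fixes the first two components of its token. Only the third one, below \<open>rest q'\<close>, is
  left; as \<open>tok\<close> is injective, it determines the triple and the pair.\<close>

lemma card_pair_slots_le:
  assumes j: "odd_slot j q u" and q': "q' = (if 0 \<le> q then nat q else nat (- q - 1))"
  shows "card {s\<in>Tri \<times> {3..<2 * h + 3}. dpos s = j} \<le> rest q'"
proof -
  let ?A = "{s\<in>Tri \<times> {3..<2 * h + 3}. dpos s = j}"
  let ?tk = "\<lambda>s. tok (fst s, (snd s - 3) div 2)"
  define u' where "u' = (if 0 \<le> q then u else M - 1 - u)"
  have key: "fst (?tk s) = q' \<and> int l + 1 + int (fst (snd (?tk s))) = u'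
      \<and> snd (snd (?tk s)) < rest q' \<and> (even (snd s) \<longleftrightarrow> \<not> 0 \<le> q)"
    if sA: "s \<in> ?A" for s
  proof -
    obtain \<omega> i where s0: "s = (\<omega>, i)" by (cases s)
    with sA have s: "s = (\<omega>, i)" "\<omega> \<in> Tri" "3 \<le> i" "i < 2 * h + 3" "dpos (\<omega>, i) = j" by auto
    obtain p v z where tk: "tok (\<omega>, (i - 3) div 2) = (p, v, z)" by (metis prod_cases3)
    have T: "(p, v, z) \<in> Tok" using tok_in(2)[OF s(2-4)] tk by simp
    note sl = odd_slot_tokpos[OF T]
    have z: "z < rest p" using T by (auto simp: Tok_def)
    have pos: "1 \<le> tokpos (p, v, z)" using odd_slot_sign[OF sl] by simp
    show ?thesis
    proof (cases "even i")
      case True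
      then have "j = 1 - tokpos (p, v, z)" using s tk by (auto simp: dpos_def)
      then have "odd_slot j (- int p - 1) (M - 1 - (int l + 1 + int v))"
        using odd_slot_reflect[OF sl] by simp
      from odd_slot_unique[OF this j] z True tk s show ?thesis
        unfolding q' u'_def by auto
    next
      case False
      then have "j = tokpos (p, v, z)" using s tk by (auto simp: dpos_def)
      from odd_slot_unique[OF sl[folded this] j] z False tk s show ?thesis
        unfolding q' u'_def by auto
    qed
  qed
  have "card ?A \<le> card {..<rest q'}"
  proof (rule card_inj_on_le[where f = "\<lambda>s. snd (snd (?tk s))"])
    show "inj_on (\<lambda>s. snd (snd (?tk s))) ?A"
    proof (rule inj_onI)
      fix s s' assume A: "s \<in> ?A" "s' \<in> ?A" and eq: "snd (snd (?tk s)) = snd (snd (?tk s'))"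
      have "?tk s = ?tk s'"
        using key[OF A(1)] key[OF A(2)] eq by (auto simp: prod_eq_iff)
      moreover have in1: "(fst s, (snd s - 3) div 2) \<in> Tri \<times> {..<h}" "(fst s', (snd s' - 3) div 2) \<in> Tri \<times> {..<h}"
        using A tok_in(1)[of "fst s" "snd s"] tok_in(1)[of "fst s'" "snd s'"] by auto
      ultimately have "(fst s, (snd s - 3) div 2) = (fst s', (snd s' - 3) div 2)"
        using tok(2) by (meson inj_onD)
      then have eqs: "fst s = fst s'" "(snd s - 3) div 2 = (snd s' - 3) div 2" by auto
      have "even (snd s) \<longleftrightarrow> even (snd s')" using key[OF A(1)] key[OF A(2)] by simp
      moreover have "3 \<le> snd s" "3 \<le> snd s'" using A by auto
      ultimately have "snd s = snd s'" using eqs(2) half_parity_eq by blast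
      then show "s = s'" using eqs(1) by (simp add: prod_eq_iff)
    qed
    show "(\<lambda>s. snd (snd (?tk s))) ` ?A \<subseteq> {..<rest q'}" using key by blast
  qed auto
  then show ?thesis by simp
qed

text \<open>The bounds for the three kinds of odd slots add up to \<open>(2 * h + 2) * F q'\<close>.
  This fits the layer at the end of the period farthest from the middle, where the layers of the
  period are smallest.\<close>

lemma card_odd_slots_le:
  assumes j: "odd_slot j q u"
  shows "card {s\<in>Tri \<times> {1..<2 * h + 3}. dpos s = j} \<le> odd_layer N f j"
proof -
  define q' where "q' = (if 0 \<le> q then nat q else nat (- q - 1))"
  note ub = odd_slot_bounds[OF j]
  have jq: "j = q * M + u + 1" using j by (simp add: odd_slot_def)
  let ?A2 = "{\<omega>\<in>Tri. pos2 \<omega> = j}" and ?A3 = "{\<omega>\<in>Tri. pos3 \<omega> = j}"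
  let ?B = "{s\<in>Tri \<times> {3..<2 * h + 3}. dpos s = j}"
  have fin: "finite ?A2" "finite ?A3" "finite ?B" using finite_Tri by auto
  have "{s\<in>Tri \<times> {1..<2 * h + 3}. dpos s = j} \<subseteq> (\<lambda>\<omega>. (\<omega>, 1)) ` ?A2 \<union> (\<lambda>\<omega>. (\<omega>, 2)) ` ?A3 \<union> ?B"
  proof
    fix s assume s: "s \<in> {s\<in>Tri \<times> {1..<2 * h + 3}. dpos s = j}"
    obtain \<omega> i where "s = (\<omega>, i)" by (cases s)
    moreover have "i = 1 \<or> i = 2 \<or> 3 \<le> i" using s calculation by auto
    ultimately show "s \<in> (\<lambda>\<omega>. (\<omega>, 1)) ` ?A2 \<union> (\<lambda>\<omega>. (\<omega>, 2)) ` ?A3 \<union> ?B"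
      using s by (auto simp: dpos_def)
  qed
  then have "card {s\<in>Tri \<times> {1..<2 * h + 3}. dpos s = j}
      \<le> card ((\<lambda>\<omega>. (\<omega>, 1 :: nat)) ` ?A2 \<union> (\<lambda>\<omega>. (\<omega>, 2)) ` ?A3 \<union> ?B)"
    by (rule card_mono[rotated]) (use fin in auto)
  also have "\<dots> \<le> card ?A2 + card ?A3 + card ?B"
    using fin by (meson add_le_mono card_Un_le card_image_le le_refl order_trans)
  also have "\<dots> \<le> F (nat \<bar>q\<bar>) + F (nat \<bar>q + 1\<bar>) + rest q'"
    using card_pos2_le[of u q] card_pos3_le[of u q] card_pair_slots_le[OF j q'_def] ub
    unfolding jq by (intro add_mono) auto
  \<comment> \<open>For negative \<open>q\<close> the second and third sets exchange roles:
    \<open>q' = - q - 1\<close>, so \<open>\<bar>q + 1\<bar> = q'\<close> and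
    \<open>\<bar>q\<bar> = q' + 1\<close>.\<close>
  also have "\<dots> = F q' + F (q' + 1) + rest q'"
    by (cases "0 \<le> q") (auto simp: q'_def nat_add_distrib nat_diff_distrib abs_if algebra_simps
        intro!: arg_cong[of _ _ F])
  also have "\<dots> = (2 * h + 2) * F q'" by (rule rest_eq)
  also have "\<dots> \<le> odd_layer N f ((int q' + 1) * M)" by (rule F_odd)
  also have "\<dots> \<le> odd_layer N f j"
  proof (cases "0 \<le> q")
    case True
    then have "j \<le> (int q' + 1) * M" using ub by (simp add: q'_def jq algebra_simps)
    then show ?thesis using odd_mono odd_slot_sign[OF j] True by simp
  next
    case False
    note r = odd_slot_reflect[OF j]
    have "1 \<le> 1 - j" using odd_slot_sign[OF r] False by simp
    moreover have "1 - j \<le> (int q' + 1) * M"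
      using ub False by (simp add: q'_def jq algebra_simps)
    ultimately show ?thesis using odd_mono[of "1 - j"] odd_layer_reflect by metis
  qed
  finally show ?thesis .
qed

lemma card_even_slots_le:
  assumes "\<omega>0 \<in> Tri"
  shows "card {\<omega>\<in>Tri. pos1 \<omega> = pos1 \<omega>0} \<le> even_layer N e (pos1 \<omega>0)"
proof -
  obtain a y t b where \<omega>0: "\<omega>0 = (a, y, t, b)" by (cases \<omega>0)
  have b: "\<bar>b\<bar> \<le> int l" using assms TriD \<omega>0 by blast
  have "card {\<omega>\<in>Tri. pos1 \<omega> = pos1 \<omega>0} \<le> g * F (nat \<bar>a\<bar>)"
    using card_pos1_le assms unfolding \<omega>0 by blast
  also have "\<dots> \<le> even_layer N e ((int (nat \<bar>a\<bar>) + 1) * M)" by (rule F_even)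
  also have "\<dots> \<le> even_layer N e \<bar>pos1 \<omega>0\<bar>"
  proof (rule even_mono)
    have "\<bar>a * M + b\<bar> \<le> \<bar>a\<bar> * M + \<bar>b\<bar>"
      using abs_triangle_ineq[of "a * M" b] M_pos by (simp add: abs_mult)
    also have "\<dots> \<le> (\<bar>a\<bar> + 1) * M" using b M_gt by (simp add: algebra_simps)
    finally show "\<bar>pos1 \<omega>0\<bar> \<le> (int (nat \<bar>a\<bar>) + 1) * M" by (simp add: \<omega>0 pos1_def)
  qed simp
  also have "\<dots> = even_layer N e (pos1 \<omega>0)"
    by (cases "0 \<le> pos1 \<omega>0") (auto simp: even_layer_minus)
  finally show ?thesis .
qed

text \<open>Otherwise \<open>(q - a) * M\<close> would lie strictly between \<open>- M\<close> and
  0: odd offsets range from \<open>l + 2\<close> to \<open>M - l - 1\<close>, whereas even offsets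
  stay in \<open>- l..l\<close>.\<close>

lemma even_odd_separate:
  assumes "\<omega> \<in> Tri" "odd_slot j q u" shows "j \<noteq> pos1 \<omega>" "j \<noteq> pos1 \<omega> + 1"
proof -
  obtain a y t b where \<omega>: "\<omega> = (a, y, t, b)" by (cases \<omega>)
  have b: "\<bar>b\<bar> \<le> int l" using assms TriD \<omega> by blast
  have "(q - a) * M = b + \<epsilon> - u - 1" if "j = pos1 \<omega> + \<epsilon>" for \<epsilon>
    using that assms(2) by (simp add: \<omega> pos1_def odd_slot_def algebra_simps)
  moreover have "(q - a) * M \<ge> 0 \<or> (q - a) * M \<le> - M"
  proof (cases "q - a \<ge> 0")
    case True
    then show ?thesis using M_pos by simp
  next
    case False
    then have "(q - a) * M \<le> - 1 * M" using M_pos by (intro mult_right_mono) auto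
    then show ?thesis by simp
  qed
  ultimately show "j \<noteq> pos1 \<omega>" "j \<noteq> pos1 \<omega> + 1"
    using b assms(2) M_eq unfolding odd_slot_def by (smt (verit))+
qed

definition slots :: "((int \<times> nat \<times> nat \<times> int) \<times> nat) set" where
  "slots = Tri \<times> {..<2 * h + 3}"

definition ty :: "(int \<times> nat \<times> nat \<times> int) \<times> nat \<Rightarrow> nat \<times> nat" where
  "ty s = (if snd s = 0 then (nat (int e + pos1 (fst s)), nat (int e - pos1 (fst s)))
     else (nat (int f + dpos s), nat (int f + 1 - dpos s)))"

text \<open>A position in use has positive capacity, and the layers are zero outside the admissible
  range. In this way the capacity bound also ensures that \<open>nat\<close> does not truncate the
  types.\<close>

lemma pos1_range: "\<omega> \<in> Tri \<Longrightarrow> \<bar>pos1 \<omega>\<bar> \<le> int e"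
proof -
  assume \<omega>: "\<omega> \<in> Tri"
  then have "{\<omega>'\<in>Tri. pos1 \<omega>' = pos1 \<omega>} \<noteq> {}" by blast
  then have "card {\<omega>'\<in>Tri. pos1 \<omega>' = pos1 \<omega>} > 0" using finite_Tri by (simp add: card_gt_0_iff)
  then show ?thesis using card_even_slots_le[OF \<omega>] by (auto simp: even_layer_def split: if_splits)
qed

lemma dpos_range:
  assumes "s \<in> slots" "snd s \<noteq> 0"
  shows "- int f \<le> dpos s" "dpos s \<le> int f + 1"
proof -
  have s: "s \<in> {s'\<in>Tri \<times> {1..<2 * h + 3}. dpos s' = dpos s}"
    using assms by (auto simp: slots_def)
  then have "{s'\<in>Tri \<times> {1..<2 * h + 3}. dpos s' = dpos s} \<noteq> {}" by blast
  then have "card {s'\<in>Tri \<times> {1..<2 * h + 3}. dpos s' = dpos s} > 0"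
    using finite_Tri by (simp add: card_gt_0_iff)
  moreover obtain q u where "odd_slot (dpos s) q u"
    using dpos_odd_slot[of "fst s" "snd s"] s by auto
  ultimately show "- int f \<le> dpos s" "dpos s \<le> int f + 1"
    using card_odd_slots_le[of "dpos s" q u] by (auto simp: odd_layer_def split: if_splits)
qed

lemma ty_even: "s \<in> slots \<Longrightarrow> snd s = 0 \<Longrightarrow>
    int (fst (ty s)) = int e + pos1 (fst s) \<and> int (snd (ty s)) = int e - pos1 (fst s)"
  using pos1_range[of "fst s"] by (auto simp: ty_def slots_def)

lemma ty_odd: "s \<in> slots \<Longrightarrow> snd s \<noteq> 0 \<Longrightarrow>
    int (fst (ty s)) = int f + dpos s \<and> int (snd (ty s)) = int f + 1 - dpos s"
  using dpos_range[of s] by (auto simp: ty_def)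

lemma ty_total: "s \<in> slots \<Longrightarrow> fst (ty s) + snd (ty s) = (if snd s = 0 then 2 * e else 2 * f + 1)"
  using ty_even[of s] ty_odd[of s] by auto

lemma sum_ty:
  assumes \<omega>: "\<omega> \<in> Tri"
  shows "(\<Sum>i<2 * h + 3. fst (ty (\<omega>, i))) = N" "(\<Sum>i<2 * h + 3. snd (ty (\<omega>, i))) = N"
proof -
  have slot: "(\<omega>, i) \<in> slots" if "i < 2 * h + 3" for i using that \<omega> by (simp add: slots_def)
  have odd: "int (fst (ty (\<omega>, i))) = int f + dpos (\<omega>, i)"
    "int (snd (ty (\<omega>, i))) = int f + 1 - dpos (\<omega>, i)" if "0 < i" "i < 2 * h + 3" for i
    using ty_odd[OF slot[OF that(2)]] that by simp_all
  have ev: "int (fst (ty (\<omega>, 0))) = int e + pos1 \<omega>" "int (snd (ty (\<omega>, 0))) = int e - pos1 \<omega>"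
    using ty_even[OF slot[of 0]] by simp_all
  have pair: "dpos (\<omega>, 2 * a + 3) + dpos (\<omega>, 2 * a + 4) = 1" for a
  proof -
    have "(2 * a + 4 - 3) div 2 = a" "(2 * a + 3 - 3) div 2 = a" by simp_all
    then show ?thesis by (simp add: dpos_def)
  qed
  have p1: "fst (ty (\<omega>, 2 * a + 3)) + fst (ty (\<omega>, 2 * a + 4)) = 2 * f + 1"
    and p2: "snd (ty (\<omega>, 2 * a + 3)) + snd (ty (\<omega>, 2 * a + 4)) = 2 * f + 1" if "a < h" for a
    using odd[of "2 * a + 3"] odd[of "2 * a + 4"] pair[of a] that by linarith+
  have t: "dpos (\<omega>, 1) = pos2 \<omega>" "dpos (\<omega>, 2) = pos3 \<omega>" by (simp_all add: dpos_def)
  have "fst (ty (\<omega>, 0)) + fst (ty (\<omega>, 1)) + fst (ty (\<omega>, 2)) = e + 2 * f + 1"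
    "snd (ty (\<omega>, 0)) + snd (ty (\<omega>, 1)) + snd (ty (\<omega>, 2)) = e + 2 * f + 1"
    using ev odd[of 1] odd[of 2] t pos_sum[of \<omega>] by simp_all
  then show "(\<Sum>i<2 * h + 3. fst (ty (\<omega>, i))) = N" "(\<Sum>i<2 * h + 3. snd (ty (\<omega>, i))) = N"
    unfolding sum_lessThan_pairs using p1 p2 by (simp_all add: N algebra_simps)
qed

lemma card_Tri_le_SP: "card Tri \<le> SP (2 * N) (2 * h + 3)"
proof -
  have fin: "finite slots" using finite_Tri by (simp add: slots_def)
  have fibre: "{s'\<in>slots. fst s' = fst s} = Pair (fst s) ` {..<2 * h + 3}" if "s \<in> slots" for s
    using that by (auto simp: slots_def)
  have inj: "inj_on (Pair \<omega>) A" for \<omega> :: "int \<times> nat \<times> nat \<times> int" and A :: "nat set"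
    by (auto intro: inj_onI)
  have "card (fst ` slots) \<le> SP (2 * N) (2 * h + 3)"
  proof (rule card_le_SP_of_types[where ty = ty])
    fix s assume s: "s \<in> slots"
    then have \<omega>: "fst s \<in> Tri" by (auto simp: slots_def)
    show "card {s'\<in>slots. fst s' = fst s} = 2 * h + 3"
      by (simp add: fibre[OF s] card_image[OF inj])
    show "(\<Sum>s'\<in>{s'\<in>slots. fst s' = fst s}. fst (ty s')) = N"
      "(\<Sum>s'\<in>{s'\<in>slots. fst s' = fst s}. snd (ty s')) = N"
      unfolding fibre[OF s] using sum_ty[OF \<omega>] by (simp_all add: sum.reindex[OF inj])
    show "ty s \<noteq> (0, 0)" using ty_total[OF s] ef(3) by (auto split: if_splits)
  next
    fix \<tau>
    show "card {s\<in>slots. ty s = \<tau>} \<le> (N choose fst \<tau>) * (N choose snd \<tau>)"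
    proof (cases "{s\<in>slots. ty s = \<tau>} = {}")
      case True
      then show ?thesis by (simp only: card.empty)
    next
      case False
      then obtain s0 where s0: "s0 \<in> slots" "ty s0 = \<tau>" by blast
      \<comment> \<open>The total sizes \<open>2 * e\<close> and \<open>2 * f + 1\<close> differ in
        parity, so a type is shared only by slots of one kind, and within one kind it determines the
        position.\<close>
      have par: "snd s = 0 \<longleftrightarrow> snd s0 = 0" if "s \<in> slots" "ty s = \<tau>" for s
      proof -
        have "(if snd s = 0 then 2 * e else 2 * f + 1) = (if snd s0 = 0 then 2 * e else 2 * f + 1)"
          using ty_total[OF that(1)] ty_total[OF s0(1)] that(2) s0(2) by simp
        then show ?thesis by (auto split: if_splits) presburger+
      qed
      show ?thesis
      proof (cases "snd s0 = 0")
        case True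
        have \<omega>0: "fst s0 \<in> Tri" using s0 by (auto simp: slots_def)
        have "{s\<in>slots. ty s = \<tau>} \<subseteq> (\<lambda>\<omega>. (\<omega>, 0)) ` {\<omega>\<in>Tri. pos1 \<omega> = pos1 (fst s0)}"
        proof
          fix s assume "s \<in> {s\<in>slots. ty s = \<tau>}"
          then have s: "s \<in> slots" "ty s = \<tau>" by auto
          then have "snd s = 0" using par[OF s] True by simp
          then have "pos1 (fst s) = pos1 (fst s0)"
            using ty_even[OF s(1)] ty_even[OF s0(1) True] s(2) s0(2) by simp
          then show "s \<in> (\<lambda>\<omega>. (\<omega>, 0)) ` {\<omega>\<in>Tri. pos1 \<omega> = pos1 (fst s0)}"
            using s \<open>snd s = 0\<close> by (cases s) (auto simp: slots_def)
        qed
        then have "card {s\<in>slots. ty s = \<tau>} \<le> card {\<omega>\<in>Tri. pos1 \<omega> = pos1 (fst s0)}"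
          by (rule surj_card_le[rotated]) (use finite_Tri in simp)
        also have "\<dots> \<le> even_layer N e (pos1 (fst s0))" by (rule card_even_slots_le[OF \<omega>0])
        also have "\<dots> = (N choose fst \<tau>) * (N choose snd \<tau>)"
          using pos1_range[OF \<omega>0] s0(2) True by (auto simp: even_layer_def ty_def)
        finally show ?thesis .
      next
        case False
        have "{s\<in>slots. ty s = \<tau>} \<subseteq> {s\<in>Tri \<times> {1..<2 * h + 3}. dpos s = dpos s0}"
        proof
          fix s assume "s \<in> {s\<in>slots. ty s = \<tau>}"
          then have s: "s \<in> slots" "ty s = \<tau>" by auto
          then have "snd s \<noteq> 0" using par[OF s] False by simp
          then have "dpos s = dpos s0"
            using ty_odd[OF s(1)] ty_odd[OF s0(1) False] s(2) s0(2) by simp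
          then show "s \<in> {s\<in>Tri \<times> {1..<2 * h + 3}. dpos s = dpos s0}"
            using s \<open>snd s \<noteq> 0\<close> by (cases s) (auto simp: slots_def)
        qed
        then have "card {s\<in>slots. ty s = \<tau>} \<le> card {s\<in>Tri \<times> {1..<2 * h + 3}. dpos s = dpos s0}"
          by (rule card_mono[rotated]) (use finite_Tri in auto)
        also have "\<dots> \<le> odd_layer N f (dpos s0)"
          using card_odd_slots_le dpos_odd_slot[of "fst s0" "snd s0"] s0 False
          by (auto simp: slots_def)
        also have "\<dots> = (N choose fst \<tau>) * (N choose snd \<tau>)"
          using dpos_range[OF s0(1) False] s0(2) False by (auto simp: odd_layer_def ty_def)
        finally show ?thesis .
      qed
    qed
  next
    fix s s' assume s: "s \<in> slots" "s' \<in> slots" "fst (ty s) \<le> fst (ty s')" "snd (ty s) \<le> snd (ty s')"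
    have sep: False if "r \<in> slots" "r' \<in> slots" "snd r = 0" "snd r' \<noteq> 0"
      "dpos r' = pos1 (fst r) \<or> dpos r' = pos1 (fst r) + 1" for r r'
      using even_odd_separate[of "fst r" "dpos r'"] dpos_odd_slot[of "fst r'" "snd r'"] that
      by (auto simp: slots_def)
    have "fst (ty s) + snd (ty s) = fst (ty s') + snd (ty s')"
    proof (rule ccontr)
      assume ne: "fst (ty s) + snd (ty s) \<noteq> fst (ty s') + snd (ty s')"
      then have ne': "(snd s = 0) \<noteq> (snd s' = 0)" using ty_total s by (metis (full_types))
      show False
      proof (cases "snd s = 0")
        case True
        \<comment> \<open>As \<open>f \<le> e \<le> f + 1\<close>, comparability of an even set at
          position \<open>p\<close> with an odd set at position \<open>j\<close> forces
          \<open>j\<close> to be \<open>p\<close> or \<open>p + 1\<close>.\<close>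
        then have "dpos s' = pos1 (fst s) \<or> dpos s' = pos1 (fst s) + 1"
          using ty_even[OF s(1)] ty_odd[OF s(2)] ne' s(3,4) ef by linarith
        then show False using sep[of s s'] s True ne' by simp
      next
        case False
        then have "dpos s = pos1 (fst s') \<or> dpos s = pos1 (fst s') + 1"
          using ty_even[OF s(2)] ty_odd[OF s(1)] ne' s(3,4) ef by linarith
        then show False using sep[of s' s] s False ne' by simp
      qed
    qed
    then show "ty s = ty s'" using s(3,4) by (simp add: prod_eq_iff)
  qed (use fin in auto)
  moreover have "0 \<in> {..<2 * h + 3}" by simp
  then have "fst ` slots = Tri" unfolding slots_def by (simp add: fst_image_times del: lessThan_iff) blast
  ultimately show ?thesis by simp
qed

end

section \<open>Layer sizes\<close>

lemma Suc_times_choose_Suc: "Suc a * (n choose Suc a) = (n - a) * (n choose a)"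
  by (simp only: binomial_absorption binomial_absorb_comp)

text \<open>Log-concavity of a row of Pascal's triangle. Multiplying by \<open>Suc a * Suc b\<close>
  reduces the claim to \<open>(n - a) * Suc b \<le> (n - b) * Suc a\<close>.\<close>

lemma choose_mult_choose_antimono:
  assumes "b \<le> a"
  shows "(n choose Suc a) * (n choose b) \<le> (n choose a) * (n choose Suc b)"
proof -
  have le: "(n - a) * Suc b \<le> (n - b) * Suc a"
    using assms by (intro mult_le_mono) auto
  have "(Suc a * Suc b) * ((n choose Suc a) * (n choose b))
      = (Suc a * (n choose Suc a)) * (Suc b * (n choose b))" by (simp only: mult_ac)
  also have "\<dots> = ((n - a) * Suc b) * ((n choose a) * (n choose b))"
    by (simp only: Suc_times_choose_Suc mult_ac)
  also have "\<dots> \<le> ((n - b) * Suc a) * ((n choose a) * (n choose b))"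
    using le by (rule mult_le_mono1)
  also have "\<dots> = (Suc a * (n choose a)) * (Suc b * (n choose Suc b))"
    by (simp only: Suc_times_choose_Suc mult_ac)
  also have "\<dots> = (Suc a * Suc b) * ((n choose a) * (n choose Suc b))" by (simp only: mult_ac)
  finally show ?thesis by (simp del: mult_Suc mult_Suc_right)
qed

lemma even_layer_nat: "s \<le> e \<Longrightarrow> even_layer N e (int s) = (N choose (e + s)) * (N choose (e - s))"
  by (simp add: even_layer_def nat_add_distrib nat_diff_distrib)

lemma odd_layer_nat: "j \<le> f + 1 \<Longrightarrow> odd_layer N f (int j) = (N choose (f + j)) * (N choose (f + 1 - j))"
proof -
  assume "j \<le> f + 1"
  then have "nat (int f + int j) = f + j" "nat (int f + 1 - int j) = f + 1 - j" by linarith+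
  then show ?thesis using \<open>j \<le> f + 1\<close> by (simp add: odd_layer_def)
qed

lemma odd_layer_0: "f + 1 < j \<Longrightarrow> odd_layer N f (int j) = 0"
  by (simp add: odd_layer_def)

lemma even_layer_Suc_le: "even_layer N e (int (Suc s)) \<le> even_layer N e (int s)"
proof (cases "Suc s \<le> e")
  case True
  then have "(N choose Suc (e + s)) * (N choose (e - Suc s)) \<le> (N choose (e + s)) * (N choose Suc (e - Suc s))"
    by (intro choose_mult_choose_antimono) simp
  moreover have "Suc (e - Suc s) = e - s" using True by simp
  ultimately show ?thesis using even_layer_nat[OF True, of N] even_layer_nat[of s e N] True
    by (simp del: of_nat_Suc)
qed (simp add: even_layer_def)

lemma odd_layer_Suc_le:
  assumes "1 \<le> j" shows "odd_layer N f (int (Suc j)) \<le> odd_layer N f (int j)"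
proof (cases "Suc j \<le> f + 1")
  case True
  then have "(N choose Suc (f + j)) * (N choose (f + 1 - Suc j)) \<le> (N choose (f + j)) * (N choose Suc (f + 1 - Suc j))"
    using assms by (intro choose_mult_choose_antimono) simp
  moreover have "Suc (f + 1 - Suc j) = f + 1 - j" using True by simp
  ultimately show ?thesis using odd_layer_nat[OF True, of N] odd_layer_nat[of j f N] True
    by (simp del: of_nat_Suc)
qed (simp add: odd_layer_def)

lemma even_layer_antimono:
  assumes "0 \<le> s" "s \<le> s'" shows "even_layer N e s' \<le> even_layer N e s"
proof -
  have "even_layer N e (int (nat s')) \<le> even_layer N e (int (nat s))"
    by (rule lift_Suc_antimono_le[where f = "\<lambda>i. even_layer N e (int i)"])
      (use even_layer_Suc_le assms in auto)
  then show ?thesis using assms by simp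
qed

lemma odd_layer_antimono:
  assumes "1 \<le> j" "j \<le> j'" shows "odd_layer N f j' \<le> odd_layer N f j"
proof -
  have "odd_layer N f (int (Suc (nat (j' - 1)))) \<le> odd_layer N f (int (Suc (nat (j - 1))))"
  proof (rule lift_Suc_antimono_le[where f = "\<lambda>i. odd_layer N f (int (Suc i))"])
    show "odd_layer N f (int (Suc (Suc n))) \<le> odd_layer N f (int (Suc n))" for n
      by (rule odd_layer_Suc_le) simp
  qed (use assms in auto)
  moreover have "int (Suc (nat (j' - 1))) = j'" "int (Suc (nat (j - 1))) = j" using assms by auto
  ultimately show ?thesis by (simp del: of_nat_Suc)
qed

section \<open>Sums over the odd layers\<close>

locale odd_layers =
  fixes N f :: nat
  assumes Nf: "2 * f + 1 \<le> N"
begin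

definition d :: "nat \<Rightarrow> real" where "d j = real (odd_layer N f (int j))"

abbreviation T :: real where "T \<equiv> real (2 * N choose (2 * f + 1))"

lemma d_nonneg: "d j \<ge> 0" by (simp add: d_def)

lemma d_antimono: "1 \<le> j \<Longrightarrow> j \<le> j' \<Longrightarrow> d j' \<le> d j"
  unfolding d_def using odd_layer_antimono[of "int j" "int j'" N f] by simp

lemma d_0: "f + 1 < j \<Longrightarrow> d j = 0"
  by (simp add: d_def odd_layer_0)

text \<open>The ratio of neighbouring layers in cross-multiplied form; at \<open>j = f + 1\<close>
  both sides vanish, so the recursion extends beyond the support.\<close>

lemma d_step: "(real f + 1 + real j) * (real N - real f + real j) * d (j + 1)
    = (real f + 1 - real j) * (real N - real f - real j) * d j"
proof -
  consider "j \<le> f" | "j = f + 1" | "j > f + 1" by linarith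
  then show ?thesis
  proof cases
    case 1
    define a where "a = f + j"
    define b where "b = f - j"
    have "real (Suc a) * real (N choose Suc a) = real (N - a) * real (N choose a)"
      by (metis Suc_times_choose_Suc of_nat_mult)
    moreover have "real (N - a) = real N - real a" using 1 Nf by (simp add: a_def of_nat_diff)
    ultimately have A: "(real f + 1 + real j) * real (N choose Suc a) = (real N - real f - real j) * real (N choose a)"
      by (simp add: a_def algebra_simps)
    have "real (Suc b) * real (N choose Suc b) = real (N - b) * real (N choose b)"
      by (metis Suc_times_choose_Suc of_nat_mult)
    moreover have "real (N - b) = real N - real f + real j" "real (Suc b) = real f + 1 - real j"
      using 1 Nf by (auto simp: b_def of_nat_diff)
    ultimately have B: "(real f + 1 - real j) * real (N choose Suc b) = (real N - real f + real j) * real (N choose b)"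
      by (simp only:)
    have "d j = real (N choose a) * real (N choose Suc b)"
      unfolding d_def using 1 by (subst odd_layer_nat) (auto simp: a_def b_def Suc_diff_le)
    moreover have "d (j + 1) = real (N choose Suc a) * real (N choose b)"
      unfolding d_def using 1 by (subst odd_layer_nat) (auto simp: a_def b_def)
    ultimately show ?thesis using A B by algebra
  qed (auto simp: d_0)
qed

lemma sum_choose_mult_choose_upper:
  "2 * (\<Sum>i<f + 1. (N choose (f + 1 + i)) * (N choose (f - i))) = 2 * N choose (2 * f + 1)"
proof -
  let ?P = "\<lambda>i. (N choose i) * (N choose (2 * f + 1 - i))"
  have "(\<Sum>i\<le>2 * f + 1. ?P i) = (\<Sum>i<f + 1. ?P i) + (\<Sum>i=f + 1..<2 * f + 2. ?P i)"
  proof -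
    have "{..2 * f + 1} = {0..<2 * f + 2}" by auto
    then show ?thesis
      using sum.atLeastLessThan_concat[of 0 "f + 1" "2 * f + 2" ?P] by (simp add: lessThan_atLeast0)
  qed
  moreover have "(\<Sum>i=f + 1..<2 * f + 2. ?P i) = (\<Sum>i<f + 1. ?P (f + 1 + i))"
    using sum.shift_bounds_nat_ivl[of ?P 0 "f + 1" "f + 1"]
    by (simp add: lessThan_atLeast0 add_ac mult_2)
  moreover have "(\<Sum>i<f + 1. ?P i) = (\<Sum>i<f + 1. ?P (f - i))"
    using sum.nat_diff_reindex[of ?P "f + 1"] by simp
  moreover have "(\<Sum>i<f + 1. ?P (f - i)) = (\<Sum>i<f + 1. (N choose (f + 1 + i)) * (N choose (f - i)))"
  proof (rule sum.cong[OF refl])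
    fix i assume "i \<in> {..<f + 1}"
    then have "2 * f + 1 - (f - i) = f + 1 + i" by auto
    then show "?P (f - i) = (N choose (f + 1 + i)) * (N choose (f - i))" by simp
  qed
  moreover have "(\<Sum>i<f + 1. ?P (f + 1 + i)) = (\<Sum>i<f + 1. (N choose (f + 1 + i)) * (N choose (f - i)))"
    by (rule sum.cong[OF refl]) (simp add: algebra_simps)
  moreover have "(\<Sum>i\<le>2 * f + 1. ?P i) = 2 * N choose (2 * f + 1)"
    using vandermonde[of N N "2 * f + 1"] by (simp add: mult_2)
  ultimately show ?thesis by simp
qed

lemma sum_d: "(\<Sum>i<f + 1. d (i + 1)) = T / 2"
proof -
  have "(\<Sum>i<f + 1. d (i + 1)) = (\<Sum>i<f + 1. real ((N choose (f + 1 + i)) * (N choose (f - i))))"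
    unfolding d_def by (intro sum.cong refl arg_cong[of _ _ real], subst odd_layer_nat) (auto simp: add_ac)
  also have "\<dots> = real (\<Sum>i<f + 1. (N choose (f + 1 + i)) * (N choose (f - i)))" by simp
  also have "\<dots> = T / 2" using sum_choose_mult_choose_upper
    by (metis (no_types, lifting) nonzero_mult_div_cancel_left of_nat_mult of_nat_numeral zero_neq_numeral)
  finally show ?thesis .
qed

lemma sum_d_ext: "f + 1 \<le> J \<Longrightarrow> (\<Sum>i<J. d (i + 1)) = T / 2"
  unfolding sum_d[symmetric] by (rule sum.mono_neutral_right) (auto simp: d_0)

lemma sum_d_le: "(\<Sum>i<J. d (i + 1)) \<le> T / 2"
proof -
  have "(\<Sum>i<J. d (i + 1)) \<le> (\<Sum>i<max J (f + 1). d (i + 1))"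
    by (rule sum_mono2) (auto simp: d_nonneg)
  then show ?thesis using sum_d_ext[of "max J (f + 1)"] by simp
qed

text \<open>The first moment telescopes, so no concentration estimate for the layers is needed.\<close>

lemma sum_moment_le: "(\<Sum>i<J. real (i + 1) * d (i + 1)) \<le> real (f + 1) * d 1"
proof -
  \<comment> \<open>By \<open>d_step\<close>, \<open>\<tau> (j + 1)\<close> equals
    \<open>(f + 1 - j) * (N - f - j) * d j\<close>, and \<open>(f + j) * (N - f - 1 + j)\<close>
    exceeds \<open>(f + 1 - j) * (N - f - j)\<close> by \<open>N * (2 * j - 1)\<close>.\<close>
  define \<tau> where "\<tau> j = d j * (real f + real j) * (real N - real f - 1 + real j)" for j
  have N0: "real N > 0" using Nf by simp
  have tel: "real N * ((2 * real (i + 1) - 1) * d (i + 1)) = \<tau> (i + 1) - \<tau> (i + 2)" for i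
  proof -
    have "\<tau> (i + 2) = (real f + 1 - real (i + 1)) * (real N - real f - real (i + 1)) * d (i + 1)"
      using d_step[of "i + 1"] by (simp add: \<tau>_def algebra_simps)
    then show ?thesis by (simp add: \<tau>_def algebra_simps)
  qed
  have \<tau>0: "\<tau> j \<ge> 0" for j using Nf by (simp add: \<tau>_def d_nonneg)
  have "real N * (\<Sum>i<J. (2 * real (i + 1) - 1) * d (i + 1)) = (\<Sum>i<J. \<tau> (Suc i) - \<tau> (Suc (Suc i)))"
    unfolding sum_distrib_left by (rule sum.cong[OF refl]) (use tel in simp)
  also have "\<dots> = \<tau> 1 - \<tau> (J + 1)"
    using sum_lessThan_telescope'[of "\<lambda>i. \<tau> (Suc i)" J] by simp
  also have "\<dots> \<le> \<tau> 1" using \<tau>0[of "J + 1"] by simp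
  also have "\<dots> = d 1 * real (f + 1) * (real N - real f)" by (simp add: \<tau>_def algebra_simps)
  also have "\<dots> \<le> d 1 * real (f + 1) * real N" by (intro mult_left_mono) (auto simp: d_nonneg)
  finally have "(\<Sum>i<J. (2 * real (i + 1) - 1) * d (i + 1)) \<le> real (f + 1) * d 1"
    using N0 by (simp add: mult.commute)
  moreover have "(\<Sum>i<J. real (i + 1) * d (i + 1)) \<le> (\<Sum>i<J. (2 * real (i + 1) - 1) * d (i + 1))"
    by (intro sum_mono mult_right_mono) (auto simp: d_nonneg)
  ultimately show ?thesis by linarith
qed

text \<open>The step from \<open>j\<close> to \<open>j + 1\<close> costs at most the fraction
  \<open>4 * j / (f + 1)\<close> of \<open>d 1\<close>, and these costs add up to
  \<open>2 * i * (i + 1) / (f + 1)\<close>. So about \<open>sqrt f\<close> layers are comparable to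
  the largest one.\<close>

lemma d_ge: "d 1 * (1 - 2 * real i * real (i + 1) / real (f + 1)) \<le> d (i + 1)"
proof (induction i)
  case (Suc i)
  define A where "A = real (f + 1)"
  define B where "B = real N - real f"
  define j where "j = real (i + 1)"
  have AB: "A > 0" "A \<le> B" "j \<ge> 1" using Nf by (auto simp: A_def B_def j_def)
  have step: "(A + j) * (B + j) * d (i + 2) = (A - j) * (B - j) * d (i + 1)"
    using d_step[of "i + 1"] by (simp add: A_def B_def j_def algebra_simps)
  \<comment> \<open>The step ratio \<open>(A - j) * (B - j) / ((A + j) * (B + j))\<close> is at
    least \<open>1 - 4 * j / A\<close> when \<open>A \<le> B\<close>.\<close>
  have "A * ((A - j) * (B - j)) - (A - 4 * j) * ((A + j) * (B + j))
      = 2 * j * (A * (B - A) + 2 * j * (A + B) + 2 * j * j)"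
    by (simp add: algebra_simps)
  moreover have "\<dots> \<ge> 0" using AB by (intro mult_nonneg_nonneg add_nonneg_nonneg) auto
  ultimately have "(A - 4 * j) * ((A + j) * (B + j)) * d (i + 1) \<le> A * ((A - j) * (B - j)) * d (i + 1)"
    using d_nonneg[of "i + 1"] by (intro mult_right_mono) auto
  also have "\<dots> = A * ((A + j) * (B + j)) * d (i + 2)" using step by simp
  finally have "((A + j) * (B + j)) * ((A - 4 * j) * d (i + 1)) \<le> ((A + j) * (B + j)) * (A * d (i + 2))"
    by (simp add: mult_ac)
  moreover have "(A + j) * (B + j) > 0" using AB by (intro mult_pos_pos) auto
  ultimately have "(A - 4 * j) * d (i + 1) \<le> A * d (i + 2)" by (simp add: mult_le_cancel_left_pos)
  then have "d (i + 1) - 4 * j / A * d (i + 1) \<le> d (i + 2)" using AB by (simp add: field_simps)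
  moreover have "4 * j / A * d (i + 1) \<le> 4 * j / A * d 1"
    using AB d_antimono[of 1 "i + 1"] by (intro mult_left_mono) auto
  ultimately have "d (i + 1) - 4 * j / A * d 1 \<le> d (i + 2)" by linarith
  moreover have "d 1 * (1 - 2 * real i * real (i + 1) / A) \<le> d (i + 1)" using Suc by (simp add: A_def)
  moreover have "d 1 * (1 - 2 * real (Suc i) * real (Suc i + 1) / A)
      = d 1 * (1 - 2 * real i * real (i + 1) / A) - 4 * j / A * d 1"
    using AB by (simp add: field_simps j_def)
  ultimately show ?case by (simp add: A_def)
qed simp

text \<open>By \<open>d_ge\<close> the first \<open>K\<close> layers all have at least half the size
  of the largest one, and together they are at most \<open>T / 2\<close>.\<close>

lemma d_1_le:
  assumes "4 * K ^ 2 \<le> f + 1" shows "real K * d 1 \<le> T"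
proof -
  have "d 1 / 2 \<le> d (i + 1)" if "i < K" for i
  proof -
    have "i * (i + 1) \<le> K * K" using that by (intro mult_le_mono) auto
    then have "4 * (i * (i + 1)) \<le> f + 1" using assms by (simp add: power2_eq_square)
    then have "real (4 * (i * (i + 1))) \<le> real (f + 1)" by (simp only: of_nat_le_iff)
    then have "4 * (real i * real (i + 1)) \<le> real (f + 1)" by (simp add: algebra_simps)
    then have "2 * real i * real (i + 1) / real (f + 1) \<le> 1 / 2" by (simp add: divide_le_eq)
    then have "d 1 * (1 / 2) \<le> d 1 * (1 - 2 * real i * real (i + 1) / real (f + 1))"
      by (intro mult_left_mono) (auto simp: d_nonneg)
    then show ?thesis using d_ge[of i] by linarith
  qed
  then have "(\<Sum>i<K. d 1 / 2) \<le> (\<Sum>i<K. d (i + 1))" by (intro sum_mono) auto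
  also have "\<dots> \<le> T / 2" by (rule sum_d_le)
  finally show ?thesis by simp
qed

text \<open>The sample at a multiple of \<open>M\<close> dominates the \<open>M\<close> layers that
  follow it, so only the first block, of size at most \<open>M * d 1\<close>, is lost.\<close>

lemma sum_blocks_ge:
  assumes "f + 1 \<le> Q" "M > 0"
  shows "T / 2 - real M * d 1 \<le> real M * (\<Sum>q<Q. d ((q + 1) * M))"
proof -
  have QM: "f + 1 \<le> Suc Q * M" using assms by (cases M) auto
  have "T / 2 = (\<Sum>i<Suc Q * M. d (i + 1))" using sum_d_ext[OF QM] by simp
  also have "\<dots> = (\<Sum>q<Suc Q. \<Sum>i\<in>{q * M..<q * M + M}. d (i + 1))"
    by (rule sum.nat_group[symmetric])
  also have "\<dots> = (\<Sum>i\<in>{0..<M}. d (i + 1)) + (\<Sum>q<Q. \<Sum>i\<in>{Suc q * M..<Suc q * M + M}. d (i + 1))"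
    by (subst sum.lessThan_Suc_shift) simp
  also have "(\<Sum>i\<in>{0..<M}. d (i + 1)) \<le> real (card {0..<M}) * d 1"
    by (rule sum_bounded_above) (auto intro: d_antimono)
  also have "(\<Sum>q<Q. \<Sum>i\<in>{Suc q * M..<Suc q * M + M}. d (i + 1)) \<le> (\<Sum>q<Q. real M * d ((q + 1) * M))"
  proof (rule sum_mono)
    fix q
    have "(\<Sum>i\<in>{Suc q * M..<Suc q * M + M}. d (i + 1))
        \<le> real (card {Suc q * M..<Suc q * M + M}) * d ((q + 1) * M)"
      by (rule sum_bounded_above) (use assms in \<open>auto intro!: d_antimono\<close>)
    then show "(\<Sum>i\<in>{Suc q * M..<Suc q * M + M}. d (i + 1)) \<le> real M * d ((q + 1) * M)" by simp
  qed
  finally show ?thesis by (simp add: sum_distrib_left)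
qed

text \<open>The comparison in the other direction: a sample is at most every layer of the block that
  it closes, and positions in that block are smaller by less than \<open>M\<close>.\<close>

lemma sum_blocks_moment_le:
  assumes "M > 0"
  shows "real M * (\<Sum>q<Q. real ((q + 1) * M) * d ((q + 1) * M)) \<le> real (f + 1) * d 1 + real M * (T / 2)"
proof -
  have "real M * (\<Sum>q<Q. real ((q + 1) * M) * d ((q + 1) * M))
      = (\<Sum>q<Q. \<Sum>i\<in>{q * M..<q * M + M}. real ((q + 1) * M) * d ((q + 1) * M))"
    by (simp add: sum_distrib_left)
  also have "\<dots> \<le> (\<Sum>q<Q. \<Sum>i\<in>{q * M..<q * M + M}. (real (i + 1) + real M) * d (i + 1))"
  proof (intro sum_mono mult_mono)
    fix q i assume i: "i \<in> {q * M..<q * M + M}"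
    then have "(q + 1) * M \<le> i + 1 + M" by auto
    then have "real ((q + 1) * M) \<le> real (i + 1 + M)" by (simp only: of_nat_le_iff)
    then show "real ((q + 1) * M) \<le> real (i + 1) + real M" by simp
    show "d ((q + 1) * M) \<le> d (i + 1)" using i by (intro d_antimono) auto
  qed (auto simp: d_nonneg)
  also have "\<dots> = (\<Sum>i<Q * M. (real (i + 1) + real M) * d (i + 1))"
    by (rule sum.nat_group)
  also have "\<dots> = (\<Sum>i<Q * M. real (i + 1) * d (i + 1)) + real M * (\<Sum>i<Q * M. d (i + 1))"
    by (simp add: distrib_right sum.distrib sum_distrib_left)
  also have "\<dots> \<le> real (f + 1) * d 1 + real M * (T / 2)"
    by (intro add_mono sum_moment_le mult_left_mono sum_d_le) auto
  finally show ?thesis .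
qed

end

section \<open>Lower bounds for the number of partitions\<close>

text \<open>Makes the loss from rounding \<open>F\<close> to integers, at most one unit in each of
  \<open>f + 1\<close> periods, negligible. It follows from the lower bound
  \<open>(n / (2 * f + 1)) ^ (2 * f + 1)\<close> for the binomial coefficient and from
  \<open>f + 1 \<le> 2 ^ f\<close>.\<close>

lemma choose_ge_square:
  assumes "n \<ge> c * (2 * f + 1)" "c \<ge> 2"
  shows "real c * (real (f + 1))\<^sup>2 \<le> real (n choose (2 * f + 1))"
proof -
  have nc: "2 * f + 1 \<le> n" using assms mult_le_mono1[of 1 c "2 * f + 1"] by simp
  have "real (c * (2 * f + 1)) \<le> real n" using assms(1) by (simp only: of_nat_le_iff)
  then have cn: "real c \<le> real n / real (2 * f + 1)"
    by (subst pos_le_divide_eq) (simp_all add: algebra_simps)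
  have "f + 1 \<le> 2 ^ f" using less_exp[of f] by (simp add: Suc_le_eq)
  then have "(f + 1) ^ 2 \<le> (2 ^ f) ^ 2" by (rule power_mono) simp
  also have "\<dots> \<le> (c ^ f) ^ 2" using assms(2) by (intro power_mono) auto
  finally have "c * (f + 1) ^ 2 \<le> c ^ (2 * f + 1)"
    by (simp add: power_mult[symmetric] mult.commute)
  then have "real (c * (f + 1) ^ 2) \<le> real (c ^ (2 * f + 1))" by (simp only: of_nat_le_iff)
  then have "real c * (real (f + 1))\<^sup>2 \<le> real c ^ (2 * f + 1)" by simp
  also have "\<dots> \<le> (real n / real (2 * f + 1)) ^ (2 * f + 1)" using cn by (intro power_mono) auto
  also have "\<dots> \<le> real (n choose (2 * f + 1))"
    by (rule binomial_ge_n_over_k_pow_k) (use nc in simp)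
  finally show ?thesis .
qed

text \<open>An odd position carries \<open>2 * h + 2\<close> times and an even one \<open>g\<close>
  times the profile \<open>F\<close>. So \<open>F\<close> is a damped odd layer divided by
  \<open>2 * h + 2\<close>, and \<open>ratio\<close> says that the even layers can carry it.
  Counting triples then compares samples of the odd layers with their full sum.\<close>

lemma SP_ge_of_ratio:
  fixes N e f h g l K :: nat
  defines "M \<equiv> (g + 1) * (2 * l + 1) + 1"
  assumes N: "N = e + (h + 1) * (2 * f + 1)" and ef: "f \<le> e" "e \<le> f + 1" "e > 0"
    and K: "K > 0" "4 * K ^ 2 \<le> f + 1"
    and ratio: "\<And>m. 1 \<le> m \<Longrightarrow> m \<le> e \<Longrightarrow>
      real g * (real (odd_layer N f (int m)) * (1 - 2 * real m / real e)) / real (2 * h + 2)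
        \<le> real (even_layer N e (int m))"
  shows "real (g * (2 * l + 1)) / (real (2 * h + 2) * real M) * real (2 * N choose (2 * f + 1))
      * (1 - 17 * real M / real K) \<le> real (SP (2 * N) (2 * h + 3))"
proof -
  define \<kappa> where "\<kappa> = real (2 * h + 2)"
  have \<kappa>: "\<kappa> \<ge> 2" by (simp add: \<kappa>_def)
  have Mpos: "M > 0" by (simp add: M_def)
  interpret odd_layers N f by unfold_locales (simp add: N)
  define w where "w m = d m * max 0 (1 - 2 * real m / real e)" for m
  have w_nonneg: "w m \<ge> 0" for m by (simp add: w_def d_nonneg)
  have w_antimono: "w m' \<le> w m" if "1 \<le> m" "m \<le> m'" for m m'
  proof -
    have "2 * real m / real e \<le> 2 * real m' / real e"
      using that by (intro divide_right_mono) auto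
    then show ?thesis
      unfolding w_def using that by (intro mult_mono d_antimono max.mono) (auto simp: d_nonneg)
  qed
  have w_le: "w m \<le> d m" for m
    unfolding w_def using d_nonneg[of m] by (intro mult_left_le) auto
  \<comment> \<open>The factor \<open>1 - 2m/e\<close> pays for the drift of the ratio between even and odd layers away from the
    middle.\<close>
  define F where "F q = nat \<lfloor>w ((q + 1) * M) / \<kappa>\<rfloor>" for q
  have F_le: "real (F q) \<le> w ((q + 1) * M) / \<kappa>" for q
    using w_nonneg[of "(q + 1) * M"] \<kappa> by (simp add: F_def)
  have F_ge: "w ((q + 1) * M) / \<kappa> - 1 \<le> real (F q)" for q
    using w_nonneg[of "(q + 1) * M"] \<kappa> unfolding F_def by linarith
  interpret layered_triples N e f h g l "f + 1" F "int M"
  proof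
    show "N = e + (h + 1) * (2 * f + 1)" "f \<le> e" "e \<le> f + 1" "e > 0" by fact+
    show "int M = int ((g + 1) * (2 * l + 1) + 1)" by (simp add: M_def)
    show "F q \<le> F p" if "p \<le> q" for p q
      unfolding F_def using that \<kappa> Mpos
      by (intro nat_mono floor_mono divide_right_mono w_antimono) auto
    have "f + 1 < (f + 1 + 1) * M" using Mpos by (cases M) auto
    then show "F (f + 1) = 0" by (simp add: F_def w_def d_0)
    show "even_layer N e s' \<le> even_layer N e s" if "0 \<le> s" "s \<le> s'" for s s'
      by (rule even_layer_antimono[OF that])
    show "odd_layer N f j' \<le> odd_layer N f j" if "1 \<le> j" "j \<le> j'" for j j'
      by (rule odd_layer_antimono[OF that])
    fix q
    define m where "m = (q + 1) * M"
    have m1: "1 \<le> m" using Mpos by (simp add: m_def)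
    have im: "(int q + 1) * int M = int m" by (simp add: m_def algebra_simps)
    have "\<kappa> * real (F q) \<le> d m" using F_le[of q] w_le[of m] \<kappa> by (simp add: m_def field_simps)
    then have "real ((2 * h + 2) * F q) \<le> real (odd_layer N f (int m))"
      by (simp add: \<kappa>_def d_def algebra_simps)
    then show "(2 * h + 2) * F q \<le> odd_layer N f ((int q + 1) * int M)"
      unfolding im by (simp only: of_nat_le_iff)
    show "g * F q \<le> even_layer N e ((int q + 1) * int M)"
    proof (cases "F q = 0")
      case False
      then have "w m > 0" using F_le[of q] \<kappa> w_nonneg[of m] by (cases "w m = 0") (auto simp: m_def)
      then have pos: "1 - 2 * real m / real e > 0" unfolding w_def by (metis max.absorb1 mult_zero_right not_less order_less_irrefl linorder_le_less_linear)
      then have "2 * real m < real e" using ef by (simp add: field_simps)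
      then have me: "m \<le> e" by simp
      have "real (g * F q) \<le> real g * (w m / \<kappa>)" 
        unfolding of_nat_mult m_def by (intro mult_left_mono F_le) simp
      also have "w m = d m * (1 - 2 * real m / real e)" using pos by (simp add: w_def)
      also have "real g * (\<dots> / \<kappa>) \<le> real (even_layer N e (int m))"
        using ratio[OF m1 me] by (simp add: d_def \<kappa>_def)
      finally show ?thesis unfolding im by (simp only: of_nat_le_iff)
    qed simp
  qed
  define S where "S = (\<Sum>q<f + 1. real (F q))"
  define D where "D = (\<Sum>q<f + 1. d ((q + 1) * M))"
  define E where "E = (\<Sum>q<f + 1. real ((q + 1) * M) * d ((q + 1) * M))"
  have "\<kappa> * real (F q) \<ge> d ((q + 1) * M) - (2 / real e) * (real ((q + 1) * M) * d ((q + 1) * M)) - \<kappa>" for q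
  proof -
    have "d m - (2 / real e) * (real m * d m) \<le> w m" for m
    proof -
      have "d m * (1 - 2 * real m / real e) \<le> w m"
        unfolding w_def by (intro mult_left_mono) (auto simp: d_nonneg)
      then show ?thesis by (simp add: algebra_simps)
    qed
    moreover have "w ((q + 1) * M) - \<kappa> \<le> \<kappa> * real (F q)" using F_ge[of q] \<kappa> by (simp add: field_simps)
    ultimately show ?thesis by (meson diff_right_mono order_trans)
  qed
  then have "(\<Sum>q<f + 1. d ((q + 1) * M) - (2 / real e) * (real ((q + 1) * M) * d ((q + 1) * M)) - \<kappa>)
      \<le> (\<Sum>q<f + 1. \<kappa> * real (F q))"
    by (intro sum_mono) auto
  then have S1: "D - (2 / real e) * E - real (f + 1) * \<kappa> \<le> \<kappa> * S"
    unfolding S_def D_def E_def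
    by (simp only: sum_subtractf sum_constant card_lessThan flip: sum_distrib_left)
  have D1: "T / 2 - real M * d 1 \<le> real M * D" unfolding D_def by (rule sum_blocks_ge) (use Mpos in auto)
  have E1: "real M * E \<le> real (f + 1) * d 1 + real M * (T / 2)"
    unfolding E_def by (rule sum_blocks_moment_le[OF Mpos])
  have F0: "\<kappa> * real (F 0) \<le> d 1"
  proof -
    have "\<kappa> * real (F 0) \<le> w M" using F_le[of 0] \<kappa> by (simp add: field_simps)
    also have "\<dots> \<le> d 1" using w_le[of M] d_antimono[of 1 M] Mpos by simp
    finally show ?thesis .
  qed
  have e0: "real e > 0" using ef by simp
  have dK: "real K * d 1 \<le> T" using K(2) by (rule d_1_le)
  have d1: "d 1 \<le> T / real K" using dK K by (simp add: field_simps)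
  have T0: "T \<ge> 0" by simp
  have Mr: "real M \<ge> 1" using Mpos by simp
  have Kr: "real K \<ge> 1" using K by simp
  have fK: "real K \<le> real (f + 1)"
  proof -
    have "K \<le> 4 * K ^ 2" by (cases K) (auto simp: power2_eq_square)
    then have "K \<le> f + 1" using K(2) by linarith
    then show ?thesis by (simp only: of_nat_le_iff)
  qed
  have fe: "real (f + 1) / real e \<le> 2" using ef e0 by (simp add: divide_le_eq)
  have t1: "real M * d 1 \<le> real M * T / real K"
    using mult_left_mono[OF d1, of "real M"] by simp
  have t2: "(4 / real e) * (real (f + 1) * d 1) \<le> 8 * (real M * T / real K)"
  proof -
    have "(4 / real e) * (real (f + 1) * d 1) = 4 * ((real (f + 1) / real e) * d 1)" by simp
    also have "\<dots> \<le> 4 * (2 * d 1)" using fe d_nonneg[of 1] by (intro mult_left_mono mult_right_mono) auto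
    also have "\<dots> \<le> 8 * (real M * d 1)" using Mr d_nonneg[of 1] by (simp add: mult_le_cancel_right1)
    finally show ?thesis using t1 by linarith
  qed
  have inv: "T / real (f + 1) \<le> T / real K" using fK Kr T0 by (intro divide_left_mono) auto
  have t3: "2 * real M * T / real e \<le> 4 * (real M * T / real K)"
  proof -
    have "1 / real e \<le> 2 / real (f + 1)" using ef e0 by (simp add: field_simps)
    from mult_left_mono[OF this T0] have "T / real e \<le> 2 * (T / real (f + 1))" by (simp add: mult.commute)
    then have "T / real e \<le> 2 * (T / real K)" using inv by linarith
    from mult_left_mono[OF this, of "2 * real M"] show ?thesis by simp
  qed
  have t4: "2 * \<kappa> * real M * real (f + 1) \<le> 2 * (real M * T / real K)"
  proof -
    have "(2 * h + 2) * (2 * f + 1) \<le> 2 * N" by (simp add: N)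
    then have "\<kappa> * (real (f + 1))\<^sup>2 \<le> T" unfolding \<kappa>_def by (rule choose_ge_square) simp
    then have "\<kappa> * real (f + 1) \<le> T / real (f + 1)"
      by (simp add: pos_le_divide_eq power2_eq_square mult.assoc)
    then have "\<kappa> * real (f + 1) \<le> T / real K" using inv by linarith
    from mult_left_mono[OF this, of "2 * real M"] show ?thesis by (simp add: mult_ac)
  qed
  \<comment> \<open>The 17 is 3 + 8 + 4 + 2 from \<open>t1\<close> to \<open>t4\<close>. The term
    \<open>3 * (M * d 1)\<close> accounts for the first block on both sides of the middle and for
    the doubly counted period 0, the next two come from the first moment, the last one from
    rounding.\<close>
  have "T * (1 - 17 * real M / real K) = T - 17 * (real M * T / real K)"
    by (simp add: algebra_simps)
  also have "\<dots> \<le> T - 3 * (real M * d 1) - (4 / real e) * (real (f + 1) * d 1) - 2 * real M * T / real e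
      - 2 * \<kappa> * real M * real (f + 1)"
    using t1 t2 t3 t4 by linarith
  also have "\<dots> = 2 * (T / 2 - real M * d 1) - (4 / real e) * (real (f + 1) * d 1 + real M * (T / 2))
      - 2 * \<kappa> * real M * real (f + 1) - real M * d 1"
    by (simp add: algebra_simps)
  also have "\<dots> \<le> 2 * (real M * D) - (4 / real e) * (real M * E) - 2 * \<kappa> * real M * real (f + 1) - real M * (\<kappa> * real (F 0))"
    using D1 E1 F0 e0 Mr \<kappa> by (intro diff_mono mult_left_mono) auto
  also have "\<dots> = real M * (2 * (D - (2 / real e) * E - real (f + 1) * \<kappa>) - \<kappa> * real (F 0))"
    by (simp add: algebra_simps)
  also have "\<dots> \<le> real M * (2 * (\<kappa> * S) - \<kappa> * real (F 0))"
    using S1 Mr by (intro mult_left_mono) auto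
  also have "\<dots> = \<kappa> * real M * (2 * S - real (F 0))" by (simp add: algebra_simps)
  finally have main: "T * (1 - 17 * real M / real K) / (\<kappa> * real M) \<le> 2 * S - real (F 0)"
    using \<kappa> Mr by (subst pos_divide_le_eq) (auto simp: mult_ac)
  have "(\<Sum>a\<in>{- int (f + 1)..int (f + 1)}. F (nat \<bar>a\<bar>)) + F 0 = 2 * (\<Sum>q\<le>f + 1. F q)"
    by (rule sum_abs_int)
  also have "(\<Sum>q\<le>f + 1. F q) = (\<Sum>q<f + 1. F q)"
    using F_zero by (simp add: lessThan_Suc_atMost[symmetric])
  finally have "real ((\<Sum>a\<in>{- int (f + 1)..int (f + 1)}. F (nat \<bar>a\<bar>)) + F 0) = real (2 * (\<Sum>q<f + 1. F q))"
    by (simp only:)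
  then have cnt: "real (\<Sum>a\<in>{- int (f + 1)..int (f + 1)}. F (nat \<bar>a\<bar>)) = 2 * S - real (F 0)"
    unfolding S_def by (simp only: of_nat_add of_nat_mult of_nat_sum of_nat_numeral)
  have "real (g * (2 * l + 1)) / (\<kappa> * real M) * T * (1 - 17 * real M / real K)
      = real (g * (2 * l + 1)) * (T * (1 - 17 * real M / real K) / (\<kappa> * real M))"
    by simp
  also have "\<dots> \<le> real (g * (2 * l + 1)) * (2 * S - real (F 0))"
    by (rule mult_left_mono[OF main]) simp
  also have "\<dots> = real (card Tri)" by (simp only: card_Tri of_nat_mult cnt)
  also have "\<dots> \<le> real (SP (2 * N) (2 * h + 3))" using card_Tri_le_SP by (simp only: of_nat_le_iff)
  finally show ?thesis by (simp add: \<kappa>_def)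
qed

text \<open>The types \<open>(f + 1 + m, f + 1 - m)\<close> and \<open>(f + m, f + 1 - m)\<close>
  differ in one coordinate only, so a single binomial ratio relates the two layers.\<close>

lemma even_layer_Suc_odd_layer:
  assumes "1 \<le> m" "m \<le> f + 1" "f + m \<le> N"
  shows "real (f + 1 + m) * real (even_layer N (f + 1) (int m))
    = (real N - real f - real m) * real (odd_layer N f (int m))"
proof -
  have "real (Suc (f + m)) * real (N choose Suc (f + m)) = real (N - (f + m)) * real (N choose (f + m))"
    by (metis Suc_times_choose_Suc of_nat_mult)
  moreover have "real (N - (f + m)) = real N - real f - real m" using assms by (simp add: of_nat_diff)
  moreover have "even_layer N (f + 1) (int m) = (N choose Suc (f + m)) * (N choose (f + 1 - m))"
    using assms by (subst even_layer_nat) auto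
  moreover have "odd_layer N f (int m) = (N choose (f + m)) * (N choose (f + 1 - m))"
    using assms by (subst odd_layer_nat) auto
  ultimately show ?thesis by simp
qed

lemma even_layer_odd_layer:
  assumes "1 \<le> m" "m \<le> e" "e \<le> N"
  shows "(real N - real e + real m) * real (even_layer N e (int m))
    = (real e + 1 - real m) * real (odd_layer N e (int m))"
proof -
  have "real (Suc (e - m)) * real (N choose Suc (e - m)) = real (N - (e - m)) * real (N choose (e - m))"
    by (metis Suc_times_choose_Suc of_nat_mult)
  moreover have "real (N - (e - m)) = real N - real e + real m" using assms by (simp add: of_nat_diff)
  moreover have "real (Suc (e - m)) = real e + 1 - real m" using assms by (simp add: of_nat_diff)
  moreover have "even_layer N e (int m) = (N choose (e + m)) * (N choose (e - m))"
    using assms by (subst even_layer_nat) auto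
  moreover have "odd_layer N e (int m) = (N choose (e + m)) * (N choose Suc (e - m))"
    using assms by (subst odd_layer_nat) (auto simp: Suc_diff_le)
  ultimately show ?thesis by (simp only: of_nat_mult) (metis mult.assoc mult.left_commute)
qed

text \<open>Here \<open>e = f + 1\<close>. Near the middle an even layer is about
  \<open>k - 1\<close> times the odd layer, while \<open>F\<close> is about the odd layer divided by
  \<open>k - 1\<close>; hence \<open>g\<close> may be as large as
  \<open>(k - 1) ^ 2\<close>.\<close>

lemma SP_ge_mod_1:
  fixes f h g l K :: nat
  defines "M \<equiv> (g + 1) * (2 * l + 1) + 1" and "k \<equiv> 2 * h + 3"
  assumes K: "K > 0" "4 * K ^ 2 \<le> f + 1" and g: "g \<le> (k - 1)\<^sup>2"
  shows "real (g * (2 * l + 1)) / (real (k - 1) * real M) * real ((k * (2 * f + 1) + 1) choose (2 * f + 1))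
      * (1 - 17 * real M / real K) \<le> real (SP (k * (2 * f + 1) + 1) k)"
proof -
  define N where "N = f + 1 + (h + 1) * (2 * f + 1)"
  define \<kappa> where "\<kappa> = real (2 * h + 2)"
  have \<kappa>: "\<kappa> \<ge> 2" by (simp add: \<kappa>_def)
  have n: "k * (2 * f + 1) + 1 = 2 * N" by (simp add: k_def N_def algebra_simps)
  have k1: "k - 1 = 2 * h + 2" by (simp add: k_def)
  have "real g \<le> real ((2 * h + 2)\<^sup>2)" using g unfolding k1 by (simp only: of_nat_le_iff)
  then have g': "real g \<le> \<kappa>\<^sup>2" by (simp add: \<kappa>_def)
  have "real (g * (2 * l + 1)) / (real (2 * h + 2) * real M) * real (2 * N choose (2 * f + 1))
      * (1 - 17 * real M / real K) \<le> real (SP (2 * N) (2 * h + 3))"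
    unfolding M_def
  proof (rule SP_ge_of_ratio[OF N_def _ _ _ K])
    fix m assume m: "1 \<le> m" "m \<le> f + 1"
    define a where "a = real (f + 1)"
    define x where "x = real m"
    define D where "D = real (odd_layer N f (int m))"
    have a: "a > 0" and x: "1 \<le> x" using m by (auto simp: a_def x_def)
    have Na: "real N - real f = \<kappa> * (a - 1 / 2) + 1"
      by (simp add: N_def a_def \<kappa>_def algebra_simps)
    have "f + m \<le> N" using m by (simp add: N_def)
    from even_layer_Suc_odd_layer[OF m this]
    have E: "(a + x) * real (even_layer N (f + 1) (int m)) = (\<kappa> * (a - 1 / 2) + 1 - x) * D"
      by (simp add: Na D_def) (simp add: a_def x_def algebra_simps)
    have "real g * (D * (1 - 2 * x / a)) / \<kappa> \<le> real (even_layer N (f + 1) (int m))"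
    proof (cases "1 - 2 * x / a \<le> 0")
      case True
      then have "real g * (D * (1 - 2 * x / a)) / \<kappa> \<le> 0"
        using \<kappa> by (intro divide_nonpos_pos mult_nonneg_nonpos) (auto simp: D_def)
      then show ?thesis by linarith
    next
      case False
      have "real g * (D * (1 - 2 * x / a)) \<le> \<kappa>\<^sup>2 * (D * (1 - 2 * x / a))"
        using g' False by (intro mult_right_mono mult_nonneg_nonneg) (auto simp: D_def)
      then have "real g * (D * (1 - 2 * x / a)) / \<kappa> \<le> \<kappa> * (D * (1 - 2 * x / a))"
        using \<kappa> by (simp add: divide_le_eq power2_eq_square mult_ac)
      moreover have "(a + x) * (\<kappa> * (D * (1 - 2 * x / a))) \<le> (\<kappa> * (a - 1 / 2) + 1 - x) * D"
      proof -
        have "(a + x) * (1 - 2 * x / a) = a - x - 2 * x\<^sup>2 / a"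
          using a by (simp add: field_simps power2_eq_square)
        also have "\<dots> \<le> a - x" using a by simp
        finally have "\<kappa> * ((a + x) * (1 - 2 * x / a)) \<le> \<kappa> * (a - x)" using \<kappa> by (intro mult_left_mono) auto
        also have "\<dots> \<le> \<kappa> * (a - 1 / 2) + 1 - x"
        proof -
          have "(\<kappa> - 1) * (x - 1 / 2) \<ge> 0" using \<kappa> x by simp
          then show ?thesis by (simp add: algebra_simps diff_divide_distrib)
        qed
        finally have "\<kappa> * ((a + x) * (1 - 2 * x / a)) * D \<le> (\<kappa> * (a - 1 / 2) + 1 - x) * D"
          by (rule mult_right_mono) (simp add: D_def)
        then show ?thesis by (simp only: mult_ac)
      qed
      ultimately have "(a + x) * (real g * (D * (1 - 2 * x / a)) / \<kappa>) \<le> (a + x) * real (even_layer N (f + 1) (int m))"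
        unfolding E using a x by (meson add_pos_pos less_le_trans mult_left_mono order_less_imp_le order_trans zero_less_one)
      moreover have "a + x > 0" using a x by simp
      ultimately show ?thesis by (simp only: mult_le_cancel_left_pos)
    qed
    then show "real g * (real (odd_layer N f (int m)) * (1 - 2 * real m / real (f + 1))) / real (2 * h + 2)
        \<le> real (even_layer N (f + 1) (int m))"
      by (simp only: D_def x_def a_def \<kappa>_def)
  qed auto
  then show ?thesis unfolding n by (simp only: k1 flip: k_def)
qed

text \<open>Here \<open>e = f\<close> and \<open>g = 1\<close>: near the middle an even layer is
  about the odd layer divided by \<open>k - 1\<close>, and so is \<open>F\<close>.\<close>

lemma SP_ge_mod_minus_1:
  fixes e h l K :: nat
  defines "M \<equiv> 2 * (2 * l + 1) + 1" and "k \<equiv> 2 * h + 3"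
  assumes K: "K > 0" "4 * K ^ 2 \<le> e + 1" and e: "e > 0"
  shows "real (2 * l + 1) / (real (k - 1) * real M) * real ((k * (2 * e) + (k - 1)) choose (2 * e + 1))
      * (1 - 17 * real M / real K) \<le> real (SP (k * (2 * e) + (k - 1)) k)"
proof -
  define N where "N = e + (h + 1) * (2 * e + 1)"
  define \<kappa> where "\<kappa> = real (2 * h + 2)"
  have \<kappa>: "\<kappa> \<ge> 2" by (simp add: \<kappa>_def)
  have n: "k * (2 * e) + (k - 1) = 2 * N" by (simp add: k_def N_def algebra_simps)
  have k1: "k - 1 = 2 * h + 2" by (simp add: k_def)
  have "real (1 * (2 * l + 1)) / (real (2 * h + 2) * real ((1 + 1) * (2 * l + 1) + 1)) * real (2 * N choose (2 * e + 1))
      * (1 - 17 * real ((1 + 1) * (2 * l + 1) + 1) / real K) \<le> real (SP (2 * N) (2 * h + 3))"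
  proof (rule SP_ge_of_ratio[OF N_def _ _ e K])
    fix m assume m: "1 \<le> m" "m \<le> e"
    define a where "a = real e"
    define x where "x = real m"
    define D where "D = real (odd_layer N e (int m))"
    have a: "a > 0" and x: "1 \<le> x" "x \<le> a" by (use e m in \<open>auto simp: a_def x_def\<close>)
    have Na: "real N - real e = \<kappa> * (a + 1 / 2)"
      by (simp add: N_def a_def \<kappa>_def algebra_simps)
    have "e \<le> N" by (simp add: N_def)
    from even_layer_odd_layer[OF m this]
    have E: "(\<kappa> * (a + 1 / 2) + x) * real (even_layer N e (int m)) = (a + 1 - x) * D"
      by (simp add: Na D_def a_def x_def)
    have pos: "\<kappa> * (a + 1 / 2) + x > 0" using \<kappa> a x by (intro add_pos_pos mult_pos_pos) auto
    have "D * (1 - 2 * x / a) / \<kappa> \<le> real (even_layer N e (int m))"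
    proof (cases "1 - 2 * x / a \<le> 0")
      case True
      then have "D * (1 - 2 * x / a) / \<kappa> \<le> 0"
        using \<kappa> by (intro divide_nonpos_pos mult_nonneg_nonpos) (auto simp: D_def)
      then show ?thesis by linarith
    next
      case False
      have "(\<kappa> * (a + 1 / 2) + x) / \<kappa> = a + 1 / 2 + x / \<kappa>" using \<kappa> by (simp add: field_simps)
      also have "\<dots> \<le> a + 1 / 2 + x / 2" using \<kappa> x by (intro add_left_mono divide_left_mono) auto
      finally have "(\<kappa> * (a + 1 / 2) + x) / \<kappa> * (1 - 2 * x / a) \<le> (a + 1 / 2 + x / 2) * (1 - 2 * x / a)"
        using False by (intro mult_right_mono) auto
      also have "\<dots> = a + 1 / 2 + x / 2 - 2 * x - x / a - x\<^sup>2 / a"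
        using a by (simp add: field_simps power2_eq_square)
      also have "\<dots> \<le> a + 1 - x"
      proof -
        have "x / a \<ge> 0" "x\<^sup>2 / a \<ge> 0" using a x by simp_all
        then show ?thesis using x by linarith
      qed
      finally have "(\<kappa> * (a + 1 / 2) + x) / \<kappa> * (1 - 2 * x / a) * D \<le> (a + 1 - x) * D"
        by (rule mult_right_mono) (simp add: D_def)
      then have "(\<kappa> * (a + 1 / 2) + x) * (D * (1 - 2 * x / a) / \<kappa>) \<le> (\<kappa> * (a + 1 / 2) + x) * real (even_layer N e (int m))"
        unfolding E by (simp add: mult_ac)
      then show ?thesis using pos by (simp only: mult_le_cancel_left_pos)
    qed
    then show "real 1 * (real (odd_layer N e (int m)) * (1 - 2 * real m / real e)) / real (2 * h + 2)
        \<le> real (even_layer N e (int m))"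
      by (simp add: D_def x_def a_def \<kappa>_def)
  qed auto
  moreover have "1 * (2 * l + 1) = 2 * l + 1" "(1 + 1) * (2 * l + 1) + 1 = M" by (simp_all add: M_def)
  ultimately show ?thesis unfolding n by (simp only: k1 flip: k_def)
qed

section \<open>The upper bound and the asymptotics\<close>

text \<open>At least \<open>fact (card A) * fact (n - card A)\<close> permutations of
  \<open>X\<close> list \<open>A\<close> first, and no permutation does so for two members of an
  antichain, because its prefixes form a chain.\<close>

lemma LYM_inequality:
  fixes X :: "'a set"
  assumes X: "finite X" and sub: "\<F> \<subseteq> Pow X"
    and antichain: "\<And>A B. A \<in> \<F> \<Longrightarrow> B \<in> \<F> \<Longrightarrow> A \<subseteq> B \<Longrightarrow> A = B"
  shows "(\<Sum>A\<in>\<F>. 1 / real (card X choose card A)) \<le> 1"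
proof -
  define n where "n = card X"
  define chains where "chains A = {xs \<in> permutations_of_set X. set (take (card A) xs) = A}" for A :: "'a set"
  have finF: "finite \<F>" using X sub by (meson finite_Pow_iff finite_subset)
  have fin: "finite (chains A)" for A by (simp add: chains_def)
  have card_ge: "fact (card A) * fact (n - card A) \<le> card (chains A)" if "A \<in> \<F>" for A
  proof -
    have A: "A \<subseteq> X" "finite A" using that sub X by (auto intro: finite_subset)
    let ?D = "permutations_of_set A \<times> permutations_of_set (X - A)"
    have "card ?D = fact (card A) * fact (n - card A)"
      using A X by (simp add: card_cartesian_product n_def card_Diff_subset)
    moreover have "card ?D \<le> card (chains A)"
    proof (rule card_inj_on_le[where f = "\<lambda>(ys, zs). ys @ zs"])
      have len: "length ys = card A" if "ys \<in> permutations_of_set A" for ys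
        using that by (rule length_finite_permutations_of_set)
      show "inj_on (\<lambda>(ys, zs). ys @ zs) ?D"
        by (rule inj_onI) (use len in auto)
      show "(\<lambda>(ys, zs). ys @ zs) ` ?D \<subseteq> chains A"
        using A len by (auto simp: chains_def permutations_of_set_def)
    qed (rule fin)
    ultimately show ?thesis by simp
  qed
  have disj: "chains A \<inter> chains B = {}" if "A \<in> \<F>" "B \<in> \<F>" "A \<noteq> B" for A B
  proof -
    have False if xs: "xs \<in> chains A" "xs \<in> chains B" for xs
    proof -
      have AB: "A = set (take (card A) xs)" "B = set (take (card B) xs)"
        using xs by (simp_all add: chains_def)
      have "A \<subseteq> B \<or> B \<subseteq> A"
        using set_take_subset_set_take[of "card A" "card B" xs]
          set_take_subset_set_take[of "card B" "card A" xs] AB by (metis nat_le_linear)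
      then show False using antichain \<open>A \<in> \<F>\<close> \<open>B \<in> \<F>\<close> \<open>A \<noteq> B\<close> by metis
    qed
    then show ?thesis by blast
  qed
  have "(\<Sum>A\<in>\<F>. fact (card A) * fact (n - card A)) \<le> (\<Sum>A\<in>\<F>. card (chains A))"
    by (intro sum_mono card_ge)
  also have "\<dots> = card (\<Union>A\<in>\<F>. chains A)"
    by (rule card_UN_disjoint[symmetric]) (use finF fin disj in auto)
  also have "\<dots> \<le> card (permutations_of_set X)"
    by (rule card_mono) (auto simp: chains_def)
  also have "\<dots> = fact n" using X by (simp add: n_def)
  finally have "real (\<Sum>A\<in>\<F>. fact (card A) * fact (n - card A)) \<le> real (fact n)"
    by (simp only: of_nat_le_iff)
  then have "(\<Sum>A\<in>\<F>. fact (card A) * fact (n - card A)) / fact n \<le> (1 :: real)"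
    by simp
  moreover have "(\<Sum>A\<in>\<F>. fact (card A) * fact (n - card A)) / fact n = (\<Sum>A\<in>\<F>. 1 / real (n choose card A))"
    unfolding sum_divide_distrib
  proof (rule sum.cong[OF refl])
    fix A assume "A \<in> \<F>"
    then have "card A \<le> n" using sub X by (auto simp: n_def intro: card_mono)
    then show "fact (card A) * fact (n - card A) / fact n = 1 / real (n choose card A)"
      by (simp add: binomial_fact)
  qed
  ultimately show ?thesis by (simp only: n_def)
qed

text \<open>Log-concavity gives \<open>p * r \<le> q ^ 2\<close> for consecutive entries, and the
  inequality of arithmetic and geometric means turns this into
  \<open>2 / q \<le> 1 / p + 1 / r\<close>.\<close>

lemma inverse_choose_diff_mono:
  assumes "i \<le> j" "Suc j \<le> n"
  shows "1 / real (n choose Suc i) - 1 / real (n choose i) \<le> 1 / real (n choose Suc j) - 1 / real (n choose j)"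
  using assms
proof (induction rule: dec_induct)
  case (step j)
  define p where "p = real (n choose j)"
  define q where "q = real (n choose Suc j)"
  define r where "r = real (n choose Suc (Suc j))"
  have pos: "p > 0" "q > 0" "r > 0" using step.prems by (auto simp: p_def q_def r_def)
  have "real ((n choose Suc (Suc j)) * (n choose j)) \<le> real ((n choose Suc j) * (n choose Suc j))"
    by (simp only: of_nat_le_iff) (rule choose_mult_choose_antimono, simp)
  then have pr: "p * r \<le> q\<^sup>2" by (simp add: p_def q_def r_def power2_eq_square mult.commute)
  have "(2 * (p * r))\<^sup>2 = 4 * (p * r) * (p * r)" by (simp add: power2_eq_square)
  also have "\<dots> \<le> (p + r)\<^sup>2 * (p * r)"
    using pos sum_squares_ge_zero[of "p - r" 0] by (intro mult_right_mono) (auto simp: power2_eq_square algebra_simps)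
  also have "\<dots> \<le> (p + r)\<^sup>2 * q\<^sup>2" using pr by (intro mult_left_mono) auto
  also have "\<dots> = ((p + r) * q)\<^sup>2" by (simp add: power_mult_distrib)
  finally have "2 * (p * r) \<le> (p + r) * q" by (rule power2_le_imp_le) (use pos in simp)
  then have "2 / q \<le> (p + r) / (p * r)" using pos by (simp add: divide_le_eq pos_le_divide_eq)
  moreover have "(p + r) / (p * r) = 1 / r + 1 / p" using pos by (simp add: add_divide_distrib)
  ultimately have "1 / q - 1 / p \<le> 1 / r - 1 / q" by simp
  then show ?case using step unfolding p_def q_def r_def by simp
qed simp

text \<open>The line through the points at \<open>c\<close> and \<open>c + 1\<close> supports a
  convex sequence at all integers; the increments are compared step by step on either side of
  \<open>c\<close>.\<close>

lemma inverse_choose_tangent: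
  assumes "x \<le> n" "Suc c \<le> n"
  shows "1 / real (n choose c) + (real x - real c) * (1 / real (n choose Suc c) - 1 / real (n choose c))
    \<le> 1 / real (n choose x)"
proof -
  define \<Delta> where "\<Delta> = 1 / real (n choose Suc c) - 1 / real (n choose c)"
  have "1 / real (n choose c) + (real x - real c) * \<Delta> \<le> 1 / real (n choose x)"
  proof (cases "c \<le> x")
    case True
    then show ?thesis using assms(1)
    proof (induction rule: dec_induct)
      case (step y)
      have "(real (Suc y) - real c) * \<Delta> = (real y - real c) * \<Delta> + \<Delta>" by (simp add: algebra_simps)
      then show ?case using inverse_choose_diff_mono[of c y n] step unfolding \<Delta>_def by simp
    qed simp
  next
    case False
    then have "x \<le> c" by simp
    then show ?thesis
    proof (induction rule: inc_induct)
      case (step y)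
      have "(real (Suc y) - real c) * \<Delta> = (real y - real c) * \<Delta> + \<Delta>" by (simp add: algebra_simps)
      then show ?case using inverse_choose_diff_mono[of y c n] step assms unfolding \<Delta>_def by simp
    qed simp
  qed
  then show ?thesis by (simp only: \<Delta>_def)
qed

lemma MMS_pos:
  assumes "0 < k" shows "MMS n k > 0"
proof -
  have c: "n div k \<le> n" by simp
  have "real (n mod k) < real k" using assms by simp
  then have "real k - real (n mod k) + real (n mod k) * (real (n div k) + 1) / (real n - real (n div k)) > 0"
    using c by (intro add_pos_nonneg divide_nonneg_nonneg) auto
  then show ?thesis using c by (simp add: MMS_def Let_def)
qed

text \<open>Summed over the parts of one partition, the supporting line at \<open>c\<close> depends
  only on the total size \<open>n = k * c + r\<close> and gives the weight \<open>w\<close> of a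
  balanced partition. Its reciprocal is \<open>MMS\<close>, so the LYM inequality bounds the number
  of partitions.\<close>

lemma SP_le_MMS:
  assumes k: "0 < k" and c: "n div k + 1 \<le> n"
  shows "real (SP n k) \<le> MMS n k"
proof -
  define c where "c = n div k"
  define r where "r = n mod k"
  have n: "n = k * c + r" by (simp add: c_def r_def)
  have cn: "Suc c \<le> n" using assms by (simp add: c_def)
  obtain S where S: "sperner_partition_system {..<n} k S" "card S = SP n k"
    using SP_attained[of "{..<n}" n k] by auto
  then have part: "\<And>P. P \<in> S \<Longrightarrow> partition_on {..<n} P \<and> card P = k"
    and sper: "\<And>P Q A B. P \<in> S \<Longrightarrow> Q \<in> S \<Longrightarrow> P \<noteq> Q \<Longrightarrow> A \<in> P \<Longrightarrow> B \<in> Q \<Longrightarrow> \<not> A \<subseteq> B"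
    by (auto simp: sperner_partition_system_def)
  define u where "u x = 1 / real (n choose x)" for x
  define w where "w = (real k - real r) * u c + real r * u (Suc c)"
  have finP: "finite P" if "P \<in> S" for P using part[OF that] k card_ge_0_finite by metis
  have subX: "A \<subseteq> {..<n}" if "P \<in> S" "A \<in> P" for P A
    using part[OF that(1)] that(2) by (auto simp: partition_on_def)
  have finS: "finite S"
    using part by (intro finite_subset[of S "Pow (Pow {..<n})"]) (auto simp: partition_on_def)
  have weight: "w \<le> (\<Sum>A\<in>P. u (card A))" if P: "P \<in> S" for P
  proof -
    have "card (\<Union>P) = (\<Sum>A\<in>P. card A)"
    proof (rule card_Union_disjoint)
      show "pairwise disjnt P" using part[OF P] by (auto simp: partition_on_def disjoint_def pairwise_def disjnt_def)
      show "finite A" if "A \<in> P" for A using subX[OF P that] finite_subset by blast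
    qed
    moreover have "\<Union>P = {..<n}" using part[OF P] by (simp add: partition_on_def)
    ultimately have sz: "(\<Sum>A\<in>P. real (card A)) = real n" by (metis card_lessThan of_nat_sum)
    have "w = (\<Sum>A\<in>P. u c + (real (card A) - real c) * (u (Suc c) - u c))"
    proof -
      have "(\<Sum>A\<in>P. u c + (real (card A) - real c) * (u (Suc c) - u c))
          = real k * u c + ((\<Sum>A\<in>P. real (card A)) - real k * real c) * (u (Suc c) - u c)"
        using part[OF P] by (simp add: sum.distrib sum_subtractf flip: sum_distrib_right)
      also have "\<dots> = real k * u c + real r * (u (Suc c) - u c)" unfolding sz by (simp add: n)
      finally show ?thesis by (simp add: w_def algebra_simps)
    qed
    also have "\<dots> \<le> (\<Sum>A\<in>P. u (card A))"
    proof (rule sum_mono)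
      fix A assume "A \<in> P"
      then have "card A \<le> n" using subX[OF P] by (metis card_lessThan card_mono finite_lessThan)
      then show "u c + (real (card A) - real c) * (u (Suc c) - u c) \<le> u (card A)"
        unfolding u_def using cn by (rule inverse_choose_tangent)
    qed
    finally show ?thesis .
  qed
  have "real (card S) * w = (\<Sum>P\<in>S. w)" by simp
  also have "\<dots> \<le> (\<Sum>P\<in>S. \<Sum>A\<in>P. u (card A))" by (intro sum_mono weight)
  \<comment> \<open>Different partitions share no part, since a part is contained in itself.\<close>
  also have "\<dots> = (\<Sum>A\<in>\<Union>S. u (card A))"
  proof -
    have "(\<Sum>A\<in>\<Union>S. u (card A)) = (sum \<circ> sum) (\<lambda>A. u (card A)) S"
      by (rule sum.Union_disjoint) (use finP sper in blast)+
    then show ?thesis by simp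
  qed
  also have "\<dots> \<le> 1"
  proof -
    have "(\<Sum>A\<in>\<Union>S. 1 / real (card {..<n} choose card A)) \<le> 1"
    proof (rule LYM_inequality)
      show "\<Union>S \<subseteq> Pow {..<n}" using subX by blast
      fix A B assume "A \<in> \<Union>S" "B \<in> \<Union>S" "A \<subseteq> B"
      then obtain P Q where PQ: "P \<in> S" "Q \<in> S" "A \<in> P" "B \<in> Q" by blast
      then have "P = Q" using sper \<open>A \<subseteq> B\<close> by blast
      then have "A = B \<or> A \<inter> B = {}" "A \<noteq> {}"
        using part[OF PQ(1)] PQ by (auto simp: partition_on_def disjoint_def)
      then show "A = B" using \<open>A \<subseteq> B\<close> by blast
    qed simp
    then show ?thesis by (simp add: u_def)
  qed
  finally have main: "real (SP n k) * w \<le> 1" using S(2) by simp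
  define D where "D = real k - real r + real r * (real c + 1) / (real n - real c)"
  have D: "D > 0"
    unfolding D_def using k cn by (intro add_pos_nonneg) (auto simp: r_def)
  have C: "real (n choose c) > 0" using cn by simp
  have nc: "real n - real c > 0" using cn by simp
  have "real (Suc c) * real (n choose Suc c) = real (n - c) * real (n choose c)"
    by (metis Suc_times_choose_Suc of_nat_mult)
  then have eq: "real (n choose Suc c) = (real n - real c) * real (n choose c) / (real c + 1)"
    using cn by (simp add: of_nat_diff field_simps)
  define s where "s = (real c + 1) / (real n - real c)"
  have "u (Suc c) = s / real (n choose c)"
    unfolding u_def eq s_def using nc C by simp
  moreover have "D = real k - real r + real r * s" by (simp add: D_def s_def)
  ultimately have "w = D / real (n choose c)"
    unfolding w_def u_def[of c] by (simp add: add_divide_distrib)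
  then have "real (SP n k) * D \<le> real (n choose c)" using main C by (simp add: divide_le_eq)
  then have "real (SP n k) \<le> real (n choose c) / D" using D by (simp add: pos_le_divide_eq)
  then show ?thesis by (simp add: MMS_def Let_def D_def c_def r_def)
qed

section \<open>Passage to the limit\<close>

text \<open>The threshold in \<open>lower\<close> is one constant for all values of
  \<open>k i\<close>, so \<open>k = o(n)\<close> is used only to make \<open>q i\<close> exceed any
  constant eventually.\<close>

lemma SP_asymp_equiv_MMS:
  fixes n k q :: "nat \<Rightarrow> nat"
  assumes k: "\<And>i. 2 \<le> k i" and kn: "\<And>i. k i \<le> n i" and small: "(\<lambda>i. real (k i)) \<in> o(\<lambda>i. real (n i))"
    and q: "\<And>i. n i < 2 * k i * (q i + 1)"
    and lower: "\<And>\<epsilon>. 0 < \<epsilon> \<Longrightarrow> \<exists>c. \<forall>i. c \<le> q i \<longrightarrow> (1 - \<epsilon>) * MMS (n i) (k i) \<le> real (SP (n i) (k i))"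
  shows "(\<lambda>i. real (SP (n i) (k i))) \<sim>[sequentially] (\<lambda>i. MMS (n i) (k i))"
proof (rule asymp_equivI')
  have pos: "MMS (n i) (k i) > 0" for i by (rule MMS_pos) (use k[of i] in simp)
  have upper: "real (SP (n i) (k i)) \<le> MMS (n i) (k i)" for i
  proof (rule SP_le_MMS)
    have "n i div k i \<le> n i div 2" using k[of i] by (intro div_le_mono2) auto
    then show "n i div k i + 1 \<le> n i" using k[of i] kn[of i] by linarith
  qed (use k[of i] in simp)
  show "((\<lambda>i. real (SP (n i) (k i)) / MMS (n i) (k i)) \<longlongrightarrow> 1) sequentially"
  proof (rule tendstoI)
    fix \<epsilon> :: real assume \<epsilon>: "0 < \<epsilon>"
    then obtain c where c: "\<And>i. c \<le> q i \<Longrightarrow> (1 - \<epsilon> / 2) * MMS (n i) (k i) \<le> real (SP (n i) (k i))"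
      using lower[of "\<epsilon> / 2"] by auto
    \<comment> \<open>The constant is chosen to give \<open>n i \<ge> 2 * k i * (c + 1)\<close>,
      which with the bound on \<open>q\<close> forces \<open>c \<le> q i\<close>.\<close>
    have "eventually (\<lambda>i. norm (real (k i)) \<le> 1 / (2 * (real c + 1)) * norm (real (n i))) sequentially"
      by (rule landau_o.smallD[OF small]) simp
    then show "eventually (\<lambda>i. dist (real (SP (n i) (k i)) / MMS (n i) (k i)) 1 < \<epsilon>) sequentially"
    proof eventually_elim
      case (elim i)
      then have "real (2 * k i * (c + 1)) \<le> real (n i)" by (simp add: field_simps)
      then have "2 * k i * (c + 1) \<le> n i" by (simp only: of_nat_le_iff)
      also have "\<dots> < 2 * k i * (q i + 1)" by (rule q)
      finally have "c \<le> q i" by (simp only: mult_less_cancel1) simp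
      from c[OF this] have "1 - \<epsilon> / 2 \<le> real (SP (n i) (k i)) / MMS (n i) (k i)"
        using pos by (simp add: pos_le_divide_eq)
      moreover have "real (SP (n i) (k i)) / MMS (n i) (k i) \<le> 1"
        using upper pos by (simp add: divide_le_eq)
      ultimately show ?case using \<epsilon> by (simp add: dist_real_def)
    qed
  qed
qed

lemma one_minus_cube_le:
  fixes \<delta> a b c :: real
  assumes "0 \<le> \<delta>" "\<delta> \<le> 1" "1 - \<delta> \<le> a" "1 - \<delta> \<le> b" "1 - \<delta> \<le> c"
  shows "1 - 3 * \<delta> \<le> a * b * c"
proof -
  have "1 - 3 * \<delta> \<le> (1 - \<delta>) * (1 - \<delta>) * (1 - \<delta>)"
  proof -
    have "(1 - \<delta>) * (1 - \<delta>) * (1 - \<delta>) - (1 - 3 * \<delta>) = \<delta> * \<delta> * (3 - \<delta>)" by (simp add: algebra_simps)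
    also have "\<dots> \<ge> 0" using assms by simp
    finally show ?thesis by simp
  qed
  also have "\<dots> \<le> a * b * c" using assms by (intro mult_mono) auto
  finally show ?thesis .
qed

text \<open>Three losses of a factor \<open>1 - \<delta>\<close>: capping \<open>g\<close> at
  \<open>G\<close>, the wasted position in each period, and the error term
  \<open>17 * M / K\<close>. First \<open>G\<close> is chosen, then \<open>M0\<close> bounding all
  periods, then \<open>K\<close>, then the range of \<open>f\<close>; none of these depends on
  \<open>h\<close>.\<close>

lemma SP_asymp_lower_mod_1:
  fixes \<epsilon> :: real
  assumes "0 < \<epsilon>"
  shows "\<exists>f0. \<forall>f h. f0 \<le> f \<longrightarrow>
    (1 - \<epsilon>) * MMS ((2 * h + 3) * (2 * f + 1) + 1) (2 * h + 3) \<le> real (SP ((2 * h + 3) * (2 * f + 1) + 1) (2 * h + 3))"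
proof -
  define \<delta> where "\<delta> = min 1 (\<epsilon> / 3)"
  have \<delta>: "0 < \<delta>" "\<delta> \<le> 1" "3 * \<delta> \<le> \<epsilon>" using assms by (auto simp: \<delta>_def)
  obtain G :: nat where G: "1 / (real G + 1) \<le> \<delta>"
    using \<delta>(1) by (metis less_imp_le nat_approx_posE of_nat_Suc add.commute)
  define M0 where "M0 = (G + 1) * (2 * G + 1) + 1"
  obtain K :: nat where K: "real K > 17 * real M0 / \<delta>" using reals_Archimedean2 by blast
  have "real M0 > 0" by (simp add: M0_def add_pos_nonneg)
  then have "17 * real M0 / \<delta> > 0" using \<delta> by simp
  then have K0: "K > 0" using K by (metis of_nat_0_less_iff order_less_trans)
  have KM: "17 * real M0 / real K \<le> \<delta>" using K \<delta>(1) K0 by (simp add: field_simps)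
  show ?thesis
  proof (intro exI[of _ "4 * K ^ 2"] allI impI)
    fix f h :: nat assume f: "4 * K ^ 2 \<le> f"
    define k where "k = 2 * h + 3"
    define n where "n = k * (2 * f + 1) + 1"
    define \<kappa> where "\<kappa> = real (k - 1)"
    \<comment> \<open>The ratio \<open>(k - 1)\<^sup>2\<close> between odd and even blocks is optimal; the cap keeps the period bounded
      when \<open>k\<close> grows.\<close>
    define g where "g = min ((k - 1)\<^sup>2) G"
    define M where "M = (g + 1) * (2 * G + 1) + 1"
    define T where "T = real (n choose (2 * f + 1))"
    have \<kappa>: "\<kappa> \<ge> 2" by (simp add: \<kappa>_def k_def)
    have "1 < k" by (simp add: k_def)
    moreover have "(k * (2 * f + 1) + j) div k = 2 * f + 1" "(k * (2 * f + 1) + j) mod k = j" if "j < k" for j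
      using div_mult_self4[of k "2 * f + 1" j] mod_mult_self4[of k "2 * f + 1" j] that by simp_all
    ultimately have nd: "n div k = 2 * f + 1" "n mod k = 1" unfolding n_def by blast+
    have rk: "real k = \<kappa> + 1" by (simp add: \<kappa>_def k_def)
    define C where "C = real (2 * f + 1)"
    have Cpos: "C > 0" by (simp add: C_def)
    have "real n = real k * C + 1" by (simp add: n_def C_def algebra_simps)
    then have rn: "real n = (\<kappa> + 1) * C + 1" by (simp only: rk)
    have MMS: "MMS n k = T / (\<kappa> + (C + 1) / (\<kappa> * C + 1))"
      unfolding MMS_def Let_def nd T_def[symmetric] C_def[symmetric] rn rk by (simp add: algebra_simps)
    \<comment> \<open>This bounds the denominator of \<open>MMS\<close> below by
      \<open>\<kappa> + 1 / \<kappa>\<close>; the resulting factor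
      \<open>\<kappa>\<^sup>2 / (\<kappa>\<^sup>2 + 1)\<close> is \<open>g / (g + 1)\<close> for
      uncapped \<open>g\<close>.\<close>
    have frac: "1 / \<kappa> \<le> (C + 1) / (\<kappa> * C + 1)"
    proof -
      have "\<kappa> * C + 1 > 0" using \<kappa> Cpos by (simp add: add_pos_pos)
      then show ?thesis using \<kappa> by (simp add: field_simps)
    qed
    have T0: "T \<ge> 0" by (simp add: T_def)
    have "MMS n k \<le> T / (\<kappa> + 1 / \<kappa>)"
      unfolding MMS using frac \<kappa> T0 by (intro divide_left_mono mult_pos_pos add_pos_pos) (auto intro: less_le_trans[OF _ frac])
    also have "\<dots> = T / \<kappa> * (\<kappa>\<^sup>2 / (\<kappa>\<^sup>2 + 1))"
      using \<kappa> by (simp add: field_simps power2_eq_square)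
    finally have up: "MMS n k \<le> T / \<kappa> * (\<kappa>\<^sup>2 / (\<kappa>\<^sup>2 + 1))" .
    have gG: "(1 - \<delta>) * (\<kappa>\<^sup>2 / (\<kappa>\<^sup>2 + 1)) \<le> real g / (real g + 1)"
    proof (cases "(k - 1)\<^sup>2 \<le> G")
      case True
      then have "real g = \<kappa>\<^sup>2" by (simp add: g_def \<kappa>_def)
      moreover have "(1 - \<delta>) * (\<kappa>\<^sup>2 / (\<kappa>\<^sup>2 + 1)) \<le> 1 * (\<kappa>\<^sup>2 / (\<kappa>\<^sup>2 + 1))"
        by (rule mult_right_mono) (use \<delta> in auto)
      ultimately show ?thesis by (simp only: mult_1)
    next
      case False
      then have "g = G" by (simp add: g_def)
      have "1 - \<delta> \<le> 1 - 1 / (real G + 1)" using G by simp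
      also have "\<dots> = real G / (real G + 1)" by (simp add: field_simps)
      finally have "1 - \<delta> \<le> real G / (real G + 1)" .
      moreover have "\<kappa>\<^sup>2 / (\<kappa>\<^sup>2 + 1) \<le> 1" by (simp add: add_nonneg_pos divide_le_eq)
      ultimately have "(1 - \<delta>) * (\<kappa>\<^sup>2 / (\<kappa>\<^sup>2 + 1)) \<le> real G / (real G + 1) * 1"
        using \<delta> by (intro mult_mono) auto
      then show ?thesis using \<open>g = G\<close> by simp
    qed
    have "g \<le> G" by (simp add: g_def)
    then have M: "M > 0" "M \<le> M0" unfolding M_def M0_def by (auto intro!: add_mono mult_le_mono)
    have l1: "real g / (real g + 1) * (1 - \<delta>) \<le> real (g * (2 * G + 1)) / real M"
    proof -
      have "1 - \<delta> \<le> 1 - 1 / (real G + 1)" using G by simp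
      also have "\<dots> \<le> real (2 * G + 1) / (real (2 * G + 1) + 1)" by (simp add: field_simps)
      finally have "real g / (real g + 1) * (1 - \<delta>)
          \<le> real g / (real g + 1) * (real (2 * G + 1) / (real (2 * G + 1) + 1))"
        by (rule mult_left_mono) simp
      also have "\<dots> = real (g * (2 * G + 1)) / ((real g + 1) * (real (2 * G + 1) + 1))"
        by (simp only: of_nat_mult times_divide_times_eq)
      also have "\<dots> \<le> real (g * (2 * G + 1)) / real M"
      proof (rule divide_left_mono)
        show "real M \<le> (real g + 1) * (real (2 * G + 1) + 1)" by (simp add: M_def algebra_simps)
        show "0 < (real g + 1) * (real (2 * G + 1) + 1) * real M"
          using M by (simp add: zero_less_mult_iff add_nonneg_pos)
      qed simp
      finally show ?thesis .
    qed
    have "17 * real M / real K \<le> 17 * real M0 / real K" using M K0 by (simp add: divide_right_mono)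
    then have l2: "1 - \<delta> \<le> 1 - 17 * real M / real K" using KM by linarith
    have sp: "real (g * (2 * G + 1)) / (\<kappa> * real M) * T * (1 - 17 * real M / real K) \<le> real (SP n k)"
      unfolding \<kappa>_def M_def T_def n_def k_def
      by (rule SP_ge_mod_1[OF K0]) (use f in \<open>auto simp: g_def k_def\<close>)
    have "(1 - \<epsilon>) * MMS n k \<le> (1 - 3 * \<delta>) * MMS n k"
      using MMS_pos[of k n] \<delta>(3) by (intro mult_right_mono) (auto simp: k_def)
    also have "\<dots> \<le> (1 - \<delta>) * (1 - \<delta>) * (1 - \<delta>) * MMS n k"
      using MMS_pos[of k n] \<delta> one_minus_cube_le[of \<delta> "1 - \<delta>" "1 - \<delta>" "1 - \<delta>"]
      by (intro mult_right_mono) (auto simp: k_def)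
    also have "\<dots> \<le> (1 - \<delta>) * (1 - \<delta>) * (1 - \<delta>) * (T / \<kappa> * (\<kappa>\<^sup>2 / (\<kappa>\<^sup>2 + 1)))"
      using up \<delta> by (intro mult_left_mono) auto
    also have "\<dots> = (((1 - \<delta>) * (\<kappa>\<^sup>2 / (\<kappa>\<^sup>2 + 1))) * (1 - \<delta>)) * (T / \<kappa>) * (1 - \<delta>)" by (simp only: mult_ac)
    also have "\<dots> \<le> ((real g / (real g + 1)) * (1 - \<delta>)) * (T / \<kappa>) * (1 - \<delta>)"
      using gG \<delta> T0 \<kappa> by (intro mult_right_mono) auto
    also have "\<dots> \<le> (real (g * (2 * G + 1)) / real M) * (T / \<kappa>) * (1 - \<delta>)"
      using l1 \<delta> T0 \<kappa> by (intro mult_right_mono) auto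
    also have "\<dots> \<le> (real (g * (2 * G + 1)) / real M) * (T / \<kappa>) * (1 - 17 * real M / real K)"
      using l2 T0 \<kappa> by (intro mult_left_mono) auto
    also have "\<dots> = real (g * (2 * G + 1)) / (\<kappa> * real M) * T * (1 - 17 * real M / real K)" by simp
    also have "\<dots> \<le> real (SP n k)" by (rule sp)
    finally show "(1 - \<epsilon>) * MMS ((2 * h + 3) * (2 * f + 1) + 1) (2 * h + 3) \<le> real (SP ((2 * h + 3) * (2 * f + 1) + 1) (2 * h + 3))"
      unfolding n_def k_def .
  qed
qed

text \<open>For remainder \<open>k - 1\<close> the denominator of \<open>MMS\<close> is exactly 2,
  and \<open>T = \<kappa> * C\<close>. With \<open>g = 1\<close> the share
  \<open>(2 * G + 1) / M\<close> of even positions in a period tends to one half as \<open>G\<close>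
  grows.\<close>

lemma SP_asymp_lower_mod_minus_1:
  fixes \<epsilon> :: real
  assumes "0 < \<epsilon>"
  shows "\<exists>e0. \<forall>e h. e0 \<le> e \<longrightarrow>
    (1 - \<epsilon>) * MMS ((2 * h + 3) * (2 * e) + (2 * h + 2)) (2 * h + 3) \<le> real (SP ((2 * h + 3) * (2 * e) + (2 * h + 2)) (2 * h + 3))"
proof -
  define \<delta> where "\<delta> = min 1 (\<epsilon> / 3)"
  have \<delta>: "0 < \<delta>" "\<delta> \<le> 1" "3 * \<delta> \<le> \<epsilon>" using assms by (auto simp: \<delta>_def)
  obtain G :: nat where G: "1 / (real G + 1) \<le> \<delta>"
    using \<delta>(1) by (metis less_imp_le nat_approx_posE of_nat_Suc add.commute)
  define M where "M = 2 * (2 * G + 1) + 1"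
  obtain K :: nat where K: "real K > 17 * real M / \<delta>" using reals_Archimedean2 by blast
  have "real M > 0" by (simp add: M_def add_pos_nonneg)
  then have "17 * real M / \<delta> > 0" using \<delta> by simp
  then have K0: "K > 0" using K by (metis of_nat_0_less_iff order_less_trans)
  have KM: "17 * real M / real K \<le> \<delta>" using K \<delta>(1) K0 by (simp add: field_simps)
  show ?thesis
  proof (intro exI[of _ "4 * K ^ 2"] allI impI)
    fix e h :: nat assume e: "4 * K ^ 2 \<le> e"
    define k where "k = 2 * h + 3"
    define n where "n = k * (2 * e) + (k - 1)"
    define \<kappa> where "\<kappa> = real (k - 1)"
    define T where "T = real (n choose (2 * e + 1))"
    define C where "C = real (n choose (2 * e))"
    have k1: "k - 1 = 2 * h + 2" by (simp add: k_def)
    have e0: "e > 0" using e K0 by (cases e) auto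
    have \<kappa>: "\<kappa> \<ge> 2" by (simp add: \<kappa>_def k_def)
    have "k - 1 < k" by (simp add: k_def)
    moreover have "(k * (2 * e) + j) div k = 2 * e" "(k * (2 * e) + j) mod k = j" if "j < k" for j
      using that by simp_all
    ultimately have nd: "n div k = 2 * e" "n mod k = k - 1" unfolding n_def by blast+
    have rk: "real k = \<kappa> + 1" by (simp add: \<kappa>_def k_def)
    define c where "c = real (2 * e)"
    have c: "c > 0" using e0 by (simp add: c_def)
    have "real n = real k * c + \<kappa>" by (simp add: n_def c_def \<kappa>_def)
    then have rn: "real n = (\<kappa> + 1) * c + \<kappa>" by (simp only: rk)
    have nc: "real n - c = \<kappa> * (c + 1)" unfolding rn by (simp add: algebra_simps)
    have MMS: "MMS n k = C / 2"
      unfolding MMS_def Let_def nd C_def[symmetric] c_def[symmetric] nc \<kappa>_def[symmetric] rk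
      using \<kappa> c by simp
    have "real (2 * e + 1) * T = real (n - 2 * e) * C"
      unfolding T_def C_def by (metis Suc_times_choose_Suc Suc_eq_plus1 of_nat_mult)
    moreover have "real (2 * e + 1) = c + 1" by (simp add: c_def)
    ultimately have "(c + 1) * T = real (n - 2 * e) * C" by (simp only:)
    moreover have "2 * e \<le> n" by (simp add: n_def k_def algebra_simps)
    then have "real (n - 2 * e) = \<kappa> * (c + 1)" using nc by (simp add: of_nat_diff c_def)
    ultimately have "(c + 1) * T = (c + 1) * (\<kappa> * C)" by (simp only: mult_ac)
    then have T: "T = \<kappa> * C" using c by simp
    have C0: "C \<ge> 0" by (simp add: C_def)
    have M: "M > 0" by (simp add: M_def)
    have l1: "(1 - \<delta>) / 2 \<le> real (2 * G + 1) / real M"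
    proof -
      have "1 - \<delta> \<le> 1 - 1 / (real G + 1)" using G by simp
      also have "\<dots> \<le> 2 * (real (2 * G + 1) / real M)" by (simp add: M_def field_simps)
      finally show ?thesis by simp
    qed
    have l2: "1 - \<delta> \<le> 1 - 17 * real M / real K" using KM by linarith
    have sp: "real (2 * G + 1) / (\<kappa> * real M) * T * (1 - 17 * real M / real K) \<le> real (SP n k)"
      unfolding \<kappa>_def M_def T_def n_def k_def
      by (rule SP_ge_mod_minus_1[OF K0 _ e0]) (use e in simp)
    have "(1 - \<epsilon>) * MMS n k \<le> (1 - 3 * \<delta>) * MMS n k"
      using MMS_pos[of k n] \<delta>(3) by (intro mult_right_mono) (auto simp: k_def)
    also have "\<dots> \<le> ((1 - \<delta>) * (1 - \<delta>) * 1) * MMS n k"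
      using MMS_pos[of k n] \<delta> one_minus_cube_le[of \<delta> "1 - \<delta>" "1 - \<delta>" 1]
      by (intro mult_right_mono) (auto simp: k_def)
    also have "\<dots> = ((1 - \<delta>) / 2) * C * (1 - \<delta>)" by (simp add: MMS)
    also have "\<dots> \<le> (real (2 * G + 1) / real M) * C * (1 - \<delta>)"
      using l1 \<delta> C0 by (intro mult_right_mono) auto
    also have "\<dots> \<le> (real (2 * G + 1) / real M) * C * (1 - 17 * real M / real K)"
      using l2 C0 by (intro mult_left_mono) auto
    also have "\<dots> = real (2 * G + 1) / (\<kappa> * real M) * T * (1 - 17 * real M / real K)" using \<kappa> by (simp add: T)
    also have "\<dots> \<le> real (SP n k)" by (rule sp)
    finally show "(1 - \<epsilon>) * MMS ((2 * h + 3) * (2 * e) + (2 * h + 2)) (2 * h + 3) \<le> real (SP ((2 * h + 3) * (2 * e) + (2 * h + 2)) (2 * h + 3))"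
      unfolding n_def k1 unfolding k_def .
  qed
qed

theorem theorem4:
  shows "(\<forall>n k :: nat \<Rightarrow> nat.
            filterlim n at_top sequentially \<longrightarrow>
            (\<forall>i. k i \<le> n i) \<longrightarrow>
            (\<forall>i. [n i = k i + 1] (mod 2 * k i)) \<longrightarrow>
            (\<lambda>i. real (k i)) \<in> o[sequentially](\<lambda>i. real (n i)) \<longrightarrow>
            (\<forall>i. k i \<ge> 3 \<and> odd (k i)) \<longrightarrow>
            (\<lambda>i. real (SP (n i) (k i))) \<sim>[sequentially] (\<lambda>i. MMS (n i) (k i)))
       \<and> (\<forall>n k :: nat \<Rightarrow> nat.
            filterlim n at_top sequentially \<longrightarrow>
            (\<forall>i. k i \<le> n i) \<longrightarrow>
            (\<forall>i. [n i = k i - 1] (mod 2 * k i)) \<longrightarrow>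
            (\<lambda>i. real (k i)) \<in> o[sequentially](\<lambda>i. real (n i)) \<longrightarrow>
            (\<forall>i. k i \<ge> 5 \<and> odd (k i)) \<longrightarrow>
            (\<lambda>i. real (SP (n i) (k i))) \<sim>[sequentially] (\<lambda>i. MMS (n i) (k i)))"
proof (intro conjI allI impI)
  fix n k :: "nat \<Rightarrow> nat"
  assume kn: "\<forall>i. k i \<le> n i" and cong: "\<forall>i. [n i = k i + 1] (mod 2 * k i)"
    and small: "(\<lambda>i. real (k i)) \<in> o(\<lambda>i. real (n i))" and k: "\<forall>i. k i \<ge> 3 \<and> odd (k i)"
  define q where "q i = n i div (2 * k i)" for i
  have "\<exists>h. k i = 2 * h + 3" for i using k[rule_format, of i] by presburger
  then obtain h where h: "\<And>i. k i = 2 * h i + 3" by metis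
  \<comment> \<open>\<open>k i + 1\<close> is below \<open>2 * k i\<close>, so it is the remainder
    modulo \<open>2 * k i\<close>. The quotient by \<open>k i\<close> is then
    \<open>2 * q i + 1\<close> with remainder 1, and \<open>q i\<close> plays the role of
    \<open>f\<close>.\<close>
  have nq: "n i = k i * (2 * q i + 1) + 1" for i
  proof -
    have "n i mod (2 * k i) = (k i + 1) mod (2 * k i)" using cong by (simp add: cong_def)
    also have "\<dots> = k i + 1" by (rule mod_less) (simp add: h)
    finally show ?thesis using div_mult_mod_eq[of "n i" "2 * k i"] by (simp add: q_def algebra_simps)
  qed
  show "(\<lambda>i. real (SP (n i) (k i))) \<sim>[sequentially] (\<lambda>i. MMS (n i) (k i))"
  proof (rule SP_asymp_equiv_MMS[where q = q])
    show "n i < 2 * k i * (q i + 1)" for i by (simp add: nq h algebra_simps)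
    fix \<epsilon> :: real assume "0 < \<epsilon>"
    from SP_asymp_lower_mod_1[OF this] show "\<exists>c. \<forall>i. c \<le> q i \<longrightarrow> (1 - \<epsilon>) * MMS (n i) (k i) \<le> real (SP (n i) (k i))"
      unfolding nq h by blast
  qed (use kn small h in auto)
next
  fix n k :: "nat \<Rightarrow> nat"
  assume kn: "\<forall>i. k i \<le> n i" and cong: "\<forall>i. [n i = k i - 1] (mod 2 * k i)"
    and small: "(\<lambda>i. real (k i)) \<in> o(\<lambda>i. real (n i))" and k: "\<forall>i. k i \<ge> 5 \<and> odd (k i)"
  define q where "q i = n i div (2 * k i)" for i
  have "\<exists>h. k i = 2 * h + 3" for i using k[rule_format, of i] by presburger
  then obtain h where h: "\<And>i. k i = 2 * h i + 3" by metis
  \<comment> \<open>Now the quotient by \<open>k i\<close> is even, namely \<open>2 * q i\<close>,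
    and \<open>q i\<close> plays the role of \<open>e\<close>.\<close>
  have nq: "n i = k i * (2 * q i) + (2 * h i + 2)" for i
  proof -
    have "n i mod (2 * k i) = (k i - 1) mod (2 * k i)" using cong by (simp add: cong_def)
    also have "\<dots> = k i - 1" by (rule mod_less) (simp add: h)
    finally show ?thesis using div_mult_mod_eq[of "n i" "2 * k i"] by (simp add: q_def algebra_simps h)
  qed
  show "(\<lambda>i. real (SP (n i) (k i))) \<sim>[sequentially] (\<lambda>i. MMS (n i) (k i))"
  proof (rule SP_asymp_equiv_MMS[where q = q])
    show "n i < 2 * k i * (q i + 1)" for i by (simp add: nq h algebra_simps)
    fix \<epsilon> :: real assume "0 < \<epsilon>"
    from SP_asymp_lower_mod_minus_1[OF this] show "\<exists>c. \<forall>i. c \<le> q i \<longrightarrow> (1 - \<epsilon>) * MMS (n i) (k i) \<le> real (SP (n i) (k i))"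
      unfolding nq h by blast
  qed (use kn small h in auto)
qed

end
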